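(* Consider the feedback loop of $N$ agents, a linear filter $\mathcal F$ and a linear controller $\mathcal C$ described in the context. Assume that each agent $i\in\{1,\dots,N\}$ has state $x_i$ governed by the affine stochastic difference equations $$x_i(k+1)=A_ix_i(k)+b_i,\qquad y_i(k)=c_i^Tx_i(k)+d_i,$$ where $A_i\in\mathbb R^{n_i\times n_i}$ are Schur matrices, $c_i\in\mathbb R^{n_i}$, and $b_i$ and $d_i$ are chosen, at each time step, from the finite sets $\{b_{ij}: j=1,\dots,w_i\}\subset\mathbb R^{n_i}$ and $\{d_{i\ell}:\ell=1,\dots,h_i\}\subset\mathbb R$ according to Dini continuous probability functions $p_{ij}:\Pi\to[0,1]$, respectively $p'_{i\ell}:\Pi\to[0,1]$; that is, at time $k$, $\mathbb P(b_i=b_{ij})=p_{ij}(\pi(k))$ and $\mathbb P(d_i=d_{i\ell})=p'_{i\ell}(\pi(k))$, with $\sum_{j=1}^{w_i}p_{ij}(\pi)=\sum_{\ell=1}^{h_i}p'_{i\ell}(\pi)=1$ for all $\pi\in\Pi$ and all $i$. Assume furthermore that there are scalars $\delta,\delta'>0$ such that $p_{ij}(\pi)\ge\delta>0$ for all $(i,j)$ and $p'_{i\ell}(\pi)\ge\delta'>0$ for all $(i,\ell)$, for all $\pi\in\Pi$. Then, for every stable linear controller $\mathcal C$ and every stable linear filter $\mathcal F$ compatible with the system structure, the feedback loop converges in distribution to a unique invariant measure.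
   Context: Closed loop (discrete time). The aggregate output is $y(k)=\sum_{i=1}^N y_i(k)$. The filter is $$\mathcal F:\quad x_f(k+1)=A_fx_f(k)+B_fy(k),\qquad \hat y(k)=C_fx_f(k),\qquad x_f(k)\in\mathbb R^{n_f}.$$ The error is $e(k)=r-\hat y(k)$ with $r$ a constant reference value. The controller is $$\mathcal C:\quad x_c(k+1)=A_cx_c(k)+B_ce(k),\qquad \pi(k)=C_cx_c(k)+D_ce(k),\qquad x_c(k)\in\mathbb R^{n_c}.$$ Signals $y,\hat y,e,\pi$ are scalar, and matrices have compatible dimensions. $\Pi\subseteq\mathbb R$ is the set of admissible broadcast signals, containing all values of $\pi(k)$. A Schur matrix is one with all eigenvalues in the open unit disc; "stable" controller/filter means that $A_c$, respectively $A_f$, is Schur. Conditioned on the current overall state (hence on $\pi(k)$), the choices of all $b_i$ and $d_i$, $i=1,\dots,N$, at time $k$ are stochastically independent. The closed loop is thus a time-homogeneous Markov chain with state $\xi=(x_1,\dots,x_N,x_f,x_c)$. A function $p$ is Dini continuous if its modulus of continuity $\omega(t)=\sup_{|s-s'|\le t}|p(s)-p(s')|$ satisfies $\int_0^{1}\omega(t)/t\,dt<\infty$. "Converges in distribution to a unique invariant measure" means that the Markov chain has a unique invariant probability measure $\mu$ and, for every initial distribution, the law of $\xi(k)$ converges to $\mu$ in distribution (weakly) as $k\to\infty$. *)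

theory Defs
  imports
    "HOL-Probability.Probability"
    "HOL-Probability.Product_PMF"
    "Jordan_Normal_Form.Spectral_Radius"
begin

unbundle no vec_syntax
unbundle no inner_syntax

text \<open>
  The dimensions of vectors and matrices are natural numbers that may differ from agent to agent.
  All signals are scalar; hence the one-column matrices
  \<open>B\<^sub>f\<close>, \<open>B\<^sub>c\<close> and the one-row matrices \<open>c\<^sub>i\<^sup>T\<close>, \<open>C\<^sub>f\<close>, \<open>C\<^sub>c\<close> are given as vectors, and \<open>D\<^sub>c\<close> as a number.
\<close>

text \<open>
  The offsets are \<open>ag_b j\<close> for \<open>j \<in> {1..ag_w}\<close> and \<open>ag_d l\<close> for \<open>l \<in> {1..ag_h}\<close>; they are chosen with
  probabilities \<open>ag_p j s\<close> and \<open>ag_p' l s\<close> when \<open>s\<close> is the broadcast signal.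
\<close>

record affine_agent =
  ag_dim :: nat
  ag_A :: "real mat"
  ag_c :: "real vec"
  ag_w :: nat
  ag_b :: "nat \<Rightarrow> real vec"
  ag_p :: "nat \<Rightarrow> real \<Rightarrow> real"
  ag_h :: nat
  ag_d :: "nat \<Rightarrow> real"
  ag_p' :: "nat \<Rightarrow> real \<Rightarrow> real"

record linear_filter =
  fi_dim :: nat
  fi_A :: "real mat"
  fi_B :: "real vec"
  fi_C :: "real vec"

record linear_controller =
  co_dim :: nat
  co_A :: "real mat"
  co_B :: "real vec"
  co_C :: "real vec"
  co_D :: real

definition schur :: "real mat \<Rightarrow> bool" where
  "schur A \<longleftrightarrow> (\<forall>z. eigenvalue (map_mat complex_of_real A) z \<longrightarrow> cmod z < 1)"

definition agent_dims :: "affine_agent \<Rightarrow> bool" where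
  "agent_dims a \<longleftrightarrow>
     ag_A a \<in> carrier_mat (ag_dim a) (ag_dim a) \<and>
     ag_c a \<in> carrier_vec (ag_dim a) \<and>
     (\<forall>j\<in>{1..ag_w a}. ag_b a j \<in> carrier_vec (ag_dim a))"

definition filter_dims :: "linear_filter \<Rightarrow> bool" where
  "filter_dims F \<longleftrightarrow>
     fi_A F \<in> carrier_mat (fi_dim F) (fi_dim F) \<and>
     fi_B F \<in> carrier_vec (fi_dim F) \<and>
     fi_C F \<in> carrier_vec (fi_dim F)"

definition controller_dims :: "linear_controller \<Rightarrow> bool" where
  "controller_dims C \<longleftrightarrow>
     co_A C \<in> carrier_mat (co_dim C) (co_dim C) \<and>
     co_B C \<in> carrier_vec (co_dim C) \<and>
     co_C C \<in> carrier_vec (co_dim C)"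

text \<open>
  The supremum is taken in \<^typ>\<open>ennreal\<close>, so that it is \<open>\<infinity>\<close> where the differences are unbounded.
\<close>

definition modulus_of_continuity :: "real set \<Rightarrow> (real \<Rightarrow> real) \<Rightarrow> real \<Rightarrow> ennreal" where
  "modulus_of_continuity S p t =
     (SUP (s, s') \<in> {(s, s'). s \<in> S \<and> s' \<in> S \<and> \<bar>s - s'\<bar> \<le> t}. ennreal \<bar>p s - p s'\<bar>)"

definition Dini_continuous_on :: "real set \<Rightarrow> (real \<Rightarrow> real) \<Rightarrow> bool" where
  "Dini_continuous_on S p \<longleftrightarrow>
     (\<integral>\<^sup>+ t \<in> {0<..1}. (modulus_of_continuity S p t / ennreal t) \<partial>lborel) < \<infinity>"

type_synonym state = "(nat \<Rightarrow> real vec) \<times> real vec \<times> real vec"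

text \<open>The Euclidean topology, transported along the coordinates.\<close>

definition vec_topology :: "nat \<Rightarrow> real vec topology" where
  "vec_topology n =
     pullback_topology (carrier_vec n) (\<lambda>v. \<lambda>i\<in>{..<n}. v $ i)
       (product_topology (\<lambda>_. euclideanreal) {..<n})"

text \<open>
  Its points are the triples \<open>((x\<^sub>1, \<dots>, x\<^sub>N), x\<^sub>f, x\<^sub>c)\<close> of vectors of the right dimensions, where
  \<open>(x\<^sub>1, \<dots>, x\<^sub>N)\<close> is an extensional function on \<open>{1..N}\<close>.
\<close>

definition state_topology ::
    "nat \<Rightarrow> (nat \<Rightarrow> affine_agent) \<Rightarrow> linear_filter \<Rightarrow> linear_controller \<Rightarrow> state topology" where
  "state_topology N ag F C =
     prod_topology (product_topology (\<lambda>i. vec_topology (ag_dim (ag i))) {1..N})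
       (prod_topology (vec_topology (fi_dim F)) (vec_topology (co_dim C)))"

definition borel_of_topology :: "'a topology \<Rightarrow> 'a measure" where
  "borel_of_topology X = sigma (topspace X) {U. openin X U}"

definition control_error :: "real \<Rightarrow> linear_filter \<Rightarrow> state \<Rightarrow> real" where
  "control_error r F = (\<lambda>(x, x\<^sub>f, x\<^sub>c). r - scalar_prod (fi_C F) x\<^sub>f)"

definition broadcast :: "real \<Rightarrow> linear_filter \<Rightarrow> linear_controller \<Rightarrow> state \<Rightarrow> real" where
  "broadcast r F C =
     (\<lambda>(x, x\<^sub>f, x\<^sub>c). scalar_prod (co_C C) x\<^sub>c + co_D C * control_error r F (x, x\<^sub>f, x\<^sub>c))"

text \<open>In the functions below, \<open>\<beta> i = (j, l)\<close> means that \<open>b\<^sub>i = b\<^sub>i\<^sub>j\<close> and \<open>d\<^sub>i = d\<^sub>i\<^sub>l\<close> are chosen.\<close>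

definition aggregate_output ::
    "nat \<Rightarrow> (nat \<Rightarrow> affine_agent) \<Rightarrow> (nat \<Rightarrow> nat \<times> nat) \<Rightarrow> state \<Rightarrow> real" where
  "aggregate_output N ag \<beta> =
     (\<lambda>(x, x\<^sub>f, x\<^sub>c). \<Sum>i=1..N. scalar_prod (ag_c (ag i)) (x i) + ag_d (ag i) (snd (\<beta> i)))"

definition next_state ::
    "nat \<Rightarrow> (nat \<Rightarrow> affine_agent) \<Rightarrow> real \<Rightarrow> linear_filter \<Rightarrow> linear_controller \<Rightarrow>
     (nat \<Rightarrow> nat \<times> nat) \<Rightarrow> state \<Rightarrow> state" where
  "next_state N ag r F C \<beta> =
     (\<lambda>(x, x\<^sub>f, x\<^sub>c).
       (\<lambda>i\<in>{1..N}. ag_A (ag i) *\<^sub>v x i + ag_b (ag i) (fst (\<beta> i)),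
        fi_A F *\<^sub>v x\<^sub>f + aggregate_output N ag \<beta> (x, x\<^sub>f, x\<^sub>c) \<cdot>\<^sub>v fi_B F,
        co_A C *\<^sub>v x\<^sub>c + control_error r F (x, x\<^sub>f, x\<^sub>c) \<cdot>\<^sub>v co_B C))"

text \<open>Meaningful only if the \<open>q j\<close> are nonnegative and sum to 1.\<close>

definition index_pmf :: "nat \<Rightarrow> (nat \<Rightarrow> real) \<Rightarrow> nat pmf" where
  "index_pmf m q = embed_pmf (\<lambda>j. if j \<in> {1..m} then q j else 0)"

text \<open>Given the broadcast signal \<open>s\<close>, all \<open>2N\<close> choices are independent.\<close>

definition choice_pmf ::
    "nat \<Rightarrow> (nat \<Rightarrow> affine_agent) \<Rightarrow> real \<Rightarrow> (nat \<Rightarrow> nat \<times> nat) pmf" where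
  "choice_pmf N ag s =
     Pi_pmf {1..N} (0, 0)
       (\<lambda>i. pair_pmf (index_pmf (ag_w (ag i)) (\<lambda>j. ag_p (ag i) j s))
                      (index_pmf (ag_h (ag i)) (\<lambda>l. ag_p' (ag i) l s)))"

definition loop_kernel ::
    "nat \<Rightarrow> (nat \<Rightarrow> affine_agent) \<Rightarrow> real \<Rightarrow> linear_filter \<Rightarrow> linear_controller \<Rightarrow>
     state \<Rightarrow> state measure" where
  "loop_kernel N ag r F C \<xi> =
     distr (measure_pmf (choice_pmf N ag (broadcast r F C \<xi>)))
       (borel_of_topology (state_topology N ag F C))
       (\<lambda>\<beta>. next_state N ag r F C \<beta> \<xi>)"

definition probability_on :: "'a topology \<Rightarrow> 'a measure \<Rightarrow> bool" where
  "probability_on X \<mu> \<longleftrightarrow> prob_space \<mu> \<and> sets \<mu> = sets (borel_of_topology X)"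

definition converges_weakly :: "'a topology \<Rightarrow> (nat \<Rightarrow> 'a measure) \<Rightarrow> 'a measure \<Rightarrow> bool" where
  "converges_weakly X \<mu>s \<mu> \<longleftrightarrow>
     (\<forall>f. continuous_map X euclideanreal f \<longrightarrow> bounded (f ` topspace X) \<longrightarrow>
        (\<lambda>k. \<integral>x. f x \<partial>\<mu>s k) \<longlonglongrightarrow> (\<integral>x. f x \<partial>\<mu>))"

definition law_at :: "('a \<Rightarrow> 'a measure) \<Rightarrow> 'a measure \<Rightarrow> nat \<Rightarrow> 'a measure" where
  "law_at K \<mu>\<^sub>0 k = ((\<lambda>\<mu>. \<mu> \<bind> K) ^^ k) \<mu>\<^sub>0"

definition invariant_probability :: "'a topology \<Rightarrow> ('a \<Rightarrow> 'a measure) \<Rightarrow> 'a measure \<Rightarrow> bool" where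
  "invariant_probability X K \<mu> \<longleftrightarrow> probability_on X \<mu> \<and> \<mu> \<bind> K = \<mu>"

definition converges_to_unique_invariant :: "'a topology \<Rightarrow> ('a \<Rightarrow> 'a measure) \<Rightarrow> bool" where
  "converges_to_unique_invariant X K \<longleftrightarrow>
     (\<exists>\<mu>. invariant_probability X K \<mu> \<and>
          (\<forall>\<nu>. invariant_probability X K \<nu> \<longrightarrow> \<nu> = \<mu>) \<and>
          (\<forall>\<mu>\<^sub>0. probability_on X \<mu>\<^sub>0 \<longrightarrow> converges_weakly X (law_at K \<mu>\<^sub>0) \<mu>))"

end

theory Submission
  imports Defs
begin

text \<open>
  All maps of the loop have the same linear part: two copies of the loop that make the same choices
  differ by the free response of the cascade agents, filter, controller, which decays geometrically
  because the diagonal blocks are Schur. In a suitable metric (\<open>loop_dist\<close>, built from norms adapted to the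
  blocks, \<open>schur_lyapunov_norm\<close>) the loop is a system of finitely many contractions of a space with compact
  balls, chosen with probabilities that depend on the current point. These probabilities are bounded
  below, and their modulus of continuity \<open>\<omega>\<close> is summable along every geometric sequence, which is what
  Dini continuity means here (\<open>Dini_summable\<close>).

  For such a system (\<open>place_dependent_ifs\<close>) the two conditions on the probabilities give bounded
  distortion: the probabilities of a finite word of choices from two starting points agree up to a
  factor that does not depend on the word and tends to 1 as the points approach each other
  (\<open>word_prob_ratio_near\<close>, \<open>word_prob_ratio_bounded\<close>). Hence a fixed fraction of the random words seen from
  one point can be matched with the same words seen from the other one, and along matched words the
  orbits merge. This makes the oscillation of the iterates of the Markov operator on a bounded
  continuous function \<open>f\<close> tend to 0 on every bounded set (\<open>oscillation_step\<close>, \<open>oscillation_vanishes\<close>), so that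
  the iterates converge to a constant, \<open>ergodic_mean f\<close>.

  It remains to represent this constant as an integral. For the probability of a word as the function
  \<open>f\<close>, it is the asymptotic frequency of the word. These frequencies are consistent and define a random
  infinite past of choices (\<open>letter_process_exists\<close>). Composing the contractions along this past gives a
  convergent sequence of points, and the law of its limit has the required integrals
  (\<open>ergodic_measure_exists\<close>). Since the integral of \<open>f\<close> against the law at time \<open>k\<close> is the integral of the
  \<open>k\<close>-th iterate of \<open>f\<close> against the initial law, convergence from every initial law, invariance and
  uniqueness follow (\<open>converges_to_unique_invariant_kernel\<close>).
\<close>

section \<open>Real-valued continuous functions on metric spaces\<close>

abbreviation (in Metric_space) continuous_real :: "('a \<Rightarrow> real) \<Rightarrow> bool" where
  "continuous_real \<equiv> continuous_map mtopology euclideanreal"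

lemma (in Metric_space) continuous_map_to_real_iff:
  "continuous_real f \<longleftrightarrow>
     (\<forall>x\<in>M. \<forall>e>0. \<exists>t>0. \<forall>y\<in>M. d x y < t \<longrightarrow> \<bar>f x - f y\<bar> < e)"
  using metric_continuous_map[OF Met_TC.Metric_space_axioms, of f, unfolded mtopology_is_euclidean]
  by (simp add: dist_real_def Ball_def imp_conjL)

text \<open>
  Only one of the two points has to lie in the compact set: a Lebesgue number of a cover of \<open>K\<close> by
  balls on which \<open>f\<close> oscillates little does not care where the second point is.
\<close>

lemma (in Metric_space) uniformly_continuous_near_compact:
  assumes K: "compactin mtopology K" and f: "continuous_real f" and e: "0 < e"
  obtains t where "t > 0" "\<And>x y. x \<in> K \<Longrightarrow> y \<in> M \<Longrightarrow> d x y < t \<Longrightarrow> \<bar>f x - f y\<bar> < e"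
proof -
  have KM: "K \<subseteq> M"
    using compactin_subset_topspace[OF K] by simp
  have "\<forall>x\<in>K. \<exists>t>0. \<forall>y\<in>M. d x y < t \<longrightarrow> \<bar>f x - f y\<bar> < e/2"
    using f e KM unfolding continuous_map_to_real_iff by (meson half_gt_zero subsetD)
  then obtain t where t: "\<And>x. x \<in> K \<Longrightarrow> t x > 0"
    "\<And>x y. x \<in> K \<Longrightarrow> y \<in> M \<Longrightarrow> d x y < t x \<Longrightarrow> \<bar>f x - f y\<bar> < e/2"
    by metis
  have "\<exists>F. finite F \<and> F \<subseteq> (\<lambda>x. mball x (t x / 2)) ` K \<and> K \<subseteq> \<Union>F"
  proof -
    have "\<forall>U\<in>(\<lambda>x. mball x (t x / 2)) ` K. openin mtopology U" by auto
    moreover have "K \<subseteq> \<Union>((\<lambda>x. mball x (t x / 2)) ` K)"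
      using t(1) KM by (fastforce simp: in_mball)
    ultimately show ?thesis
      using K unfolding compactin_def by simp
  qed
  then obtain F where F: "finite F" "F \<subseteq> (\<lambda>x. mball x (t x / 2)) ` K" "K \<subseteq> \<Union>F"
    by blast
  obtain G where G: "finite G" "G \<subseteq> K" "K \<subseteq> (\<Union>x\<in>G. mball x (t x / 2))"
    using finite_subset_image[OF F(1,2)] F(3) by blast
  define s where "s = Min (insert 1 ((\<lambda>x. t x / 2) ` G))"
  have s: "s > 0"
    unfolding s_def using G(1,2) t(1) by (auto simp: subset_iff)
  have s_le: "s \<le> t x / 2" if "x \<in> G" for x
    unfolding s_def using G(1) that by (intro Min_le) auto
  show thesis
  proof (rule that[OF s])
    fix x y assume xy: "x \<in> K" "y \<in> M" "d x y < s"
    then have x: "x \<in> M" "x \<in> (\<Union>x\<in>G. mball x (t x / 2))" using G(3) KM by blast+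
    then obtain z where z: "z \<in> G" "d z x < t z / 2" "x \<in> M"
      unfolding UN_iff in_mball by blast
    have zM: "z \<in> K" "z \<in> M" using z G KM by auto
    have "d z y \<le> d z x + d x y" using triangle zM z xy by blast
    with s_le[OF z(1)] z xy have zy: "d z y < t z" by linarith
    have zx: "d z x < t z" using z t(1)[of z] zM by linarith
    have "\<bar>f z - f y\<bar> < e/2" "\<bar>f z - f x\<bar> < e/2"
      using t(2)[OF zM(1) xy(2) zy] t(2)[OF zM(1) z(3) zx] by auto
    then show "\<bar>f x - f y\<bar> < e" by linarith
  qed
qed

section \<open>Iterated function systems with place-dependent probabilities\<close>

text \<open>
  A finite family of contractions with a common rate \<open>\<rho>\<close>; at the point \<open>x\<close> the map \<open>T b\<close> is applied with
  probability \<open>pmf (c x) b\<close>. The series condition on the modulus \<open>\<omega>\<close> is the discrete form of Dini continuity.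
  It controls two orbits that follow the same word: their distance at
  time \<open>n\<close> is at most \<open>R \<rho>\<^sup>n\<close>, so that the total discrepancy of the probabilities along the orbits is finite.
\<close>

locale place_dependent_ifs = Metric_space M d for M :: "'a set" and d +
  fixes B :: "'b set" and T :: "'b \<Rightarrow> 'a \<Rightarrow> 'a" and c :: "'a \<Rightarrow> 'b pmf"
    and \<rho> \<delta> :: real and \<omega> :: "real \<Rightarrow> real"
  assumes nonempty: "M \<noteq> {}"
    and finite_letters: "finite B"
    and T_closed: "\<And>b x. b \<in> B \<Longrightarrow> x \<in> M \<Longrightarrow> T b x \<in> M"
    and contraction: "\<And>b x y. b \<in> B \<Longrightarrow> x \<in> M \<Longrightarrow> y \<in> M \<Longrightarrow> d (T b x) (T b y) \<le> \<rho> * d x y"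
    and rho: "0 < \<rho>" "\<rho> < 1"
    and letters: "\<And>x. x \<in> M \<Longrightarrow> set_pmf (c x) \<subseteq> B"
    and delta_pos: "0 < \<delta>"
    and delta_le: "\<And>b x. b \<in> B \<Longrightarrow> x \<in> M \<Longrightarrow> \<delta> \<le> pmf (c x) b"
    and modulus: "\<And>b x y. b \<in> B \<Longrightarrow> x \<in> M \<Longrightarrow> y \<in> M \<Longrightarrow> \<bar>pmf (c x) b - pmf (c y) b\<bar> \<le> \<omega> (d x y)"
    and modulus_mono: "\<And>s t. 0 \<le> s \<Longrightarrow> s \<le> t \<Longrightarrow> \<omega> s \<le> \<omega> t"
    and modulus_summable: "\<And>R. 0 < R \<Longrightarrow> summable (\<lambda>n. \<omega> (R * \<rho> ^ n))"
    and compact_cballs: "\<And>x R. x \<in> M \<Longrightarrow> compactin mtopology (mcball x R)"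
begin

text \<open>
  Words are read in the order in which the letters are applied: \<open>fold T w x\<close> is the point reached from \<open>x\<close>
  along \<open>w\<close>, and \<open>word_prob x w\<close> the probability that the first \<open>length w\<close> letters chosen are those of \<open>w\<close>.
  The operator \<open>transfer\<close> is the Markov operator of the system acting on functions.
\<close>

definition words :: "nat \<Rightarrow> 'b list set" where
  "words n = {w. set w \<subseteq> B \<and> length w = n}"

primrec word_prob :: "'a \<Rightarrow> 'b list \<Rightarrow> real" where
  "word_prob x [] = 1"
| "word_prob x (a # w) = pmf (c x) a * word_prob (T a x) w"

definition transfer :: "('a \<Rightarrow> real) \<Rightarrow> 'a \<Rightarrow> real" where
  "transfer f x = (\<Sum>b\<in>B. pmf (c x) b * f (T b x))"

lemma pmf_sum_letters: "x \<in> M \<Longrightarrow> (\<Sum>b\<in>B. pmf (c x) b) = 1"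
  using letters finite_letters by (simp add: sum_pmf_eq_1)

lemma power_rate_small:
  assumes "0 < t"
  shows "\<exists>n0. \<forall>n\<ge>n0. \<rho> ^ n * R < t"
proof -
  have "(\<lambda>n. \<rho> ^ n * R) \<longlonglongrightarrow> 0 * R"
    using rho by (intro tendsto_mult LIMSEQ_realpow_zero tendsto_const) auto
  then have "eventually (\<lambda>n. \<rho> ^ n * R < t) sequentially"
    using assms by (intro order_tendstoD) auto
  then show ?thesis by (simp add: eventually_sequentially)
qed

lemma finite_words: "finite (words n)"
  unfolding words_def using finite_lists_length_eq[OF finite_letters] .

lemma sum_words_Suc: "(\<Sum>w\<in>words (Suc n). g w) = (\<Sum>a\<in>B. \<Sum>w\<in>words n. g (a # w))"
proof -
  have "words (Suc n) = (\<lambda>(a, w). a # w) ` (B \<times> words n)"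
    by (auto simp: words_def length_Suc_conv)
  moreover have "inj_on (\<lambda>(a, w). a # w) (B \<times> words n)"
    by (auto simp: inj_on_def)
  ultimately show ?thesis
    by (simp add: sum.reindex sum.cartesian_product case_prod_unfold)
qed

lemma words_0: "words 0 = {[]}"
  by (auto simp: words_def)

lemma fold_closed: "set w \<subseteq> B \<Longrightarrow> x \<in> M \<Longrightarrow> fold T w x \<in> M"
  by (induction w arbitrary: x) (auto simp: T_closed)

lemma fold_contraction:
  "set w \<subseteq> B \<Longrightarrow> x \<in> M \<Longrightarrow> y \<in> M \<Longrightarrow> d (fold T w x) (fold T w y) \<le> \<rho> ^ length w * d x y"
proof (induction w arbitrary: x y)
  case (Cons a w)
  have "d (fold T w (T a x)) (fold T w (T a y)) \<le> \<rho> ^ length w * d (T a x) (T a y)"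
    using Cons by (simp add: T_closed)
  also have "\<dots> \<le> \<rho> ^ length w * (\<rho> * d x y)"
    using Cons contraction rho by (intro mult_left_mono) auto
  finally show ?case by (simp add: mult_ac)
qed simp

lemma word_prob_nonneg: "0 \<le> word_prob x w"
  by (induction w arbitrary: x) auto

lemma word_prob_ge: "set w \<subseteq> B \<Longrightarrow> x \<in> M \<Longrightarrow> \<delta> ^ length w \<le> word_prob x w"
proof (induction w arbitrary: x)
  case (Cons a w)
  then show ?case
    using delta_pos by (auto intro!: mult_mono delta_le simp: T_closed)
qed simp

lemma word_prob_le_1: "word_prob x w \<le> 1"
proof (induction w arbitrary: x)
  case (Cons a w)
  then show ?case
    using mult_mono[of "pmf (c x) a" 1 "word_prob (T a x) w" 1] by (simp add: word_prob_nonneg pmf_le_1)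
qed simp

lemma sum_word_prob: "x \<in> M \<Longrightarrow> (\<Sum>w\<in>words n. word_prob x w) = 1"
  by (induction n arbitrary: x)
    (simp_all add: words_0 sum_words_Suc T_closed pmf_sum_letters flip: sum_distrib_left)

lemma word_prob_append: "word_prob x (v @ w) = word_prob x v * word_prob (fold T v x) w"
  by (induction v arbitrary: x) auto

lemma transfer_power:
  "x \<in> M \<Longrightarrow> (transfer ^^ n) f x = (\<Sum>w\<in>words n. word_prob x w * f (fold T w x))"
proof (induction n arbitrary: x)
  case (Suc n)
  then show ?case
    by (simp add: sum_words_Suc transfer_def T_closed sum_distrib_left mult.assoc)
qed (simp add: words_0)

lemma transfer_power_bound:
  assumes "x \<in> M" "\<And>x. x \<in> M \<Longrightarrow> \<bar>f x\<bar> \<le> D"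
  shows "\<bar>(transfer ^^ n) f x\<bar> \<le> D"
proof -
  have "\<bar>(transfer ^^ n) f x\<bar> \<le> (\<Sum>w\<in>words n. \<bar>word_prob x w * f (fold T w x)\<bar>)"
    using assms by (simp add: transfer_power)
  also have "\<dots> \<le> (\<Sum>w\<in>words n. word_prob x w * D)"
    using assms(1) by (intro sum_mono)
      (auto simp: abs_mult word_prob_nonneg words_def intro!: mult_left_mono assms(2) fold_closed)
  also have "\<dots> = D" using assms(1) by (simp add: sum_word_prob flip: sum_distrib_right)
  finally show ?thesis .
qed

section \<open>Bounded distortion of word probabilities\<close>

lemma modulus_nonneg: "0 \<le> t \<Longrightarrow> 0 \<le> \<omega> t"
proof -
  obtain x where x: "x \<in> M" using nonempty by auto
  then obtain b where b: "b \<in> B" using letters[OF x] set_pmf_not_empty[of "c x"] by blast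
  assume "0 \<le> t"
  then have "\<omega> 0 \<le> \<omega> t" by (simp add: modulus_mono)
  moreover have "0 \<le> \<omega> 0" using modulus[OF b x x] x by simp
  ultimately show ?thesis by simp
qed

lemma modulus_tail:
  assumes "0 < e"
  obtains t where "0 < t" "(\<Sum>n. \<omega> (t * \<rho> ^ n)) < e"
proof -
  have s: "summable (\<lambda>n. \<omega> (1 * \<rho> ^ n))" by (rule modulus_summable) simp
  obtain m where "\<forall>n\<ge>m. norm (\<Sum>i. \<omega> (1 * \<rho> ^ (i + n))) < e"
    using suminf_exist_split[OF assms s] by auto
  then have "(\<Sum>i. \<omega> (\<rho> ^ m * \<rho> ^ i)) < e"
    by (force simp: power_add mult.commute)
  then show thesis using rho by (intro that[of "\<rho> ^ m"]) auto
qed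

lemma modulus_le_tail:
  assumes "0 < t" shows "\<omega> t \<le> (\<Sum>n. \<omega> (t * \<rho> ^ n))"
proof -
  have "0 \<le> \<omega> (t * \<rho> ^ n)" for n using assms rho by (intro modulus_nonneg) auto
  then show ?thesis using sum_le_suminf[OF modulus_summable[OF assms], of "{0}"] by simp
qed

lemma modulus_small:
  assumes "0 < e"
  obtains t where "0 < t" "\<And>s. 0 \<le> s \<Longrightarrow> s \<le> t \<Longrightarrow> \<omega> s < e"
proof -
  obtain t where t: "0 < t" "(\<Sum>n. \<omega> (t * \<rho> ^ n)) < e" using modulus_tail[OF assms] .
  show thesis
    by (rule that[OF t(1)]) (use t modulus_le_tail[OF t(1)] modulus_mono in \<open>fastforce\<close>)
qed

text \<open>
  Along a word the two orbits contract, and at each step the lower bound \<open>\<delta>\<close> turns the additive error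
  \<open>\<omega>\<close> of a probability into the factor \<open>1 - \<omega> / \<delta>\<close>.
\<close>

lemma word_prob_ratio_product:
  assumes "set w \<subseteq> B" "x \<in> M" "y \<in> M" "d x y \<le> t" "\<omega> t \<le> \<delta>"
  shows "(\<Prod>k<length w. 1 - \<omega> (t * \<rho> ^ k) / \<delta>) * word_prob y w \<le> word_prob x w"
  using assms
proof (induction w arbitrary: x y t)
  case (Cons a w)
  have t0: "0 \<le> t" using Cons.prems(4) nonneg[of x y] by linarith
  have a: "a \<in> B" using Cons by auto
  have "d (T a x) (T a y) \<le> \<rho> * d x y" using contraction Cons by auto
  also have "\<dots> \<le> t * \<rho>" using rho Cons.prems by (simp add: mult.commute)
  finally have d': "d (T a x) (T a y) \<le> t * \<rho>" .
  have om: "\<omega> (t * \<rho> ^ k) \<le> \<omega> t" for k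
    using t0 rho by (intro modulus_mono) (auto simp: mult_left_le power_le_one)
  have IH: "(\<Prod>k<length w. 1 - \<omega> (t * \<rho> * \<rho> ^ k) / \<delta>) * word_prob (T a y) w \<le> word_prob (T a x) w"
    using Cons.prems om[of 1] d' by (intro Cons.IH) (auto simp: T_closed)
  have nn: "0 \<le> (\<Prod>k<length w. 1 - \<omega> (t * \<rho> * \<rho> ^ k) / \<delta>)"
    using om[of "Suc k" for k] delta_pos Cons.prems(5)
    by (intro prod_nonneg) (auto simp: mult.assoc intro: order_trans)
  have 0: "0 \<le> 1 - \<omega> t / \<delta>" using delta_pos Cons.prems(5) by simp
  have "(1 - \<omega> t / \<delta>) * pmf (c y) a = pmf (c y) a - \<omega> t * (pmf (c y) a / \<delta>)"
    by (simp add: algebra_simps)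
  also have "\<dots> \<le> pmf (c y) a - \<omega> t * 1"
    using delta_le[OF a Cons.prems(3)] modulus_nonneg[OF t0] delta_pos
    by (intro diff_left_mono mult_left_mono) auto
  also have "\<dots> \<le> pmf (c x) a"
    using modulus[OF a Cons.prems(2,3)] modulus_mono[OF nonneg Cons.prems(4)] by linarith
  finally have first: "(1 - \<omega> t / \<delta>) * pmf (c y) a \<le> pmf (c x) a" .
  have "(1 - \<omega> t / \<delta>) * pmf (c y) a *
      ((\<Prod>k<length w. 1 - \<omega> (t * \<rho> * \<rho> ^ k) / \<delta>) * word_prob (T a y) w)
    \<le> pmf (c x) a * word_prob (T a x) w"
    using first IH 0 nn by (intro mult_mono) (auto simp: word_prob_nonneg)
  then show ?case
    by (simp add: prod.lessThan_Suc_shift mult_ac del: prod.lessThan_Suc)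
qed simp

text \<open>
  The product of the factors \<open>1 - \<omega> (t \<rho>\<^sup>k) / \<delta>\<close> is at least 1 minus the sum of the \<open>\<omega> (t \<rho>\<^sup>k) / \<delta>\<close>,
  whatever the length of the word, and this sum is small for small \<open>t\<close> because it is a tail of a
  convergent series.
\<close>

lemma word_prob_ratio_near:
  assumes "0 < e"
  obtains t where "0 < t"
    "\<And>x y w. x \<in> M \<Longrightarrow> y \<in> M \<Longrightarrow> d x y \<le> t \<Longrightarrow> set w \<subseteq> B \<Longrightarrow> (1 - e) * word_prob y w \<le> word_prob x w"
proof -
  have "0 < min e 1 * \<delta>" using assms delta_pos by simp
  then obtain t where t: "0 < t" "(\<Sum>n. \<omega> (t * \<rho> ^ n)) < min e 1 * \<delta>"
    using modulus_tail by blast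
  have om: "\<omega> (t * \<rho> ^ k) \<le> \<omega> t" for k
    using t rho by (intro modulus_mono) (auto simp: mult_left_le power_le_one)
  have "min e 1 * \<delta> \<le> \<delta>" using delta_pos by (simp add: mult_le_cancel_right1)
  with modulus_le_tail[OF t(1)] t(2) have omt: "\<omega> t \<le> \<delta>" by linarith
  show thesis
  proof (rule that[OF t(1)])
    fix x y w assume *: "x \<in> M" "y \<in> M" "d x y \<le> t" "set w \<subseteq> B"
    have "(\<Sum>k<length w. \<omega> (t * \<rho> ^ k) / \<delta>) = (\<Sum>k<length w. \<omega> (t * \<rho> ^ k)) / \<delta>"
      by (simp add: sum_divide_distrib)
    also have "\<dots> \<le> (\<Sum>n. \<omega> (t * \<rho> ^ n)) / \<delta>"
      using t rho delta_pos
      by (intro divide_right_mono sum_le_suminf modulus_summable) (auto intro!: modulus_nonneg)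
    also have "\<dots> \<le> e" using t(2) delta_pos by (auto simp: divide_le_eq min_def split: if_splits intro: order_trans[OF less_imp_le])
    finally have "1 - e \<le> 1 - (\<Sum>k<length w. \<omega> (t * \<rho> ^ k) / \<delta>)" by simp
    also have "\<dots> \<le> (\<Prod>k<length w. 1 - \<omega> (t * \<rho> ^ k) / \<delta>)"
      using t rho delta_pos omt om
      by (intro Weierstrass_prod_ineq) (auto intro!: modulus_nonneg divide_nonneg_pos intro: order_trans)
    finally have "(1 - e) * word_prob y w \<le> (\<Prod>k<length w. 1 - \<omega> (t * \<rho> ^ k) / \<delta>) * word_prob y w"
      by (intro mult_right_mono word_prob_nonneg)
    also have "\<dots> \<le> word_prob x w"
      using * omt by (intro word_prob_ratio_product)
    finally show "(1 - e) * word_prob y w \<le> word_prob x w" .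
  qed
qed

text \<open>
  For points at a bounded distance the first \<open>m\<close> letters cost at most the factor \<open>\<delta>\<^sup>m\<close>; after them the orbits are
  so close that the remaining letters cost at most \<open>1/2\<close>.
\<close>

lemma word_prob_ratio_bounded:
  obtains \<alpha> where "0 < \<alpha>" "\<alpha> \<le> 1"
    "\<And>x y w. x \<in> M \<Longrightarrow> y \<in> M \<Longrightarrow> d x y \<le> R \<Longrightarrow> set w \<subseteq> B \<Longrightarrow> \<alpha> * word_prob y w \<le> word_prob x w"
proof -
  have "(0::real) < 1/2" by simp
  from word_prob_ratio_near[OF this] obtain t where t: "0 < t"
    "\<And>x y w. x \<in> M \<Longrightarrow> y \<in> M \<Longrightarrow> d x y \<le> t \<Longrightarrow> set w \<subseteq> B \<Longrightarrow> (1 - 1/2) * word_prob y w \<le> word_prob x w"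
    by metis
  obtain m where m: "\<rho> ^ m * R < t" using power_rate_small[OF t(1)] by blast
  have d1: "\<delta> \<le> 1"
  proof -
    obtain x where x: "x \<in> M" using nonempty by auto
    then obtain b where b: "b \<in> B" using letters[OF x] set_pmf_not_empty[of "c x"] by blast
    show ?thesis using delta_le[OF b x] pmf_le_1[of "c x" b] by linarith
  qed
  show thesis
  proof (rule that[of "\<delta> ^ m * (1/2)"])
    show "0 < \<delta> ^ m * (1/2)" using delta_pos by simp
    show "\<delta> ^ m * (1/2) \<le> 1" using d1 delta_pos power_le_one[of \<delta> m] by simp
    fix x y w assume *: "x \<in> M" "y \<in> M" "d x y \<le> R" "set w \<subseteq> B"
    define u v where "u = take m w" and "v = drop m w"
    have w: "w = u @ v" unfolding u_def v_def by simp
    have uv: "set u \<subseteq> B" "set v \<subseteq> B" using *(4) unfolding w by auto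
    have "\<delta> ^ m \<le> \<delta> ^ length u"
      using d1 delta_pos unfolding u_def by (intro power_decreasing) auto
    also have "\<dots> \<le> word_prob x u" using uv * by (intro word_prob_ge)
    finally have A: "\<delta> ^ m * word_prob y u \<le> word_prob x u"
      using order_trans[OF mult_left_mono[OF word_prob_le_1[of y u], of "\<delta> ^ m"]] delta_pos by simp
    have B: "1/2 * word_prob (fold T u y) v \<le> word_prob (fold T u x) v"
    proof (cases "length w < m")
      case True
      then have "v = []" unfolding v_def by simp
      then show ?thesis by simp
    next
      case False
      then have "length u = m" unfolding u_def by simp
      then have "d (fold T u x) (fold T u y) \<le> \<rho> ^ m * d x y"
        using fold_contraction[OF uv(1) *(1,2)] by simp
      also have "\<dots> \<le> \<rho> ^ m * R" using * rho by (intro mult_left_mono) auto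
      finally show ?thesis
        using t(2)[of "fold T u x" "fold T u y" v] m uv * by (auto simp: fold_closed)
    qed
    have "\<delta> ^ m * word_prob y u * (1/2 * word_prob (fold T u y) v) \<le> word_prob x u * word_prob (fold T u x) v"
      using A B delta_pos by (intro mult_mono) (auto simp: word_prob_nonneg)
    then show "\<delta> ^ m * (1/2) * word_prob y w \<le> word_prob x w"
      by (simp add: w word_prob_append mult_ac)
  qed
qed

section \<open>Convergence of the iterated transfer operator\<close>

lemma invariant_ball:
  assumes "x0 \<in> M"
  obtains R0 where "\<And>R b x. R0 \<le> R \<Longrightarrow> b \<in> B \<Longrightarrow> x \<in> mcball x0 R \<Longrightarrow> T b x \<in> mcball x0 R"
proof -
  \<comment> \<open>A map that moves the centre by \<open>D\<close> preserves every ball of radius at least \<open>D / (1 - \<rho>)\<close>; the sum bounds all these \<open>D\<close>.\<close>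
  define R0 where "R0 = (\<Sum>b\<in>B. d x0 (T b x0)) / (1 - \<rho>)"
  show thesis
  proof (rule that[of R0])
    fix R b x assume *: "R0 \<le> R" "b \<in> B" "x \<in> mcball x0 R"
    then have x: "x \<in> M" "d x0 x \<le> R" by (auto simp: in_mcball)
    have "d x0 (T b x0) \<le> (\<Sum>b\<in>B. d x0 (T b x0))"
      using * finite_letters by (intro member_le_sum) auto
    also have "\<dots> \<le> (1 - \<rho>) * R"
      using *(1) rho unfolding R0_def by (simp add: field_simps)
    finally have 1: "d x0 (T b x0) \<le> (1 - \<rho>) * R" .
    have 2: "d (T b x0) (T b x) \<le> \<rho> * R"
      using contraction[OF *(2) assms x(1)] x(2) rho mult_left_mono[of "d x0 x" R \<rho>] by linarith
    have "d x0 (T b x) \<le> d x0 (T b x0) + d (T b x0) (T b x)"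
      using assms * x by (intro triangle) (auto simp: T_closed)
    also have "\<dots> \<le> R" using 1 2 by (simp add: algebra_simps)
    finally show "T b x \<in> mcball x0 R" using assms * x by (auto simp: T_closed in_mcball)
  qed
qed

lemma fold_invariant:
  assumes "\<And>b x. b \<in> B \<Longrightarrow> x \<in> K \<Longrightarrow> T b x \<in> K" "set w \<subseteq> B" "x \<in> K"
  shows "fold T w x \<in> K"
  using assms(2,3) by (induction w arbitrary: x) (auto simp: assms(1))

text \<open>
  Two points that are close have nearly the same word probabilities, uniformly in the word, and their
  orbits along a common word stay close. Hence the modulus of continuity of \<open>(transfer ^^ n) f\<close> does not
  deteriorate with \<open>n\<close>.
\<close>

lemma transfer_power_equicontinuous:
  assumes K: "K \<subseteq> M" "compactin mtopology K" "\<And>b x. b \<in> B \<Longrightarrow> x \<in> K \<Longrightarrow> T b x \<in> K"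
    and f: "continuous_real f" "\<And>x. x \<in> M \<Longrightarrow> \<bar>f x\<bar> \<le> D"
    and e: "0 < e"
  obtains t where "0 < t"
    "\<And>n x y. x \<in> K \<Longrightarrow> y \<in> K \<Longrightarrow> d x y \<le> t \<Longrightarrow> \<bar>(transfer ^^ n) f x - (transfer ^^ n) f y\<bar> \<le> e"
proof -
  have D: "0 \<le> D" using f(2) nonempty by (meson abs_ge_zero equals0I order_trans)
  define e' where "e' = e / (4 * (D + 1))"
  have e': "0 < e'" "2 * e' * D \<le> e / 2"
    using e D unfolding e'_def by (auto simp: field_simps)
  obtain t1 where t1: "0 < t1"
    "\<And>x y w. x \<in> M \<Longrightarrow> y \<in> M \<Longrightarrow> d x y \<le> t1 \<Longrightarrow> set w \<subseteq> B \<Longrightarrow> (1 - e') * word_prob y w \<le> word_prob x w"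
    using word_prob_ratio_near[OF e'(1)] by metis
  obtain t2 where t2: "0 < t2" "\<And>x y. x \<in> K \<Longrightarrow> y \<in> M \<Longrightarrow> d x y < t2 \<Longrightarrow> \<bar>f x - f y\<bar> < e/2"
    using uniformly_continuous_near_compact[OF K(2) f(1), of "e/2"] e by auto
  show thesis
  proof (rule that[of "min t1 (t2/2)"])
    show "0 < min t1 (t2/2)" using t1 t2 by simp
    fix n x y assume xy: "x \<in> K" "y \<in> K" "d x y \<le> min t1 (t2/2)"
    have M: "x \<in> M" "y \<in> M" using xy K by auto
    have 1: "\<bar>(word_prob x w - word_prob y w) * f (fold T w x)\<bar> \<le> e' * D * (word_prob x w + word_prob y w)"
      if "w \<in> words n" for w
    proof -
      have w: "set w \<subseteq> B" using that by (simp add: words_def)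
      have "\<bar>word_prob x w - word_prob y w\<bar> \<le> e' * (word_prob x w + word_prob y w)"
        using t1(2)[of x y w] t1(2)[of y x w] M xy(3) w commute[of x y] e'(1)
          mult_nonneg_nonneg[OF less_imp_le[OF e'(1)] word_prob_nonneg[of x w]]
          mult_nonneg_nonneg[OF less_imp_le[OF e'(1)] word_prob_nonneg[of y w]]
        unfolding abs_le_iff distrib_left left_diff_distrib min.bounded_iff by linarith
      then have "\<bar>word_prob x w - word_prob y w\<bar> * \<bar>f (fold T w x)\<bar> \<le> e' * (word_prob x w + word_prob y w) * D"
        using f(2)[OF fold_closed[OF w M(1)]] e'(1) D by (intro mult_mono) (auto simp: word_prob_nonneg)
      then show ?thesis by (simp add: abs_mult mult_ac)
    qed
    have 2: "\<bar>word_prob y w * (f (fold T w x) - f (fold T w y))\<bar> \<le> word_prob y w * (e/2)"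
      if "w \<in> words n" for w
    proof -
      have w: "set w \<subseteq> B" using that by (simp add: words_def)
      have "d (fold T w x) (fold T w y) \<le> \<rho> ^ length w * d x y"
        using fold_contraction[OF w M] .
      also have "\<dots> \<le> 1 * d x y" using rho by (intro mult_right_mono power_le_one) auto
      also have "\<dots> < t2" using xy t2 by auto
      finally have "\<bar>f (fold T w x) - f (fold T w y)\<bar> < e/2"
        using t2(2) fold_invariant[OF K(3) w xy(1)] fold_closed[OF w M(2)] by blast
      then show ?thesis
        unfolding abs_mult abs_of_nonneg[OF word_prob_nonneg]
        by (intro mult_left_mono word_prob_nonneg less_imp_le)
    qed
    have eq: "(transfer ^^ n) f x - (transfer ^^ n) f y =
        (\<Sum>w\<in>words n. (word_prob x w - word_prob y w) * f (fold T w x) +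
           word_prob y w * (f (fold T w x) - f (fold T w y)))"
      using M by (simp add: transfer_power algebra_simps flip: sum_subtractf)
    have "\<bar>(transfer ^^ n) f x - (transfer ^^ n) f y\<bar> \<le> (\<Sum>w\<in>words n. e' * D * (word_prob x w + word_prob y w) + word_prob y w * (e/2))"
      unfolding eq by (rule order_trans[OF sum_abs], rule sum_mono)
        (rule order_trans[OF abs_triangle_ineq], rule add_mono, erule 1, erule 2)
    also have "\<dots> = 2 * e' * D + e/2"
      using sum_word_prob[OF M(1), of n] sum_word_prob[OF M(2), of n]
      unfolding sum.distrib sum_distrib_left[symmetric] sum_distrib_right[symmetric] by simp
    also have "\<dots> \<le> e" using e' by simp
    finally show "\<bar>(transfer ^^ n) f x - (transfer ^^ n) f y\<bar> \<le> e" .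
  qed
qed

text \<open>
  The law of the words of length \<open>m\<close> seen from \<open>y\<close> contains the fraction \<open>\<alpha>\<close> of the law seen from \<open>x\<close>. On this common
  part the same word is used from both points, which costs only \<open>h\<close>; the rest, of mass \<open>1 - \<alpha>\<close>, costs at
  most the oscillation \<open>D\<close> of \<open>g\<close>.
\<close>

lemma oscillation_step:
  assumes K: "K \<subseteq> M" "\<And>b x. b \<in> B \<Longrightarrow> x \<in> K \<Longrightarrow> T b x \<in> K"
    and \<alpha>: "0 \<le> \<alpha>" "\<alpha> \<le> 1" "\<And>w. w \<in> words m \<Longrightarrow> \<alpha> * word_prob x w \<le> word_prob y w"
    and near: "\<And>w. w \<in> words m \<Longrightarrow> \<bar>g (fold T w x) - g (fold T w y)\<bar> \<le> h"
    and osc: "\<And>x y. x \<in> K \<Longrightarrow> y \<in> K \<Longrightarrow> \<bar>g x - g y\<bar> \<le> D"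
    and xy: "x \<in> K" "y \<in> K"
  shows "\<bar>(transfer ^^ m) g x - (transfer ^^ m) g y\<bar> \<le> \<alpha> * h + (1 - \<alpha>) * D"
proof -
  have M: "x \<in> M" "y \<in> M" using K xy by auto
  \<comment> \<open>The part of the law of words at \<open>y\<close> that is not matched with words at \<open>x\<close>.\<close>
  define Q where "Q w = word_prob y w - \<alpha> * word_prob x w" for w
  define G where "G = (\<Sum>w\<in>words m. word_prob x w * g (fold T w x))"
  have Q0: "0 \<le> Q w" if "w \<in> words m" for w using \<alpha>(3)[OF that] by (simp add: Q_def)
  have Q1: "(\<Sum>w\<in>words m. Q w) = 1 - \<alpha>"
    by (simp add: Q_def sum_subtractf sum_word_prob M flip: sum_distrib_left)
  have closed: "fold T w x \<in> K" "fold T w y \<in> K" if "w \<in> words m" for w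
    using that xy fold_invariant[OF K(2)] by (auto simp: words_def)
  have G: "\<bar>G - g (fold T v y)\<bar> \<le> D" if v: "v \<in> words m" for v
  proof -
    have eq: "G - g (fold T v y) = (\<Sum>w\<in>words m. word_prob x w * (g (fold T w x) - g (fold T v y)))"
      by (simp add: G_def right_diff_distrib sum_subtractf sum_word_prob M flip: sum_distrib_right)
    have "\<bar>G - g (fold T v y)\<bar> \<le> (\<Sum>w\<in>words m. word_prob x w * D)"
      unfolding eq using closed v by (intro order_trans[OF sum_abs] sum_mono)
        (auto simp: abs_mult word_prob_nonneg intro!: mult_left_mono osc)
    then show ?thesis by (simp add: sum_word_prob M flip: sum_distrib_right)
  qed
  have "(transfer ^^ m) g x - (transfer ^^ m) g y =
      G - (\<Sum>w\<in>words m. (Q w + \<alpha> * word_prob x w) * g (fold T w y))"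
    using M by (simp add: transfer_power G_def Q_def)
  also have "\<dots> = \<alpha> * (\<Sum>w\<in>words m. word_prob x w * (g (fold T w x) - g (fold T w y)))
      + (\<Sum>w\<in>words m. Q w * (G - g (fold T w y)))"
    by (simp add: distrib_right right_diff_distrib sum.distrib sum_subtractf Q1 mult.assoc
        flip: sum_distrib_left sum_distrib_right G_def) (simp add: algebra_simps)
  finally have eq: "(transfer ^^ m) g x - (transfer ^^ m) g y = \<dots>" .
  have "\<bar>\<alpha> * (\<Sum>w\<in>words m. word_prob x w * (g (fold T w x) - g (fold T w y)))\<bar>
      \<le> \<alpha> * (\<Sum>w\<in>words m. word_prob x w * h)"
    unfolding abs_mult using \<alpha>(1)
    by (auto intro!: mult_left_mono order_trans[OF sum_abs] sum_mono near simp: abs_mult word_prob_nonneg)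
  moreover have "\<bar>\<Sum>w\<in>words m. Q w * (G - g (fold T w y))\<bar> \<le> (\<Sum>w\<in>words m. Q w * D)"
    by (auto intro!: order_trans[OF sum_abs] sum_mono mult_left_mono G simp: abs_mult Q0)
  ultimately show ?thesis
    unfolding eq by (simp add: sum_word_prob M Q1 flip: sum_distrib_right)
qed

text \<open>
  Each application of the oscillation estimate multiplies the excess of the oscillation over \<open>e/2\<close> by
  \<open>1 - \<alpha>\<close>, where \<open>e/2\<close> bounds the differences along matched words by equicontinuity.
\<close>

lemma oscillation_vanishes:
  assumes K: "K \<subseteq> M" "compactin mtopology K" "\<And>b x. b \<in> B \<Longrightarrow> x \<in> K \<Longrightarrow> T b x \<in> K"
    and diam: "\<And>x y. x \<in> K \<Longrightarrow> y \<in> K \<Longrightarrow> d x y \<le> R"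
    and f: "continuous_real f" "\<And>x. x \<in> M \<Longrightarrow> \<bar>f x\<bar> \<le> D"
    and e: "0 < e"
  obtains n0 where
    "\<And>n x y. n0 \<le> n \<Longrightarrow> x \<in> K \<Longrightarrow> y \<in> K \<Longrightarrow> \<bar>(transfer ^^ n) f x - (transfer ^^ n) f y\<bar> < e"
proof -
  obtain \<alpha> where \<alpha>: "0 < \<alpha>" "\<alpha> \<le> 1"
    "\<And>x y w. x \<in> M \<Longrightarrow> y \<in> M \<Longrightarrow> d x y \<le> R \<Longrightarrow> set w \<subseteq> B \<Longrightarrow> \<alpha> * word_prob y w \<le> word_prob x w"
    using word_prob_ratio_bounded[of R] by metis
  have "0 < e/2" using e by simp
  from transfer_power_equicontinuous[OF K f this] obtain t where t: "0 < t"
    "\<And>n x y. x \<in> K \<Longrightarrow> y \<in> K \<Longrightarrow> d x y \<le> t \<Longrightarrow> \<bar>(transfer ^^ n) f x - (transfer ^^ n) f y\<bar> \<le> e/2"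
    by metis
  obtain m where m: "\<rho> ^ m * R < t" using power_rate_small[OF t(1)] by blast
  \<comment> \<open>The last \<open>m\<close> of the \<open>n\<close> iterations are peeled off in each step of the induction.\<close>
  have step: "\<bar>(transfer ^^ n) f x - (transfer ^^ n) f y\<bar> \<le> (1 - \<alpha>) ^ j * (2 * D) + e/2"
    if "j * m \<le> n" "x \<in> K" "y \<in> K" for j n x y
    using that
  proof (induction j arbitrary: n x y)
    case 0
    have "x \<in> M" "y \<in> M" using 0 K by auto
    then show ?case
      using transfer_power_bound[of x f D n, OF _ f(2)] transfer_power_bound[of y f D n, OF _ f(2)] e
      by simp
  next
    case (Suc j)
    define k where "k = n - m"
    have k: "n = m + k" "j * m \<le> k" using Suc.prems(1) by (auto simp: k_def)
    define g where "g = (transfer ^^ k) f"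
    have M: "x \<in> M" "y \<in> M" using Suc.prems K by auto
    have "\<bar>(transfer ^^ m) g x - (transfer ^^ m) g y\<bar> \<le> \<alpha> * (e/2) + (1 - \<alpha>) * ((1 - \<alpha>) ^ j * (2 * D) + e/2)"
    proof (rule oscillation_step[OF K(1,3)])
      show "\<alpha> * word_prob x w \<le> word_prob y w" if "w \<in> words m" for w
        using that \<alpha>(3)[of y x w] M diam Suc.prems by (auto simp: words_def)
      show "\<bar>g (fold T w x) - g (fold T w y)\<bar> \<le> e/2" if "w \<in> words m" for w
      proof -
        have w: "set w \<subseteq> B" "length w = m" using that by (auto simp: words_def)
        have "d (fold T w x) (fold T w y) \<le> \<rho> ^ m * d x y"
          using fold_contraction[OF w(1) M] w by simp
        also have "\<dots> \<le> \<rho> ^ m * R" using rho diam Suc.prems by (intro mult_left_mono) auto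
        finally show ?thesis
          unfolding g_def using m w Suc.prems by (intro t(2) fold_invariant[OF K(3)]) auto
      qed
      show "\<bar>g x - g y\<bar> \<le> (1 - \<alpha>) ^ j * (2 * D) + e/2" if "x \<in> K" "y \<in> K" for x y
        unfolding g_def using Suc.IH[OF k(2) that] .
    qed (use \<alpha> Suc.prems in auto)
    also have "\<dots> = (1 - \<alpha>) ^ Suc j * (2 * D) + e/2" by (simp add: field_simps)
    finally show ?case unfolding g_def k(1) funpow_add by simp
  qed
  have "(\<lambda>j. (1 - \<alpha>) ^ j * (2 * D)) \<longlonglongrightarrow> 0 * (2 * D)"
    using \<alpha> by (intro tendsto_mult LIMSEQ_realpow_zero tendsto_const) auto
  then have "eventually (\<lambda>j. (1 - \<alpha>) ^ j * (2 * D) < e/2) sequentially"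
    using e by (intro order_tendstoD) auto
  then obtain j where "(1 - \<alpha>) ^ j * (2 * D) < e/2" by (auto simp: eventually_sequentially)
  then show thesis
    using step[of j] by (intro that[of "j * m"]) force
qed

text \<open>
  Iterating further replaces \<open>(transfer ^^ n) f x\<close> by an average of values of \<open>(transfer ^^ n) f\<close> on an invariant
  ball, where this function is almost constant. So the sequence is Cauchy at every point, and the limit
  does not depend on the point, since any two points lie in a common invariant ball.
\<close>

lemma transfer_power_converges:
  assumes f: "continuous_real f" "\<And>x. x \<in> M \<Longrightarrow> \<bar>f x\<bar> \<le> D"
  obtains L where "\<And>x. x \<in> M \<Longrightarrow> (\<lambda>n. (transfer ^^ n) f x) \<longlonglongrightarrow> L"
proof -
  obtain x0 where x0: "x0 \<in> M" using nonempty by auto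
  obtain R0 where R0: "\<And>R b x. R0 \<le> R \<Longrightarrow> b \<in> B \<Longrightarrow> x \<in> mcball x0 R \<Longrightarrow> T b x \<in> mcball x0 R"
    using invariant_ball[OF x0] by metis
  have osc: "\<exists>n0. \<forall>n\<ge>n0. \<forall>v. set v \<subseteq> B \<longrightarrow>
      \<bar>(transfer ^^ n) f (fold T v x0) - (transfer ^^ n) f x\<bar> < e"
    if x: "x \<in> M" and e: "0 < e" for x e
  proof -
    define R where "R = max R0 (d x0 x)"
    have R: "R0 \<le> R" "x \<in> mcball x0 R" "x0 \<in> mcball x0 R"
      using x x0 by (auto simp: R_def in_mcball intro: order_trans[OF _ max.cobounded2])
    have diam: "d y z \<le> R + R" if "y \<in> mcball x0 R" "z \<in> mcball x0 R" for y z
      using that triangle[of y x0 z] commute[of y x0] by (auto simp: in_mcball)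
    obtain n0 where "\<And>n y z. n0 \<le> n \<Longrightarrow> y \<in> mcball x0 R \<Longrightarrow> z \<in> mcball x0 R \<Longrightarrow>
        \<bar>(transfer ^^ n) f y - (transfer ^^ n) f z\<bar> < e"
      using oscillation_vanishes[OF mcball_subset_mspace compact_cballs[OF x0] R0[OF R(1)] diam f e]
      by metis
    then show ?thesis
      using R fold_invariant[OF R0[OF R(1)]] by blast
  qed
  have "Cauchy (\<lambda>n. (transfer ^^ n) f x0)"
  proof (rule metric_CauchyI)
    fix e :: real assume e: "0 < e"
    then obtain n0 where n0: "\<And>n v. n \<ge> n0 \<Longrightarrow> set v \<subseteq> B \<Longrightarrow>
      \<bar>(transfer ^^ n) f (fold T v x0) - (transfer ^^ n) f x0\<bar> < e/4"
      using osc[OF x0, of "e/4"] by auto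
    have *: "\<bar>(transfer ^^ (k + n0)) f x0 - (transfer ^^ n0) f x0\<bar> < e/2" for k
    proof -
      define g where "g = (transfer ^^ n0) f"
      have g: "\<bar>g (fold T v x0) - g x0\<bar> \<le> e/4" if "v \<in> words k" for v
        using n0[of n0 v] that by (simp add: g_def words_def)
      have "\<bar>(transfer ^^ k) g x0 - g x0\<bar> = \<bar>\<Sum>v\<in>words k. word_prob x0 v * (g (fold T v x0) - g x0)\<bar>"
        using x0 by (simp add: transfer_power[of x0 k] right_diff_distrib sum_subtractf
            sum_word_prob flip: sum_distrib_right)
      also have "\<dots> \<le> (\<Sum>v\<in>words k. word_prob x0 v * (e/4))"
        by (intro order_trans[OF sum_abs] sum_mono)
          (unfold abs_mult abs_of_nonneg[OF word_prob_nonneg], intro mult_left_mono g word_prob_nonneg)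
      also have "\<dots> = e/4"
        using sum_word_prob[OF x0] unfolding sum_distrib_right[symmetric] by simp
      finally show ?thesis using e unfolding g_def funpow_add o_def by linarith
    qed
    have **: "\<bar>(transfer ^^ n) f x0 - (transfer ^^ n0) f x0\<bar> < e/2" if "n \<ge> n0" for n
      using *[of "n - n0"] that by simp
    show "\<exists>N. \<forall>m\<ge>N. \<forall>n\<ge>N. dist ((transfer ^^ m) f x0) ((transfer ^^ n) f x0) < e"
    proof (intro exI[of _ n0] allI impI)
      fix m n assume "n0 \<le> m" "n0 \<le> n"
      with **[of m] **[of n]
      show "dist ((transfer ^^ m) f x0) ((transfer ^^ n) f x0) < e"
        unfolding dist_real_def by linarith
    qed
  qed
  then obtain L where L: "(\<lambda>n. (transfer ^^ n) f x0) \<longlonglongrightarrow> L"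
    unfolding Cauchy_convergent_iff convergent_def by blast
  show thesis
  proof (rule that)
    fix x assume x: "x \<in> M"
    have "(\<lambda>n. (transfer ^^ n) f x0 - (transfer ^^ n) f x) \<longlonglongrightarrow> 0"
    proof (rule LIMSEQ_I)
      fix e :: real assume "0 < e"
      then obtain n0 where n0: "\<And>n v. n0 \<le> n \<Longrightarrow> set v \<subseteq> B \<Longrightarrow>
          \<bar>(transfer ^^ n) f (fold T v x0) - (transfer ^^ n) f x\<bar> < e"
        using osc[OF x] by blast
      show "\<exists>n0. \<forall>n\<ge>n0. norm ((transfer ^^ n) f x0 - (transfer ^^ n) f x - 0) < e"
      proof (intro exI[of _ n0] allI impI)
        fix n assume "n0 \<le> n"
        then show "norm ((transfer ^^ n) f x0 - (transfer ^^ n) f x - 0) < e"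
          using n0[of n "[]"] by simp
      qed
    qed
    from tendsto_diff[OF L this] show "(\<lambda>n. (transfer ^^ n) f x) \<longlonglongrightarrow> L"
      by simp
  qed
qed

end

section \<open>Borel measures on metric spaces\<close>

lemma borel_of_topology_simps:
  "space (borel_of_topology X) = topspace X"
  "sets (borel_of_topology X) = sigma_sets (topspace X) {U. openin X U}"
  unfolding borel_of_topology_def
  by (auto simp: space_measure_of_conv sets_measure_of_conv dest: openin_subset)

lemma openin_sets_borel: "openin X U \<Longrightarrow> U \<in> sets (borel_of_topology X)"
  by (auto simp: borel_of_topology_simps)

lemma measurable_borel_of_topologyI:
  assumes "\<And>x. x \<in> space N \<Longrightarrow> f x \<in> topspace X" "\<And>U. openin X U \<Longrightarrow> f -` U \<inter> space N \<in> sets N"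
  shows "f \<in> measurable N (borel_of_topology X)"
  unfolding borel_of_topology_def
  by (rule measurable_measure_of) (use assms in \<open>auto dest: openin_subset\<close>)

lemma continuous_map_measurable:
  assumes "continuous_map X Y f"
  shows "f \<in> measurable (borel_of_topology X) (borel_of_topology Y)"
proof (rule measurable_borel_of_topologyI)
  show "f x \<in> topspace Y" if "x \<in> space (borel_of_topology X)" for x
    using that assms by (auto simp: borel_of_topology_simps continuous_map_def)
  fix U assume "openin Y U"
  then have "openin X {x \<in> topspace X. f x \<in> U}"
    by (rule openin_continuous_map_preimage[OF assms])
  moreover have "f -` U \<inter> space (borel_of_topology X) = {x \<in> topspace X. f x \<in> U}"
    by (auto simp: borel_of_topology_simps)
  ultimately show "f -` U \<inter> space (borel_of_topology X) \<in> sets (borel_of_topology X)"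
    by (simp add: openin_sets_borel)
qed

lemma continuous_map_borel_measurable:
  assumes "continuous_map X euclideanreal f"
  shows "f \<in> borel_measurable (borel_of_topology X)"
proof (rule borel_measurableI)
  fix U :: "real set" assume "open U"
  then have "openin X {x \<in> topspace X. f x \<in> U}"
    by (intro openin_continuous_map_preimage[OF assms]) simp
  moreover have "f -` U \<inter> space (borel_of_topology X) = {x \<in> topspace X. f x \<in> U}"
    by (auto simp: borel_of_topology_simps)
  ultimately show "f -` U \<inter> space (borel_of_topology X) \<in> sets (borel_of_topology X)"
    by (simp add: openin_sets_borel)
qed

text \<open>
  The indicator of an open set \<open>U\<close> is the increasing limit of the continuous functions \<open>min 1 (n D x)\<close>, where
  \<open>D\<close> is the distance to the complement of \<open>U\<close>, and the open sets form a generator that is stable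
  under intersection.
\<close>

lemma (in Metric_space) measure_eqI_bounded_continuous:
  assumes \<mu>: "probability_on mtopology \<mu>" and \<nu>: "probability_on mtopology \<nu>"
    and eq: "\<And>f. continuous_real f \<Longrightarrow> (\<And>x. x \<in> M \<Longrightarrow> \<bar>f x\<bar> \<le> 1) \<Longrightarrow>
      (\<integral>x. f x \<partial>\<mu>) = (\<integral>x. f x \<partial>\<nu>)"
  shows "\<mu> = \<nu>"
proof -
  interpret \<mu>: prob_space \<mu> using \<mu> by (simp add: probability_on_def)
  interpret \<nu>: prob_space \<nu> using \<nu> by (simp add: probability_on_def)
  have sets: "sets \<mu> = sets (borel_of_topology mtopology)" "sets \<nu> = sets (borel_of_topology mtopology)"
    using \<mu> \<nu> by (simp_all add: probability_on_def)
  have space: "space \<mu> = M" "space \<nu> = M"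
    using sets[THEN sets_eq_imp_space_eq] by (simp_all add: borel_of_topology_simps)
  have open_eq: "measure \<mu> U = measure \<nu> U" if U: "openin mtopology U" and ne: "U \<noteq> M" for U
  proof -
    have UM: "U \<subseteq> M" using U openin_subset by fastforce
    \<comment> \<open>The whole space is excluded here, because the distance to the empty set has no meaning.\<close>
    have nonempty: "M - U \<noteq> {}" using ne UM by auto
    define D where "D x = (INF y\<in>M - U. d x y)" for x
    have bdd: "bdd_below (d x ` (M - U))" for x by (intro bdd_belowI[of _ 0]) auto
    have D_nonneg: "0 \<le> D x" for x
      unfolding D_def using nonempty by (intro cINF_greatest) auto
    have D_outside: "D x = 0" if "x \<in> M - U" for x
    proof -
      have "D x \<le> d x x" unfolding D_def using bdd that by (intro cINF_lower) auto
      with D_nonneg[of x] that show ?thesis by simp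
    qed
    have D_inside: "0 < D x" if "x \<in> U" for x
    proof -
      obtain r where r: "r > 0" "mball x r \<subseteq> U"
        using U \<open>x \<in> U\<close> unfolding openin_mtopology by blast
      have "r \<le> D x" unfolding D_def
      proof (rule cINF_greatest[OF nonempty])
        fix y assume y: "y \<in> M - U"
        show "r \<le> d x y"
        proof (rule ccontr)
          assume "\<not> r \<le> d x y"
          then have "y \<in> mball x r" using y that UM by (auto simp: in_mball)
          then show False using y r by auto
        qed
      qed
      with r show ?thesis by linarith
    qed
    have D_lip: "D x \<le> D y + d x y" if "x \<in> M" "y \<in> M" for x y
    proof -
      have "D x - d x y \<le> D y" unfolding D_def[of y]
      proof (rule cINF_greatest[OF nonempty])
        fix z assume z: "z \<in> M - U"
        have "D x \<le> d x z" unfolding D_def using bdd z by (intro cINF_lower) auto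
        also have "\<dots> \<le> d x y + d y z" using that z by (intro triangle) auto
        finally show "D x - d x y \<le> d y z" by simp
      qed
      then show ?thesis by simp
    qed
    have "continuous_real D"
      unfolding continuous_map_to_real_iff
    proof (intro ballI allI impI)
      fix x and e :: real assume "x \<in> M" "0 < e"
      then show "\<exists>t>0. \<forall>y\<in>M. d x y < t \<longrightarrow> \<bar>D x - D y\<bar> < e"
        using D_lip[of x] D_lip[of _ x] commute[of x] by (intro exI[of _ e]) (force simp: abs_less_iff)
    qed
    then have cont: "continuous_real (\<lambda>x. min 1 (real n * D x))" for n
      by (intro continuous_map_real_min continuous_map_real_mult) auto
    have lim: "(\<lambda>n. min 1 (real n * D x)) \<longlonglongrightarrow> indicator U x" if "x \<in> M" for x
    proof (cases "x \<in> U")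
      case True
      then have "0 < D x" by (rule D_inside)
      then obtain m :: nat where m: "1 < real m * D x" using reals_Archimedean3 by blast
      have "eventually (\<lambda>n. min 1 (real n * D x) = 1) sequentially"
        unfolding eventually_sequentially
      proof (intro exI[of _ m] allI impI)
        fix n assume "m \<le> n"
        then have "real m * D x \<le> real n * D x" using D_nonneg by (intro mult_right_mono) auto
        with m show "min 1 (real n * D x) = 1" by simp
      qed
      with True show ?thesis by (simp add: tendsto_eventually)
    next
      case False
      then show ?thesis using that D_outside by simp
    qed
    have int: "(\<lambda>n. \<integral>x. min 1 (real n * D x) \<partial>\<kappa>) \<longlonglongrightarrow> measure \<kappa> U"
      if "prob_space \<kappa>" "sets \<kappa> = sets (borel_of_topology mtopology)" for \<kappa>
    proof -
      interpret \<kappa>: prob_space \<kappa> by fact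
      have sp: "space \<kappa> = M"
        using that(2)[THEN sets_eq_imp_space_eq] by (simp add: borel_of_topology_simps)
      have "U \<in> sets \<kappa>" using that U openin_sets_borel by blast
      have "(\<lambda>n. \<integral>x. min 1 (real n * D x) \<partial>\<kappa>) \<longlonglongrightarrow> (\<integral>x. indicator U x \<partial>\<kappa>)"
      proof (rule integral_dominated_convergence[where w = "\<lambda>_. 1"])
        show "(\<lambda>x. min 1 (real n * D x)) \<in> borel_measurable \<kappa>" for n
          using continuous_map_borel_measurable[OF cont] that(2) by (simp cong: measurable_cong_sets)
        show "AE x in \<kappa>. (\<lambda>n. min 1 (real n * D x)) \<longlonglongrightarrow> indicator U x"
          using lim sp by (intro AE_I2) auto
        show "AE x in \<kappa>. norm (min 1 (real n * D x)) \<le> 1" for n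
          using D_nonneg by (intro AE_I2) (auto simp: min_def)
      qed (use \<open>U \<in> sets \<kappa>\<close> in auto)
      also have "(\<integral>x. indicator U x \<partial>\<kappa>) = measure \<kappa> U"
        using UM sp by (simp add: Int_absorb2)
      finally show ?thesis .
    qed
    have "(\<integral>x. min 1 (real n * D x) \<partial>\<mu>) = (\<integral>x. min 1 (real n * D x) \<partial>\<nu>)" for n
      using cont D_nonneg by (intro eq) (auto simp: min_def)
    then show ?thesis
      using LIMSEQ_unique[OF int[OF \<mu>.prob_space_axioms sets(1)]] int[OF \<nu>.prob_space_axioms sets(2)]
      by simp
  qed
  show ?thesis
  proof (rule measure_eqI_generator_eq[where E = "{U. openin mtopology U}" and \<Omega> = M and A = "\<lambda>_. M"])
    show "Int_stable {U. openin mtopology U}" by (auto simp: Int_stable_def)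
    show "{U. openin mtopology U} \<subseteq> Pow M" using openin_subset by fastforce
    show "emeasure \<mu> U = emeasure \<nu> U" if "U \<in> {U. openin mtopology U}" for U
    proof (cases "U = M")
      case True
      then show ?thesis using \<mu>.emeasure_space_1 \<nu>.emeasure_space_1 space by simp
    next
      case False
      then show ?thesis
        using open_eq that by (simp add: \<mu>.emeasure_eq_measure \<nu>.emeasure_eq_measure)
    qed
  qed (use sets openin_topspace[of mtopology] in \<open>auto simp: borel_of_topology_simps\<close>)
qed

section \<open>Processes with prescribed word frequencies\<close>

text \<open>
  Kolmogorov extension for sequences over a finite alphabet. The condition on \<open>q\<close> says that the laws of
  the words of different lengths are consistent. The letters are coded as natural numbers with the
  discrete topology, which is Polish; numbers that are no code of a letter have probability 0 and are
  decoded arbitrarily, so that \<open>X\<close> takes its values in \<open>B\<close> everywhere.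
\<close>

lemma letter_process_exists:
  fixes q :: "'b list \<Rightarrow> real"
  assumes B: "finite B" and q_nonneg: "\<And>w. set w \<subseteq> B \<Longrightarrow> 0 \<le> q w" and q_Nil: "q [] = 1"
    and q_sum: "\<And>w. set w \<subseteq> B \<Longrightarrow> (\<Sum>a\<in>B. q (w @ [a])) = q w"
  shows "\<exists>(P :: (nat \<Rightarrow> nat discrete) measure) (X :: nat \<Rightarrow> (nat \<Rightarrow> nat discrete) \<Rightarrow> 'b).
    prob_space P \<and> (\<forall>n \<omega>. X n \<omega> \<in> B) \<and>
    (\<forall>w. set w \<subseteq> B \<longrightarrow> {\<omega>\<in>space P. map (\<lambda>i. X i \<omega>) [0..<length w] = w} \<in> sets P \<and>
       measure P {\<omega>\<in>space P. map (\<lambda>i. X i \<omega>) [0..<length w] = w} = q w)"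
proof -
  have Bne: "B \<noteq> {}" using q_sum[of "[]"] q_Nil by auto
  obtain e :: "'b \<Rightarrow> nat" where e: "inj_on e B"
    using B finite_imp_inj_to_nat_seg by blast
  define dec :: "nat discrete \<Rightarrow> 'b" where
    "dec k = (if of_discrete k \<in> e ` B then inv_into B e (of_discrete k) else SOME b. b \<in> B)" for k
  have dec_B: "dec k \<in> B" for k
    using Bne by (auto simp: dec_def inv_into_into some_in_eq)
  have dec_e: "dec (discrete (e b)) = b" if "b \<in> B" for b
    using that e by (simp add: dec_def discrete_inverse)
  define wn where "wn n = {w. set w \<subseteq> B \<and> length w = n}" for n
  have fin: "finite (wn n)" for n unfolding wn_def using B by (rule finite_lists_length_eq)
  have sum_snoc: "(\<Sum>w\<in>wn (Suc n). g w) = (\<Sum>w\<in>wn n. \<Sum>a\<in>B. g (w @ [a]))" for n and g :: "'b list \<Rightarrow> real"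
  proof -
    have "wn (Suc n) = (\<lambda>(w, a). w @ [a]) ` (wn n \<times> B)"
      by (auto simp: wn_def length_Suc_conv_rev)
    moreover have "inj_on (\<lambda>(w, a). w @ [a]) (wn n \<times> B)" by (auto simp: inj_on_def)
    ultimately show ?thesis by (simp add: sum.reindex sum.cartesian_product case_prod_unfold)
  qed
  have q1: "(\<Sum>w\<in>wn n. q w) = 1" for n
  proof (induction n)
    case 0
    have "wn 0 = {[]}" by (auto simp: wn_def)
    then show ?case by (simp add: q_Nil)
  next
    case (Suc n)
    have "(\<Sum>w\<in>wn n. \<Sum>a\<in>B. q (w @ [a])) = (\<Sum>w\<in>wn n. q w)"
      by (intro sum.cong refl q_sum) (simp add: wn_def)
    with Suc show ?case by (simp add: sum_snoc)
  qed
  define Q where "Q n = embed_pmf (\<lambda>w. if w \<in> wn n then q w else 0)" for n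
  have pmf_Q: "pmf (Q n) w = (if w \<in> wn n then q w else 0)" for n w
    unfolding Q_def
  proof (rule pmf_embed_pmf)
    show "0 \<le> (if w \<in> wn n then q w else 0)" for w using q_nonneg by (auto simp: wn_def)
    have "(\<integral>\<^sup>+w. ennreal (if w \<in> wn n then q w else 0) \<partial>count_space UNIV) = (\<Sum>w\<in>wn n. ennreal (q w))"
      using fin by (subst nn_integral_count_space'[of "wn n"]) auto
    also have "\<dots> = ennreal (\<Sum>w\<in>wn n. q w)"
      by (rule sum_ennreal) (auto simp: wn_def q_nonneg)
    finally show "(\<integral>\<^sup>+w. ennreal (if w \<in> wn n then q w else 0) \<partial>count_space UNIV) = 1" by (simp add: q1)
  qed
  have set_Q: "set_pmf (Q n) \<subseteq> wn n" for n
    by (auto simp: set_pmf_eq pmf_Q split: if_splits)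
  have Q_butlast: "map_pmf butlast (Q (Suc n)) = Q n" for n
  proof (rule pmf_eqI)
    fix w
    have "pmf (map_pmf butlast (Q (Suc n))) w = measure (Q (Suc n)) (butlast -` {w} \<inter> wn (Suc n))"
      unfolding pmf_map using set_Q[of "Suc n"]
      by (intro measure_prob_cong_0) (auto simp: set_pmf_iff subset_iff)
    also have "\<dots> = (\<Sum>v\<in>butlast -` {w} \<inter> wn (Suc n). q v)"
      using fin by (simp add: measure_measure_pmf_finite pmf_Q)
    also have "\<dots> = (\<Sum>v\<in>wn (Suc n). if butlast v = w then q v else 0)"
      using fin by (simp add: sum.If_cases Int_commute vimage_def)
    also have "\<dots> = (\<Sum>v\<in>wn n. if v = w then q v else 0)"
      unfolding sum_snoc using q_sum by (intro sum.cong) (auto simp: wn_def)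
    also have "\<dots> = pmf (Q n) w" using fin by (simp add: pmf_Q)
    finally show "pmf (map_pmf butlast (Q (Suc n))) w = pmf (Q n) w" .
  qed
  have Q_take: "map_pmf (take n) (Q (n + k)) = Q n" for n k
  proof (induction k)
    case 0
    have "map_pmf (take n) (Q n) = map_pmf (\<lambda>x. x) (Q n)"
      using set_Q[of n] by (intro map_pmf_cong refl) (auto simp: wn_def)
    then show ?case by (simp add: map_pmf_ident)
  next
    case (Suc k)
    have "map_pmf (take n) (Q (n + k)) = map_pmf (take n) (map_pmf butlast (Q (n + Suc k)))"
      by (simp add: Q_butlast)
    also have "\<dots> = map_pmf (\<lambda>w. take n (butlast w)) (Q (n + Suc k))"
      by (simp add: map_pmf_comp)
    also have "\<dots> = map_pmf (take n) (Q (n + Suc k))"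
      using set_Q[of "n + Suc k"] by (intro map_pmf_cong refl) (auto simp: wn_def take_butlast)
    finally show ?case using Suc by simp
  qed
  \<comment> \<open>Words of length \<open>N J\<close> have letters at all positions in \<open>J\<close>.\<close>
  define N where "N J = Max (insert 0 (Suc ` J))" for J
  have N: "j < N J" if "finite J" "j \<in> J" for J j
    using that unfolding N_def by (subst Suc_le_eq[symmetric], intro Max_ge) auto
  have N_mono: "N J \<le> N H" if "J \<subseteq> H" "finite H" for J H
    using that unfolding N_def by (intro Max_mono) auto
  define code where "code J w = (\<lambda>j\<in>J. discrete (e (w ! j)))" for J and w :: "'b list"
  define P where "P J = distr (measure_pmf (Q (N J))) (PiM J (\<lambda>_. borel)) (code J)" for J
  have code_meas: "code J \<in> measurable (measure_pmf p) (PiM J (\<lambda>_. borel))" for J p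
    by (auto simp: code_def space_PiM)
  have PQ: "P J = distr (measure_pmf (Q n)) (PiM J (\<lambda>_. borel)) (code J)"
    if "finite J" "N J \<le> n" for J n
  proof -
    have "Q (N J) = map_pmf (take (N J)) (Q n)" using Q_take[of "N J" "n - N J"] that by simp
    then have "P J = distr (distr (measure_pmf (Q n)) (count_space UNIV) (take (N J))) (PiM J (\<lambda>_. borel)) (code J)"
      by (simp add: P_def map_pmf_rep_eq)
    also have "\<dots> = distr (measure_pmf (Q n)) (PiM J (\<lambda>_. borel)) (code J \<circ> take (N J))"
      by (rule distr_distr) (auto simp: code_def space_PiM)
    also have "code J \<circ> take (N J) = code J"
      using N[OF that(1)] by (auto simp: code_def fun_eq_iff)
    finally show ?thesis .
  qed
  interpret PP: polish_projective "UNIV :: nat set" P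
  proof (intro polish_projective.intro projective_family.intro)
    fix J H :: "nat set" assume JH: "J \<subseteq> H" "finite H"
    then have J: "finite J" by (auto intro: finite_subset)
    have "distr (P H) (PiM J (\<lambda>_. borel)) (\<lambda>f. restrict f J)
       = distr (measure_pmf (Q (N H))) (PiM J (\<lambda>_. borel)) ((\<lambda>f. restrict f J) \<circ> code H)"
      unfolding P_def by (rule distr_distr[OF measurable_restrict_subset[OF JH(1)] code_meas])
    also have "(\<lambda>f. restrict f J) \<circ> code H = code J"
      using JH by (auto simp: code_def fun_eq_iff)
    also have "distr (measure_pmf (Q (N H))) (PiM J (\<lambda>_. borel)) (code J) = P J"
      using PQ[OF J N_mono[OF JH]] by simp
    finally show "P J = distr (P H) (PiM J (\<lambda>_. borel)) (\<lambda>f. restrict f J)" by (rule sym)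
  next
    fix J :: "nat set"
    show "prob_space (P J)"
      unfolding P_def by (rule measure_pmf.prob_space_distr[OF code_meas])
  qed
  have sets_lim: "space PP.lim = UNIV" unfolding PP.space_lim by (simp add: space_PiM)
  define Y where "Y w = PiE {..<length w} (\<lambda>i. dec -` {w ! i})" for w
  have Y_sets: "Y w \<in> sets (PiM {..<length w} (\<lambda>_. borel))" for w
    unfolding Y_def by (intro sets_PiM_I_finite) (auto intro: borel_open open_discrete)
  have event: "{\<omega> \<in> space PP.lim. map (\<lambda>i. dec (\<omega> i)) [0..<length w] = w} = PP.emb UNIV {..<length w} (Y w)" for w
  proof -
    have "map (\<lambda>i. dec (\<omega> i)) [0..<length w] = w \<longleftrightarrow> (\<forall>i<length w. dec (\<omega> i) = w ! i)" for \<omega>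
      unfolding list_eq_iff_nth_eq by simp
    moreover have "\<omega> \<in> PP.emb UNIV {..<length w} (Y w) \<longleftrightarrow> (\<forall>i<length w. dec (\<omega> i) = w ! i)" for \<omega>
      unfolding prod_emb_iff Y_def PiE_iff Ball_def by simp
    ultimately show ?thesis unfolding sets_lim by blast
  qed
  show ?thesis
  proof (intro exI[of _ PP.lim] exI[of _ "\<lambda>i \<omega>. dec (\<omega> i)"] conjI allI impI)
    show "prob_space PP.lim" by (rule PP.P.prob_space_axioms)
    show "dec (\<omega> n) \<in> B" for n \<omega> by (rule dec_B)
    fix w assume w: "set w \<subseteq> B"
    show "{\<omega> \<in> space PP.lim. map (\<lambda>i. dec (\<omega> i)) [0..<length w] = w} \<in> sets PP.lim"
      unfolding event PP.sets_lim by (intro measurable_prod_emb Y_sets) auto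
    have le: "N {..<length w} \<le> length w" unfolding N_def by (auto simp: Suc_le_eq)
    have "measure PP.lim (PP.emb UNIV {..<length w} (Y w)) = measure (P {..<length w}) (Y w)"
      using Y_sets by (intro PP.measure_lim_emb) auto
    also have "\<dots> = measure (Q (length w)) (code {..<length w} -` Y w)"
      unfolding PQ[OF finite_lessThan le] using measure_distr[OF code_meas Y_sets] by simp
    also have "\<dots> = measure (Q (length w)) {w}"
    proof (rule measure_prob_cong_0)
      fix v assume "v \<in> code {..<length w} -` Y w - {w}"
      then show "pmf (Q (length w)) v = 0"
        by (auto simp: pmf_Q wn_def code_def Y_def PiE_iff list_eq_iff_nth_eq dec_e subset_iff)
    next
      fix v assume "v \<in> {w} - code {..<length w} -` Y w"
      then show "pmf (Q (length w)) v = 0"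
        using w by (auto simp: code_def Y_def PiE_iff dec_e subset_iff)
    qed
    also have "\<dots> = q w" using w by (simp add: measure_pmf_single pmf_Q wn_def)
    finally show "measure PP.lim {\<omega> \<in> space PP.lim. map (\<lambda>i. dec (\<omega> i)) [0..<length w] = w} = q w"
      unfolding event .
  qed
qed

section \<open>The invariant measure\<close>

lemma abs_diff_limits_le:
  fixes a b :: "nat \<Rightarrow> real"
  assumes "a \<longlonglongrightarrow> A" "b \<longlonglongrightarrow> C" "\<And>n. \<bar>a n - b n\<bar> \<le> e"
  shows "\<bar>A - C\<bar> \<le> e"
proof (rule LIMSEQ_le_const2)
  show "(\<lambda>n. \<bar>a n - b n\<bar>) \<longlonglongrightarrow> \<bar>A - C\<bar>" using assms by (intro tendsto_intros)
qed (use assms(3) in blast)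

context place_dependent_ifs
begin

abbreviation borel_M :: "'a measure" where "borel_M \<equiv> borel_of_topology mtopology"

definition kernel :: "'a \<Rightarrow> 'a measure" where
  "kernel x = distr (measure_pmf (c x)) borel_M (\<lambda>b. T b x)"

lemma space_borel_M: "space borel_M = M"
  by (simp add: borel_of_topology_simps)

lemma continuous_prob: "b \<in> B \<Longrightarrow> continuous_real (\<lambda>x. pmf (c x) b)"
  unfolding continuous_map_to_real_iff
proof (intro ballI allI impI)
  fix x e assume *: "b \<in> B" "x \<in> M" "(0::real) < e"
  obtain t where t: "0 < t" "\<And>s. 0 \<le> s \<Longrightarrow> s \<le> t \<Longrightarrow> \<omega> s < e" using modulus_small[OF *(3)] by metis
  show "\<exists>t>0. \<forall>y\<in>M. d x y < t \<longrightarrow> \<bar>pmf (c x) b - pmf (c y) b\<bar> < e"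
  proof (intro exI[of _ t] conjI ballI impI t(1))
    fix y assume y: "y \<in> M" "d x y < t"
    have "\<bar>pmf (c x) b - pmf (c y) b\<bar> \<le> \<omega> (d x y)" using modulus * y by blast
    also have "\<dots> < e" using t(2)[of "d x y"] y by simp
    finally show "\<bar>pmf (c x) b - pmf (c y) b\<bar> < e" .
  qed
qed

lemma continuous_T: "b \<in> B \<Longrightarrow> continuous_map mtopology mtopology (T b)"
  unfolding metric_continuous_map[OF Metric_space_axioms]
proof (intro conjI ballI allI impI)
  assume b: "b \<in> B"
  show "T b ` M \<subseteq> M" using T_closed b by auto
  fix x e assume *: "x \<in> M" "(0::real) < e"
  show "\<exists>t>0. \<forall>y. y \<in> M \<and> d x y < t \<longrightarrow> d (T b x) (T b y) < e"
  proof (intro exI[of _ e] conjI allI impI *(2))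
    fix y assume y: "y \<in> M \<and> d x y < e"
    have "d (T b x) (T b y) \<le> \<rho> * d x y" using contraction b * y by blast
    also have "\<dots> \<le> 1 * d x y" using rho by (intro mult_right_mono) auto
    finally show "d (T b x) (T b y) < e" using y by simp
  qed
qed

lemma continuous_compose_T:
  "b \<in> B \<Longrightarrow> continuous_real f \<Longrightarrow>
    continuous_real (\<lambda>x. f (T b x))"
  using continuous_map_compose[OF continuous_T, of b euclideanreal f] by (simp add: o_def)

lemma continuous_transfer:
  "continuous_real f \<Longrightarrow> continuous_real (transfer f)"
  unfolding transfer_def[abs_def]
  by (intro continuous_map_sum finite_letters continuous_map_real_mult continuous_prob continuous_compose_T)

lemma continuous_word_prob:
  "set w \<subseteq> B \<Longrightarrow> continuous_real (\<lambda>x. word_prob x w)"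
proof (induction w)
  case (Cons a w)
  then show ?case
    using continuous_compose_T[of a "\<lambda>x. word_prob x w"]
    by (auto intro!: continuous_map_real_mult continuous_prob)
qed simp

text \<open>
  Letters outside \<open>B\<close> have probability 0, but their maps may leave the space. Redirecting them to \<open>x\<close>
  makes the choice of the next point a measurable map into the space without changing its law.
\<close>

lemma kernel_restrict_letters:
  assumes x: "x \<in> M"
  shows "kernel x = distr (measure_pmf (c x)) borel_M (\<lambda>b. if b \<in> B then T b x else x)"
proof -
  have "emeasure (measure_pmf (c x)) ((\<lambda>b. T b x) -` A) =
      emeasure (measure_pmf (c x)) ((\<lambda>b. if b \<in> B then T b x else x) -` A)" for A
    using letters[OF x] by (intro emeasure_eq_AE) (auto simp: AE_measure_pmf_iff)
  then show ?thesis unfolding kernel_def distr_def by simp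
qed

lemma measurable_letter_choice:
  "x \<in> M \<Longrightarrow> (\<lambda>b. if b \<in> B then T b x else x) \<in> measurable (measure_pmf p) borel_M"
  by (auto simp: space_borel_M T_closed)

lemma sets_of_kernel [simp]: "sets (kernel x) = sets borel_M"
  by (simp add: kernel_def)

lemma prob_space_kernel: "x \<in> M \<Longrightarrow> prob_space (kernel x)"
  unfolding kernel_restrict_letters
  by (rule measure_pmf.prob_space_distr[OF measurable_letter_choice])

lemma integral_kernel:
  assumes x: "x \<in> M" and f: "f \<in> borel_measurable borel_M"
  shows "(\<integral>y. f y \<partial>kernel x) = transfer f x"
proof -
  have "(\<integral>y. f y \<partial>kernel x) = (\<integral>b. f (if b \<in> B then T b x else x) \<partial>measure_pmf (c x))"
    unfolding kernel_restrict_letters[OF x] by (rule integral_distr[OF measurable_letter_choice[OF x] f])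
  also have "\<dots> = transfer f x"
    using letters[OF x] by (subst integral_measure_pmf[OF finite_letters]) (auto simp: transfer_def)
  finally show ?thesis .
qed

lemma measurable_transfer:
  assumes "f \<in> borel_measurable borel_M"
  shows "transfer f \<in> borel_measurable borel_M"
  unfolding transfer_def[abs_def]
  using measurable_compose[OF continuous_map_measurable[OF continuous_T] assms]
  by (intro borel_measurable_sum borel_measurable_times)
    (auto intro: continuous_map_borel_measurable continuous_prob)

lemma measurable_kernel: "kernel \<in> measurable borel_M (subprob_algebra borel_M)"
proof (rule measurable_subprob_algebra)
  show "subprob_space (kernel x)" if "x \<in> space borel_M" for x
    using that prob_space_kernel by (simp add: space_borel_M prob_space_imp_subprob_space)
  fix A assume A: "A \<in> sets borel_M"
  have ind: "(indicator A :: 'a \<Rightarrow> real) \<in> borel_measurable borel_M" using A by simp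
  have "emeasure (kernel x) A = ennreal (transfer (indicator A) x)" if "x \<in> space borel_M" for x
  proof -
    have x: "x \<in> M" using that by (simp add: space_borel_M)
    interpret prob_space "kernel x" using prob_space_kernel[OF x] .
    have "measure (kernel x) A = (\<integral>y. indicator A y \<partial>kernel x)"
      using A by simp
    also have "\<dots> = transfer (indicator A) x" by (rule integral_kernel[OF x ind])
    finally show ?thesis by (simp add: emeasure_eq_measure)
  qed
  then show "(\<lambda>x. emeasure (kernel x) A) \<in> borel_measurable borel_M"
    using measurable_transfer[OF ind] by (simp cong: measurable_cong)
qed simp

lemma probability_on_space: "probability_on mtopology \<mu> \<Longrightarrow> space \<mu> = M"
  unfolding probability_on_def using sets_eq_imp_space_eq space_borel_M by metis

lemma measurable_kernel_from:
  "probability_on mtopology \<mu> \<Longrightarrow> kernel \<in> measurable \<mu> (subprob_algebra borel_M)"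
  using measurable_kernel by (simp add: probability_on_def cong: measurable_cong_sets)

lemma integral_bind_kernel:
  assumes \<mu>: "probability_on mtopology \<mu>" and f: "f \<in> borel_measurable borel_M"
    and D: "\<And>x. x \<in> M \<Longrightarrow> \<bar>f x\<bar> \<le> D"
  shows "(\<integral>x. f x \<partial>(\<mu> \<bind> kernel)) = (\<integral>x. transfer f x \<partial>\<mu>)"
proof -
  interpret prob_space \<mu> using \<mu> by (simp add: probability_on_def)
  have sp: "space \<mu> = M" using \<mu> by (rule probability_on_space)
  have "(\<integral>x. f x \<partial>(\<mu> \<bind> kernel)) = (\<integral>x. \<integral>y. f y \<partial>kernel x \<partial>\<mu>)"
  proof (rule integral_bind[OF f _ measurable_kernel_from[OF \<mu>], where B' = 1])
    show "AE x in \<mu>. emeasure (kernel x) (space (kernel x)) \<le> ennreal 1"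
      using prob_space.emeasure_space_1[OF prob_space_kernel] sp by (intro AE_I2) simp
  qed (use D space_borel_M in \<open>auto intro: finite_measure_axioms\<close>)
  also have "\<dots> = (\<integral>x. transfer f x \<partial>\<mu>)"
    by (intro Bochner_Integration.integral_cong refl) (simp add: sp integral_kernel f)
  finally show ?thesis .
qed

lemma probability_on_bind:
  assumes \<mu>: "probability_on mtopology \<mu>"
  shows "probability_on mtopology (\<mu> \<bind> kernel)"
proof -
  interpret prob_space \<mu> using \<mu> by (simp add: probability_on_def)
  have sp: "space \<mu> = M" using \<mu> by (rule probability_on_space)
  have "prob_space (\<mu> \<bind> kernel)"
    by (rule prob_space_bind[OF _ measurable_kernel_from[OF \<mu>]])
      (use sp prob_space_kernel in \<open>auto intro!: AE_I2\<close>)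
  moreover have "sets (\<mu> \<bind> kernel) = sets borel_M"
    using sp nonempty by (intro sets_bind) auto
  ultimately show ?thesis by (simp add: probability_on_def)
qed

lemma probability_on_law_at:
  "probability_on mtopology \<mu> \<Longrightarrow> probability_on mtopology (law_at kernel \<mu> k)"
  unfolding law_at_def by (induction k) (auto intro: probability_on_bind)

lemma transfer_power_continuous:
  "continuous_real f \<Longrightarrow>
    continuous_real ((transfer ^^ k) f)"
  by (induction k) (auto intro: continuous_transfer)

lemma integral_law_at:
  assumes \<mu>: "probability_on mtopology \<mu>" and f: "continuous_real f"
    and D: "\<And>x. x \<in> M \<Longrightarrow> \<bar>f x\<bar> \<le> D"
  shows "(\<integral>x. f x \<partial>law_at kernel \<mu> k) = (\<integral>x. (transfer ^^ k) f x \<partial>\<mu>)"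
  using f D
proof (induction k arbitrary: f)
  case (Suc k)
  have "(\<integral>x. f x \<partial>law_at kernel \<mu> (Suc k)) = (\<integral>x. f x \<partial>(law_at kernel \<mu> k \<bind> kernel))"
    by (simp add: law_at_def)
  also have "\<dots> = (\<integral>x. transfer f x \<partial>law_at kernel \<mu> k)"
    by (rule integral_bind_kernel[OF probability_on_law_at[OF \<mu>] continuous_map_borel_measurable])
      (use Suc.prems in auto)
  also have "\<dots> = (\<integral>x. (transfer ^^ k) (transfer f) x \<partial>\<mu>)"
    using transfer_power_bound[of _ f D 1] Suc.prems
    by (intro Suc.IH continuous_transfer) auto
  finally show ?case by (simp add: funpow_swap1)
qed (simp add: law_at_def)

definition base :: 'a where "base = (SOME x. x \<in> M)"

lemma base_in: "base \<in> M"
  unfolding base_def using nonempty by (simp add: some_in_eq)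

text \<open>
  The limit of \<open>(transfer ^^ n) f\<close> is a constant function, so it may be read off at the base point; for
  bounded continuous \<open>f\<close> this constant is the only possible integral of \<open>f\<close> under an invariant
  probability measure.
\<close>

definition ergodic_mean :: "('a \<Rightarrow> real) \<Rightarrow> real" where
  "ergodic_mean f = lim (\<lambda>n. (transfer ^^ n) f base)"

lemma transfer_power_tendsto:
  assumes f: "continuous_real f" "\<And>x. x \<in> M \<Longrightarrow> \<bar>f x\<bar> \<le> D" and x: "x \<in> M"
  shows "(\<lambda>n. (transfer ^^ n) f x) \<longlonglongrightarrow> ergodic_mean f"
proof -
  obtain L where L: "\<And>x. x \<in> M \<Longrightarrow> (\<lambda>n. (transfer ^^ n) f x) \<longlonglongrightarrow> L"
    using transfer_power_converges[OF f] by metis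
  then have "ergodic_mean f = L" unfolding ergodic_mean_def using base_in by (intro limI) auto
  with L x show ?thesis by simp
qed

lemma integral_transfer_power_tendsto:
  assumes \<mu>: "probability_on mtopology \<mu>"
    and f: "continuous_real f" "\<And>x. x \<in> M \<Longrightarrow> \<bar>f x\<bar> \<le> D"
  shows "(\<lambda>n. \<integral>x. (transfer ^^ n) f x \<partial>\<mu>) \<longlonglongrightarrow> ergodic_mean f"
proof -
  interpret prob_space \<mu> using \<mu> by (simp add: probability_on_def)
  have sp: "space \<mu> = M" using \<mu> by (rule probability_on_space)
  have "(\<lambda>n. \<integral>x. (transfer ^^ n) f x \<partial>\<mu>) \<longlonglongrightarrow> (\<integral>x. ergodic_mean f \<partial>\<mu>)"
  proof (rule integral_dominated_convergence[where w = "\<lambda>_. D"])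
    show "(\<lambda>x. (transfer ^^ n) f x) \<in> borel_measurable \<mu>" for n
      using continuous_map_borel_measurable[OF transfer_power_continuous[OF f(1)]] \<mu>
      by (simp add: probability_on_def cong: measurable_cong_sets)
    show "AE x in \<mu>. (\<lambda>n. (transfer ^^ n) f x) \<longlonglongrightarrow> ergodic_mean f"
      using transfer_power_tendsto[OF f] sp by (intro AE_I2) auto
    show "AE x in \<mu>. norm ((transfer ^^ n) f x) \<le> D" for n
      using transfer_power_bound[OF _ f(2)] sp by (intro AE_I2) auto
  qed auto
  then show ?thesis by (simp add: prob_space)
qed

text \<open>
  The asymptotic frequency of a word. It exists because the probability of a fixed word is a bounded
  continuous function of the starting point.
\<close>

definition word_freq :: "'b list \<Rightarrow> real" where
  "word_freq w = ergodic_mean (\<lambda>x. word_prob x w)"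

lemma word_freq_tendsto:
  "set w \<subseteq> B \<Longrightarrow> (\<lambda>n. (transfer ^^ n) (\<lambda>x. word_prob x w) base) \<longlonglongrightarrow> word_freq w"
  unfolding word_freq_def
  by (rule transfer_power_tendsto[where D = 1])
    (auto simp: continuous_word_prob base_in word_prob_nonneg word_prob_le_1)

lemma word_freq_nonneg: "set w \<subseteq> B \<Longrightarrow> 0 \<le> word_freq w"
  by (rule LIMSEQ_le_const[OF word_freq_tendsto])
    (auto simp: transfer_power base_in intro!: sum_nonneg mult_nonneg_nonneg word_prob_nonneg)

lemma word_freq_Nil: "word_freq [] = 1"
  using word_freq_tendsto[of "[]"] sum_word_prob[OF base_in]
  by (simp add: transfer_power base_in LIMSEQ_const_iff)

text \<open>
  Prepending a letter and summing over it is one more application of the transfer operator, which the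
  limit does not see. Frequencies are thus consistent under extension of words into the past.
\<close>

lemma word_freq_Cons:
  assumes w: "set w \<subseteq> B"
  shows "(\<Sum>a\<in>B. word_freq (a # w)) = word_freq w"
proof (rule LIMSEQ_unique)
  show "(\<lambda>n. \<Sum>a\<in>B. (transfer ^^ n) (\<lambda>x. word_prob x (a # w)) base) \<longlonglongrightarrow> (\<Sum>a\<in>B. word_freq (a # w))"
    using w by (intro tendsto_sum word_freq_tendsto) auto
  have eq: "(\<Sum>a\<in>B. (transfer ^^ n) (\<lambda>x. word_prob x (a # w)) base)
      = (transfer ^^ Suc n) (\<lambda>x. word_prob x w) base" for n
  proof -
    have "(transfer ^^ Suc n) (\<lambda>x. word_prob x w) base
        = (\<Sum>v\<in>words n. \<Sum>a\<in>B. word_prob base v * word_prob (fold T v base) (a # w))"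
      unfolding funpow_Suc_right o_apply transfer_power[OF base_in]
      by (simp add: transfer_def sum_distrib_left)
    also have "\<dots> = (\<Sum>a\<in>B. \<Sum>v\<in>words n. word_prob base v * word_prob (fold T v base) (a # w))"
      by (rule sum.swap)
    finally show ?thesis unfolding transfer_power[OF base_in] by simp
  qed
  show "(\<lambda>n. \<Sum>a\<in>B. (transfer ^^ n) (\<lambda>x. word_prob x (a # w)) base) \<longlonglongrightarrow> word_freq w"
    unfolding eq using word_freq_tendsto[OF w] by (rule LIMSEQ_Suc)
qed

lemma base_ball:
  obtains R where "0 \<le> R" "base \<in> mcball base R"
    "\<And>b x. b \<in> B \<Longrightarrow> x \<in> mcball base R \<Longrightarrow> T b x \<in> mcball base R"
proof -
  obtain R0 where "\<And>R b x. R0 \<le> R \<Longrightarrow> b \<in> B \<Longrightarrow> x \<in> mcball base R \<Longrightarrow> T b x \<in> mcball base R"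
    using invariant_ball[OF base_in] by metis
  from this[OF max.cobounded2] show thesis
    using base_in by (intro that[of "max 0 R0"]) (simp, simp, blast)
qed

text \<open>
  After \<open>k + n\<close> steps from the base point, the position is determined up to \<open>\<rho>\<^sup>n R\<close> by the last \<open>n\<close> letters
  alone. Replacing the position by the end point of these letters started at the base point changes the
  average of \<open>f\<close> by little, uniformly in \<open>k\<close>; now let \<open>k\<close> tend to infinity.
\<close>

lemma word_average_tendsto:
  assumes f: "continuous_real f" "\<And>x. x \<in> M \<Longrightarrow> \<bar>f x\<bar> \<le> D"
  shows "(\<lambda>n. \<Sum>w\<in>words n. word_freq w * f (fold T w base)) \<longlonglongrightarrow> ergodic_mean f"
proof (rule LIMSEQ_I)
  fix e :: real assume e: "0 < e"
  obtain R where R: "0 \<le> R" "base \<in> mcball base R"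
    "\<And>b x. b \<in> B \<Longrightarrow> x \<in> mcball base R \<Longrightarrow> T b x \<in> mcball base R"
    using base_ball by metis
  obtain t where t: "0 < t" "\<And>x y. x \<in> mcball base R \<Longrightarrow> y \<in> M \<Longrightarrow> d x y < t \<Longrightarrow> \<bar>f x - f y\<bar> < e/2"
    using uniformly_continuous_near_compact[OF compact_cballs[OF base_in, of R] f(1), of "e/2"] e by auto
  obtain n0 where n0: "\<And>n. n0 \<le> n \<Longrightarrow> \<rho> ^ n * R < t" using power_rate_small[OF t(1)] by blast
  show "\<exists>n0. \<forall>n\<ge>n0. norm ((\<Sum>w\<in>words n. word_freq w * f (fold T w base)) - ergodic_mean f) < e"
  proof (intro exI[of _ n0] allI impI)
    fix n assume n: "n0 \<le> n"
    define g where "g x = (\<Sum>w\<in>words n. word_prob x w * f (fold T w base))" for x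
    have "\<bar>(\<Sum>w\<in>words n. word_freq w * f (fold T w base)) - ergodic_mean f\<bar> \<le> e/2"
    proof (rule abs_diff_limits_le)
      show "(\<lambda>k. \<Sum>w\<in>words n. (transfer ^^ k) (\<lambda>x. word_prob x w) base * f (fold T w base))
          \<longlonglongrightarrow> (\<Sum>w\<in>words n. word_freq w * f (fold T w base))"
        by (intro tendsto_sum tendsto_mult tendsto_const word_freq_tendsto) (simp add: words_def)
      show "(\<lambda>k. (transfer ^^ (k + n)) f base) \<longlonglongrightarrow> ergodic_mean f"
        using transfer_power_tendsto[OF f base_in] by (rule LIMSEQ_ignore_initial_segment)
      fix k
      have eq1: "(transfer ^^ (k + n)) f base =
          (\<Sum>v\<in>words k. word_prob base v * (transfer ^^ n) f (fold T v base))"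
        by (simp add: funpow_add transfer_power[OF base_in])
      have eq2: "(\<Sum>w\<in>words n. (transfer ^^ k) (\<lambda>x. word_prob x w) base * f (fold T w base))
          = (\<Sum>v\<in>words k. word_prob base v * g (fold T v base))"
      proof -
        have "(\<Sum>w\<in>words n. (transfer ^^ k) (\<lambda>x. word_prob x w) base * f (fold T w base))
          = (\<Sum>w\<in>words n. \<Sum>v\<in>words k. word_prob base v * (word_prob (fold T v base) w * f (fold T w base)))"
          by (simp add: transfer_power[OF base_in] sum_distrib_right mult.assoc)
        also have "\<dots> = (\<Sum>v\<in>words k. \<Sum>w\<in>words n. word_prob base v * (word_prob (fold T v base) w * f (fold T w base)))"
          by (rule sum.swap)
        finally show ?thesis by (simp add: g_def sum_distrib_left)
      qed
      have near: "\<bar>g y - (transfer ^^ n) f y\<bar> \<le> e/2" if y: "y \<in> mcball base R" for y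
      proof -
        have yM: "y \<in> M" using y by (simp add: in_mcball)
        have eq: "g y - (transfer ^^ n) f y =
            (\<Sum>w\<in>words n. word_prob y w * (f (fold T w base) - f (fold T w y)))"
          by (simp add: g_def transfer_power[OF yM] right_diff_distrib sum_subtractf)
        have "\<bar>g y - (transfer ^^ n) f y\<bar> \<le> (\<Sum>w\<in>words n. word_prob y w * (e/2))"
          unfolding eq
        proof (rule order_trans[OF sum_abs], rule sum_mono)
          fix w assume "w \<in> words n"
          then have w: "set w \<subseteq> B" "length w = n" by (auto simp: words_def)
          have "d (fold T w base) (fold T w y) \<le> \<rho> ^ n * d base y"
            using fold_contraction[OF w(1) base_in yM] w(2) by simp
          also have "\<dots> \<le> \<rho> ^ n * R"
            using rho y by (intro mult_left_mono) (auto simp: in_mcball)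
          also have "\<dots> < t" using n0[OF n] .
          finally have "\<bar>f (fold T w base) - f (fold T w y)\<bar> < e/2"
            using t(2) fold_invariant[OF R(3) w(1) R(2)] fold_closed[OF w(1) yM] by blast
          then show "\<bar>word_prob y w * (f (fold T w base) - f (fold T w y))\<bar> \<le> word_prob y w * (e/2)"
            unfolding abs_mult abs_of_nonneg[OF word_prob_nonneg]
            by (intro mult_left_mono word_prob_nonneg less_imp_le)
        qed
        also have "\<dots> = e/2"
          using sum_word_prob[OF yM, of n] unfolding sum_distrib_right[symmetric] by simp
        finally show ?thesis .
      qed
      have "\<bar>(\<Sum>v\<in>words k. word_prob base v * g (fold T v base))
            - (\<Sum>v\<in>words k. word_prob base v * (transfer ^^ n) f (fold T v base))\<bar>
          \<le> (\<Sum>v\<in>words k. word_prob base v * (e/2))"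
        unfolding sum_subtractf[symmetric] right_diff_distrib[symmetric]
      proof (rule order_trans[OF sum_abs], rule sum_mono)
        fix v assume "v \<in> words k"
        then have "fold T v base \<in> mcball base R"
          by (intro fold_invariant[OF R(3)] R(2)) (auto simp: words_def)
        then show "\<bar>word_prob base v * (g (fold T v base) - (transfer ^^ n) f (fold T v base))\<bar>
            \<le> word_prob base v * (e/2)"
          unfolding abs_mult abs_of_nonneg[OF word_prob_nonneg]
          by (intro mult_left_mono word_prob_nonneg near)
      qed
      also have "\<dots> = e/2"
        using sum_word_prob[OF base_in, of k] unfolding sum_distrib_right[symmetric] by simp
      finally show "\<bar>(\<Sum>w\<in>words n. (transfer ^^ k) (\<lambda>x. word_prob x w) base * f (fold T w base))
          - (transfer ^^ (k + n)) f base\<bar> \<le> e/2"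
        unfolding eq1 eq2 .
    qed
    then show "norm ((\<Sum>w\<in>words n. word_freq w * f (fold T w base)) - ergodic_mean f) < e"
      using e by simp
  qed
qed

text \<open>
  A Cauchy sequence in a compact ball, with the explicit rate carried over to the limit.
\<close>

lemma limit_point_exists:
  assumes x: "\<And>n. x n \<in> mcball base R" and close: "\<And>n m. n \<le> m \<Longrightarrow> d (x m) (x n) \<le> \<rho> ^ n * R"
  shows "\<exists>l\<in>M. \<forall>n. d l (x n) \<le> \<rho> ^ n * R"
proof -
  have "range x \<subseteq> mcball base R" using x by auto
  then obtain l r where l: "l \<in> mcball base R" "strict_mono r" "limitin mtopology (x \<circ> r) l sequentially"
    using compact_cballs[OF base_in, of R] unfolding compactin_sequentially by metis
  have lM: "l \<in> M" using l(1) by (simp add: in_mcball)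
  have "d l (x n) \<le> \<rho> ^ n * R" for n
  proof (rule field_le_epsilon)
    fix e :: real assume "0 < e"
    then have "eventually (\<lambda>k. (x \<circ> r) k \<in> M \<and> d ((x \<circ> r) k) l < e) sequentially"
      using l(3) unfolding limitin_metric by blast
    then obtain k0 where k0: "\<And>k. k0 \<le> k \<Longrightarrow> d (x (r k)) l < e"
      by (auto simp: eventually_sequentially)
    define k where "k = max k0 n"
    have "n \<le> r k" using seq_suble[OF l(2), of k] by (simp add: k_def)
    have xM: "x m \<in> M" for m using x[of m] by (simp add: in_mcball)
    have "d l (x n) \<le> d l (x (r k)) + d (x (r k)) (x n)" by (rule triangle[OF lM xM xM])
    also have "\<dots> \<le> e + \<rho> ^ n * R"
      using k0[of k] close[OF \<open>n \<le> r k\<close>] commute[of l] by (intro add_mono) (auto simp: k_def)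
    finally show "d l (x n) \<le> \<rho> ^ n * R + e" by simp
  qed
  with lM show ?thesis by blast
qed

text \<open>
  The frequencies of words define a stationary process of letters, indexed into the past: letter 0 is the
  most recent one. Applying the maps of the last \<open>n\<close> letters to the base point, the oldest first, gives
  points \<open>x n\<close> that converge, since enlarging \<open>n\<close> only changes what happens before \<open>n\<close> contractions.
  The law of the limit integrates \<open>f\<close> to the limit of the averages of \<open>f (x n)\<close>.
\<close>

lemma ergodic_measure_exists:
  obtains \<mu> where "probability_on mtopology \<mu>"
    "\<And>f D. continuous_real f \<Longrightarrow> (\<And>x. x \<in> M \<Longrightarrow> \<bar>f x\<bar> \<le> D) \<Longrightarrow>
      (\<integral>x. f x \<partial>\<mu>) = ergodic_mean f"
proof -
  have q: "\<And>w. set w \<subseteq> B \<Longrightarrow> 0 \<le> word_freq (rev w)" "word_freq (rev []) = 1"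
    "\<And>w. set w \<subseteq> B \<Longrightarrow> (\<Sum>a\<in>B. word_freq (rev (w @ [a]))) = word_freq (rev w)"
    by (simp_all add: word_freq_nonneg word_freq_Nil word_freq_Cons)
  obtain P :: "(nat \<Rightarrow> nat discrete) measure" and X :: "nat \<Rightarrow> (nat \<Rightarrow> nat discrete) \<Rightarrow> 'b"
    where PX: "prob_space P \<and> (\<forall>n \<eta>. X n \<eta> \<in> B) \<and>
    (\<forall>w. set w \<subseteq> B \<longrightarrow> {\<eta>\<in>space P. map (\<lambda>i. X i \<eta>) [0..<length w] = w} \<in> sets P \<and>
       measure P {\<eta>\<in>space P. map (\<lambda>i. X i \<eta>) [0..<length w] = w} = word_freq (rev w))"
    using letter_process_exists[where q = "\<lambda>w. word_freq (rev w)", OF finite_letters q] by blast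
  then have P: "prob_space P" and X: "\<And>n \<eta>. X n \<eta> \<in> B"
    and cyl: "\<And>w. set w \<subseteq> B \<Longrightarrow> {\<eta>\<in>space P. map (\<lambda>i. X i \<eta>) [0..<length w] = w} \<in> sets P"
    and cyl_prob: "\<And>w. set w \<subseteq> B \<Longrightarrow>
      measure P {\<eta>\<in>space P. map (\<lambda>i. X i \<eta>) [0..<length w] = w} = word_freq (rev w)"
    by blast+
  interpret P: prob_space P by fact
  \<comment> \<open>The words \<open>past n \<eta>\<close> are ordered in time, hence the reversal, and grow at their front.\<close>
  define past where "past n \<eta> = rev (map (\<lambda>i. X i \<eta>) [0..<n])" for n \<eta>
  have past_words: "past n \<eta> \<in> words n" for n \<eta> using X by (auto simp: past_def words_def)
  define C where "C w = {\<eta>\<in>space P. past (length w) \<eta> = w}" for w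
  have C_eq: "C w = {\<eta>\<in>space P. map (\<lambda>i. X i \<eta>) [0..<length (rev w)] = rev w}" for w
    by (auto simp: C_def past_def rev_swap)
  have C_sets: "C w \<in> sets P" if "set w \<subseteq> B" for w
    unfolding C_eq using that by (intro cyl) auto
  have C_prob: "measure P (C w) = word_freq w" if "set w \<subseteq> B" for w
    unfolding C_eq using that by (subst cyl_prob) auto
  obtain R where R: "0 \<le> R" "base \<in> mcball base R"
    "\<And>b x. b \<in> B \<Longrightarrow> x \<in> mcball base R \<Longrightarrow> T b x \<in> mcball base R"
    using base_ball by metis
  define x where "x n \<eta> = fold T (past n \<eta>) base" for n \<eta>
  have past_set: "set (past n \<eta>) \<subseteq> B" for n \<eta> using past_words by (auto simp: words_def)
  have x_ball: "x n \<eta> \<in> mcball base R" for n \<eta>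
    unfolding x_def by (rule fold_invariant[OF R(3) past_set R(2)])
  have x_M: "x n \<eta> \<in> M" for n \<eta> using x_ball[of n \<eta>] by (simp add: in_mcball)
  have x_close: "d (x m \<eta>) (x n \<eta>) \<le> \<rho> ^ n * R" if "n \<le> m" for n m \<eta>
  proof -
    define u where "u = rev (map (\<lambda>i. X i \<eta>) [n..<m])"
    have "past m \<eta> = u @ past n \<eta>"
      using upt_add_eq_append[of 0 n "m - n"] that by (simp add: past_def u_def flip: map_append rev_append)
    then have xm: "x m \<eta> = fold T (past n \<eta>) (fold T u base)" by (simp add: x_def)
    have u: "set u \<subseteq> B" using X by (auto simp: u_def)
    have ball: "fold T u base \<in> mcball base R" by (rule fold_invariant[OF R(3) u R(2)])
    have "d (x m \<eta>) (x n \<eta>) \<le> \<rho> ^ length (past n \<eta>) * d (fold T u base) base"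
      unfolding xm x_def[of n] by (rule fold_contraction[OF past_set fold_closed[OF u base_in] base_in])
    also have "\<dots> = \<rho> ^ n * d (fold T u base) base" by (simp add: past_def)
    also have "\<dots> \<le> \<rho> ^ n * R"
      using rho ball commute[of base] by (intro mult_left_mono) (auto simp: in_mcball)
    finally show ?thesis .
  qed
  have "\<forall>\<eta>. \<exists>l\<in>M. \<forall>n. d l (x n \<eta>) \<le> \<rho> ^ n * R"
    using limit_point_exists[OF x_ball x_close] by blast
  then obtain \<Phi> where \<Phi>: "\<And>\<eta>. \<Phi> \<eta> \<in> M" "\<And>n \<eta>. d (\<Phi> \<eta>) (x n \<eta>) \<le> \<rho> ^ n * R" by metis
  have \<Phi>_meas: "\<Phi> \<in> measurable P borel_M"
  proof (rule measurable_borel_of_topologyI)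
    show "\<Phi> \<eta> \<in> topspace mtopology" for \<eta> using \<Phi>(1) by simp
    fix U assume U: "openin mtopology U"
    \<comment> \<open>A limit point in \<open>U\<close> stays in \<open>U\<close> when only letters far in the past change, so the
      preimage of \<open>U\<close> is a countable union of cylinders.\<close>
    define W where "W = {w. set w \<subseteq> B \<and> C w \<subseteq> \<Phi> -` U}"
    have "\<Phi> -` U \<inter> space P = (\<Union>w\<in>W. C w)"
    proof
      show "(\<Union>w\<in>W. C w) \<subseteq> \<Phi> -` U \<inter> space P" by (auto simp: W_def C_def)
      show "\<Phi> -` U \<inter> space P \<subseteq> (\<Union>w\<in>W. C w)"
      proof
        fix \<eta> assume \<eta>: "\<eta> \<in> \<Phi> -` U \<inter> space P"
        then obtain e where e: "e > 0" "mball (\<Phi> \<eta>) e \<subseteq> U"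
          using U unfolding openin_mtopology by blast
        obtain n where n: "\<rho> ^ n * R < e/2" using power_rate_small[of "e/2" R] e(1) by auto
        have "C (past n \<eta>) \<subseteq> \<Phi> -` U"
        proof
          fix \<zeta> assume "\<zeta> \<in> C (past n \<eta>)"
          then have "past n \<zeta> = past n \<eta>" by (simp add: C_def past_def)
          then have "x n \<zeta> = x n \<eta>" by (simp add: x_def)
          have "d (\<Phi> \<eta>) (\<Phi> \<zeta>) \<le> d (\<Phi> \<eta>) (x n \<eta>) + d (x n \<eta>) (\<Phi> \<zeta>)"
            by (rule triangle[OF \<Phi>(1) x_M \<Phi>(1)])
          also have "\<dots> < e"
            using \<Phi>(2)[of \<eta> n] \<Phi>(2)[of \<zeta> n] \<open>x n \<zeta> = x n \<eta>\<close> n commute[of "x n \<eta>"] by simp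
          finally show "\<zeta> \<in> \<Phi> -` U" using e \<Phi>(1) by (auto simp: in_mball)
        qed
        moreover have "\<eta> \<in> C (past n \<eta>)" using \<eta> by (simp add: C_def past_def)
        ultimately show "\<eta> \<in> (\<Union>w\<in>W. C w)"
          using past_set[of n \<eta>] unfolding W_def by blast
      qed
    qed
    moreover have "countable W"
    proof (rule countable_subset)
      show "W \<subseteq> lists B" by (auto simp: W_def)
      show "countable (lists B)" using finite_letters by (simp add: countable_finite countable_lists)
    qed
    moreover have "C w \<in> sets P" if "w \<in> W" for w using that C_sets by (simp add: W_def)
    ultimately show "\<Phi> -` U \<inter> space P \<in> sets P" by (simp add: sets.countable_UN'')
  qed
  define \<mu> where "\<mu> = distr P borel_M \<Phi>"
  show thesis
  proof (rule that[of \<mu>])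
    show "probability_on mtopology \<mu>"
      unfolding probability_on_def \<mu>_def using P.prob_space_distr[OF \<Phi>_meas] by simp
    fix f and D :: real
    assume f: "continuous_real f" and D: "\<And>x. x \<in> M \<Longrightarrow> \<bar>f x\<bar> \<le> D"
    have fx: "f (x n \<eta>) = (\<Sum>w\<in>words n. f (fold T w base) * indicator (C w) \<eta>)"
      if "\<eta> \<in> space P" for n \<eta>
    proof -
      have "(\<Sum>w\<in>words n. f (fold T w base) * indicator (C w) \<eta>)
          = (\<Sum>w\<in>words n. if w = past n \<eta> then f (fold T w base) else 0)"
        using that by (intro sum.cong) (auto simp: C_def words_def indicator_def)
      then show ?thesis using finite_words past_words by (simp add: x_def)
    qed
    have C_int: "integrable P (\<lambda>\<eta>. f (fold T w base) * indicator (C w) \<eta>)" if "w \<in> words n" for w n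
      using C_sets that by (intro integrable_mult_right integrable_real_indicator) (auto simp: words_def P.emeasure_eq_measure)
    have int_x: "(\<integral>\<eta>. f (x n \<eta>) \<partial>P) = (\<Sum>w\<in>words n. word_freq w * f (fold T w base))" for n
    proof -
      have "(\<integral>\<eta>. f (x n \<eta>) \<partial>P) = (\<integral>\<eta>. (\<Sum>w\<in>words n. f (fold T w base) * indicator (C w) \<eta>) \<partial>P)"
        by (intro Bochner_Integration.integral_cong refl fx)
      also have "\<dots> = (\<Sum>w\<in>words n. \<integral>\<eta>. f (fold T w base) * indicator (C w) \<eta> \<partial>P)"
        by (rule Bochner_Integration.integral_sum) (rule C_int)
      also have "\<dots> = (\<Sum>w\<in>words n. word_freq w * f (fold T w base))"
      proof (rule sum.cong[OF refl])
        fix w assume "w \<in> words n"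
        then have w: "set w \<subseteq> B" by (simp add: words_def)
        have "C w \<inter> space P = C w" by (auto simp: C_def)
        then show "(\<integral>\<eta>. f (fold T w base) * indicator (C w) \<eta> \<partial>P) = word_freq w * f (fold T w base)"
          using C_prob[OF w] by (simp add: mult.commute)
      qed
      finally show ?thesis .
    qed
    have "(\<lambda>n. \<integral>\<eta>. f (x n \<eta>) \<partial>P) \<longlonglongrightarrow> (\<integral>\<eta>. f (\<Phi> \<eta>) \<partial>P)"
    proof (rule integral_dominated_convergence[where w = "\<lambda>_. D"])
      have "(\<lambda>\<eta>. \<Sum>w\<in>words n. f (fold T w base) * indicator (C w) \<eta>) \<in> borel_measurable P" for n
        using C_int by (intro borel_measurable_sum) blast
      then show "(\<lambda>\<eta>. f (x n \<eta>)) \<in> borel_measurable P" for n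
        using fx by (simp cong: measurable_cong)
      show "(\<lambda>\<eta>. f (\<Phi> \<eta>)) \<in> borel_measurable P"
        by (rule measurable_compose[OF \<Phi>_meas continuous_map_borel_measurable[OF f]])
      show "AE \<eta> in P. norm (f (x n \<eta>)) \<le> D" for n using D x_M by (intro AE_I2) auto
      show "AE \<eta> in P. (\<lambda>n. f (x n \<eta>)) \<longlonglongrightarrow> f (\<Phi> \<eta>)"
      proof (rule AE_I2, rule LIMSEQ_I)
        fix \<eta> and e :: real assume "0 < e"
        then obtain t where t: "0 < t" "\<And>y. y \<in> M \<Longrightarrow> d (\<Phi> \<eta>) y < t \<Longrightarrow> \<bar>f (\<Phi> \<eta>) - f y\<bar> < e"
          using f \<Phi>(1) unfolding continuous_map_to_real_iff by metis
        obtain n0 where "\<And>n. n0 \<le> n \<Longrightarrow> \<rho> ^ n * R < t" using power_rate_small[OF t(1)] by blast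
        then have "\<bar>f (\<Phi> \<eta>) - f (x n \<eta>)\<bar> < e" if "n0 \<le> n" for n
          using t(2)[OF x_M] \<Phi>(2)[of \<eta> n] that by (meson le_less_trans)
        then show "\<exists>n0. \<forall>n\<ge>n0. norm (f (x n \<eta>) - f (\<Phi> \<eta>)) < e"
          by (intro exI[of _ n0]) (simp add: abs_minus_commute)
      qed
    qed auto
    then have "(\<lambda>n. \<Sum>w\<in>words n. word_freq w * f (fold T w base)) \<longlonglongrightarrow> (\<integral>\<eta>. f (\<Phi> \<eta>) \<partial>P)"
      unfolding int_x .
    then have "(\<integral>\<eta>. f (\<Phi> \<eta>) \<partial>P) = ergodic_mean f"
      using LIMSEQ_unique word_average_tendsto[OF f D] by blast
    then show "(\<integral>x. f x \<partial>\<mu>) = ergodic_mean f"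
      unfolding \<mu>_def integral_distr[OF \<Phi>_meas continuous_map_borel_measurable[OF f]] .
  qed
qed

text \<open>
  Integrals against the law at time \<open>k\<close> are integrals of \<open>(transfer ^^ k) f\<close> against the initial law, so
  dominated convergence turns the pointwise limit into weak convergence. An invariant law equals its
  own limit, which gives uniqueness; the limit functional is invariant under the transfer operator,
  which gives invariance.
\<close>

theorem converges_to_unique_invariant_kernel:
  "converges_to_unique_invariant mtopology kernel"
proof -
  obtain \<mu> where \<mu>: "probability_on mtopology \<mu>"
    "\<And>f D. continuous_real f \<Longrightarrow> (\<And>x. x \<in> M \<Longrightarrow> \<bar>f x\<bar> \<le> D) \<Longrightarrow>
      (\<integral>x. f x \<partial>\<mu>) = ergodic_mean f"
    using ergodic_measure_exists by metis
  have "\<mu> \<bind> kernel = \<mu>"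
  proof (rule measure_eqI_bounded_continuous[OF probability_on_bind[OF \<mu>(1)] \<mu>(1)])
    fix f assume f: "continuous_real f" "\<And>x. x \<in> M \<Longrightarrow> \<bar>f x\<bar> \<le> 1"
    have bound: "\<bar>transfer f x\<bar> \<le> 1" if "x \<in> M" for x
      using transfer_power_bound[of x f 1 1] that f by simp
    have "ergodic_mean (transfer f) = ergodic_mean f"
    proof (rule LIMSEQ_unique[OF transfer_power_tendsto[OF continuous_transfer[OF f(1)] bound base_in]])
      show "(\<lambda>n. (transfer ^^ n) (transfer f) base) \<longlonglongrightarrow> ergodic_mean f"
        using LIMSEQ_Suc[OF transfer_power_tendsto[OF f base_in]] by (simp add: funpow_swap1)
    qed
    then show "(\<integral>x. f x \<partial>(\<mu> \<bind> kernel)) = (\<integral>x. f x \<partial>\<mu>)"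
      using integral_bind_kernel[OF \<mu>(1) continuous_map_borel_measurable[OF f(1)] f(2)]
        \<mu>(2)[OF f] \<mu>(2)[OF continuous_transfer[OF f(1)] bound] by simp
  qed
  then have inv: "invariant_probability mtopology kernel \<mu>"
    using \<mu>(1) by (simp add: invariant_probability_def)
  have unique: "\<nu> = \<mu>" if "invariant_probability mtopology kernel \<nu>" for \<nu>
  proof -
    have \<nu>: "probability_on mtopology \<nu>" "\<nu> \<bind> kernel = \<nu>"
      using that by (auto simp: invariant_probability_def)
    have fix_law: "law_at kernel \<nu> k = \<nu>" for k
      unfolding law_at_def by (induction k) (auto simp: \<nu>(2))
    show ?thesis
    proof (rule measure_eqI_bounded_continuous[OF \<nu>(1) \<mu>(1)])
      fix f assume f: "continuous_real f" "\<And>x. x \<in> M \<Longrightarrow> \<bar>f x\<bar> \<le> 1"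
      have "(\<integral>x. (transfer ^^ k) f x \<partial>\<nu>) = (\<integral>x. f x \<partial>\<nu>)" for k
        using integral_law_at[OF \<nu>(1) f, of k] by (simp add: fix_law)
      then show "(\<integral>x. f x \<partial>\<nu>) = (\<integral>x. f x \<partial>\<mu>)"
        using integral_transfer_power_tendsto[OF \<nu>(1) f] \<mu>(2)[OF f] by (simp add: LIMSEQ_const_iff)
    qed
  qed
  have "converges_weakly mtopology (law_at kernel \<mu>\<^sub>0) \<mu>" if "probability_on mtopology \<mu>\<^sub>0" for \<mu>\<^sub>0
    unfolding converges_weakly_def
  proof (intro allI impI)
    fix f assume f: "continuous_real f" and "bounded (f ` topspace mtopology)"
    then obtain D where D: "\<And>x. x \<in> M \<Longrightarrow> \<bar>f x\<bar> \<le> D" by (auto simp: bounded_iff)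
    show "(\<lambda>k. \<integral>x. f x \<partial>law_at kernel \<mu>\<^sub>0 k) \<longlonglongrightarrow> (\<integral>x. f x \<partial>\<mu>)"
      using integral_transfer_power_tendsto[OF that f D] integral_law_at[OF that f D] \<mu>(2)[OF f D]
      by simp
  qed
  with inv unique show ?thesis unfolding converges_to_unique_invariant_def by blast
qed

end

section \<open>Norms adapted to Schur matrices\<close>

text \<open>
  A norm on \<open>n\<close> coordinates in which \<open>A\<close> contracts by \<open>\<sigma>\<close>. It is a function of all sequences that only sees the
  first \<open>n\<close> entries (a consequence of the upper bound), which spares carrier conditions for differences
  of vectors.
\<close>

definition lyapunov_norm :: "nat \<Rightarrow> real mat \<Rightarrow> real \<Rightarrow> ((nat \<Rightarrow> real) \<Rightarrow> real) \<Rightarrow> bool" where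
  "lyapunov_norm n A \<sigma> V \<longleftrightarrow>
     (\<forall>g h. V (\<lambda>j. g j + h j) \<le> V g + V h) \<and>
     (\<forall>a g. V (\<lambda>j. a * g j) = \<bar>a\<bar> * V g) \<and>
     (\<forall>g. \<forall>j<n. \<bar>g j\<bar> \<le> V g) \<and>
     (\<exists>C\<ge>0. \<forall>g. V g \<le> C * (\<Sum>j<n. \<bar>g j\<bar>)) \<and>
     (\<forall>g. V (\<lambda>i. \<Sum>j<n. A $$ (i, j) * g j) \<le> \<sigma> * V g)"

lemma lyapunov_normD:
  assumes "lyapunov_norm n A \<sigma> V"
  shows "V (\<lambda>j. g j + h j) \<le> V g + V h" "V (\<lambda>j. a * g j) = \<bar>a\<bar> * V g"
    "j < n \<Longrightarrow> \<bar>g j\<bar> \<le> V g" "V (\<lambda>i. \<Sum>j<n. A $$ (i, j) * g j) \<le> \<sigma> * V g"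
    "\<exists>C\<ge>0. \<forall>g. V g \<le> C * (\<Sum>j<n. \<bar>g j\<bar>)"
  using assms unfolding lyapunov_norm_def by blast+

lemma lyapunov_norm_zero: "lyapunov_norm n A \<sigma> V \<Longrightarrow> V (\<lambda>j. 0) = 0"
  using lyapunov_normD(2)[of n A \<sigma> V 0 "\<lambda>j. 0"] by simp

lemma lyapunov_norm_minus: "lyapunov_norm n A \<sigma> V \<Longrightarrow> V (\<lambda>j. - g j) = V g"
  using lyapunov_normD(2)[of n A \<sigma> V "-1" g] by simp

lemma lyapunov_norm_nonneg:
  assumes "lyapunov_norm n A \<sigma> V" shows "0 \<le> V g"
  using lyapunov_normD(1)[OF assms, of g "\<lambda>j. - g j"] lyapunov_norm_minus[OF assms, of g]
    lyapunov_norm_zero[OF assms] by simp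

lemma lyapunov_norm_cong:
  assumes V: "lyapunov_norm n A \<sigma> V" and eq: "\<And>j. j < n \<Longrightarrow> g j = h j"
  shows "V g = V h"
proof -
  have le: "V g \<le> V h" if "\<And>j. j < n \<Longrightarrow> g j = h j" for g h
  proof -
    obtain C where "\<And>g. V g \<le> C * (\<Sum>j<n. \<bar>g j\<bar>)" using lyapunov_normD(5)[OF V] by blast
    from this[of "\<lambda>j. g j - h j"] have "V (\<lambda>j. g j - h j) \<le> 0" using that by simp
    then show ?thesis using lyapunov_normD(1)[OF V, of h "\<lambda>j. g j - h j"] by simp
  qed
  show ?thesis using le[of g h] le[of h g] eq by force
qed

lemma lyapunov_norm_mono:
  assumes V: "lyapunov_norm n A \<sigma> V" and le: "\<sigma> \<le> \<tau>"
  shows "lyapunov_norm n A \<tau> V"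
proof -
  have "V (\<lambda>i. \<Sum>j<n. A $$ (i, j) * g j) \<le> \<tau> * V g" for g
    using lyapunov_normD(4)[OF V, of g] mult_right_mono[OF le lyapunov_norm_nonneg[OF V, of g]]
    by linarith
  then show ?thesis using V unfolding lyapunov_norm_def by blast
qed

lemma smult_pow_mat:
  fixes A :: "'a :: comm_ring_1 mat"
  assumes A: "A \<in> carrier_mat n n"
  shows "(a \<cdot>\<^sub>m A) ^\<^sub>m k = a ^ k \<cdot>\<^sub>m (A ^\<^sub>m k)"
proof (induction k)
  case 0
  show ?case using A by (intro eq_matI) auto
next
  case (Suc k)
  have Ak: "A ^\<^sub>m k \<in> carrier_mat n n" using A by simp
  have "(a \<cdot>\<^sub>m A) ^\<^sub>m Suc k = (a ^ k \<cdot>\<^sub>m (A ^\<^sub>m k)) * (a \<cdot>\<^sub>m A)" by (simp add: Suc)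
  also have "\<dots> = a ^ k \<cdot>\<^sub>m ((A ^\<^sub>m k) * (a \<cdot>\<^sub>m A))"
    using mult_smult_assoc_mat[OF Ak, of "a \<cdot>\<^sub>m A" n] A by simp
  also have "\<dots> = a ^ k \<cdot>\<^sub>m (a \<cdot>\<^sub>m ((A ^\<^sub>m k) * A))"
    using mult_smult_distrib[OF Ak A] by simp
  also have "\<dots> = a ^ Suc k \<cdot>\<^sub>m (A ^\<^sub>m Suc k)"
    by (intro eq_matI) (auto simp: mult_ac)
  finally show ?case .
qed

text \<open>
  For \<open>\<rho>\<close> between the spectral radius and 1, the matrix \<open>A / \<rho>\<close> still has spectral radius below 1, so its powers
  are bounded by the Jordan normal form.
\<close>

lemma schur_power_bound:
  assumes A: "A \<in> carrier_mat n n" and "schur A" and n: "0 < n"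
  obtains \<rho> K where "0 < \<rho>" "\<rho> < 1" "0 \<le> K"
    "\<And>k i j. i < n \<Longrightarrow> j < n \<Longrightarrow> \<bar>(A ^\<^sub>m k) $$ (i, j)\<bar> \<le> K * \<rho> ^ k"
proof -
  define Ac where "Ac = map_mat complex_of_real A"
  have Ac: "Ac \<in> carrier_mat n n" using A by (simp add: Ac_def)
  have sr: "cmod z \<le> spectral_radius Ac" if "eigenvalue Ac z" for z
    using spectral_radius_mem_max(2)[OF Ac n] that by (simp add: spectrum_def)
  have "spectral_radius Ac \<in> cmod ` spectrum Ac"
    using spectral_radius_mem_max(1)[OF Ac n] .
  then have sr1: "0 \<le> spectral_radius Ac" "spectral_radius Ac < 1"
    using \<open>schur A\<close> by (auto simp: schur_def Ac_def spectrum_def)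
  define \<rho> where "\<rho> = (1 + spectral_radius Ac) / 2"
  have \<rho>: "0 < \<rho>" "\<rho> < 1" "spectral_radius Ac < \<rho>" using sr1 by (auto simp: \<rho>_def)
  define D where "D = complex_of_real (1 / \<rho>) \<cdot>\<^sub>m Ac"
  have D: "D \<in> carrier_mat n n" using Ac by (simp add: D_def)
  have small: "cmod z < 1" if ev: "eigenvalue D z" for z
  proof -
    obtain v where v: "v \<in> carrier_vec n" "v \<noteq> 0\<^sub>v n" "D *\<^sub>v v = z \<cdot>\<^sub>v v"
      using ev D unfolding eigenvalue_def eigenvector_def by auto
    have "Ac *\<^sub>v v = (of_real \<rho> * z) \<cdot>\<^sub>v v"
    proof (rule eq_vecI)
      fix i assume "i < dim_vec ((of_real \<rho> * z) \<cdot>\<^sub>v v)"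
      then have i: "i < n" using v by simp
      have "(D *\<^sub>v v) $ i = z * v $ i" using i v by simp
      moreover have "(D *\<^sub>v v) $ i = complex_of_real (1 / \<rho>) * (Ac *\<^sub>v v) $ i"
        using i v(1) Ac by (simp add: D_def scalar_prod_def sum_distrib_left mult.assoc)
      ultimately show "(Ac *\<^sub>v v) $ i = ((of_real \<rho> * z) \<cdot>\<^sub>v v) $ i"
        using i v \<rho> by (simp add: field_simps)
    qed (use v Ac in auto)
    then have "eigenvalue Ac (of_real \<rho> * z)"
      using v Ac unfolding eigenvalue_def eigenvector_def by auto
    from sr[OF this] have "\<rho> * cmod z \<le> spectral_radius Ac" using \<rho> by (simp add: norm_mult)
    with \<rho>(3) have "\<rho> * cmod z < \<rho> * 1" by linarith
    with \<rho>(1) show ?thesis unfolding mult_less_cancel_left_pos[OF \<rho>(1)] by simp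
  qed
  have "spectral_radius D \<in> cmod ` spectrum D"
    using spectral_radius_mem_max(1)[OF D n] .
  then have "spectral_radius D < 1" using small by (auto simp: spectrum_def)
  from spectral_radius_jnf_norm_bound_less_1_upper_triangular[OF D this]
  obtain K where K: "\<And>k. norm_bound (D ^\<^sub>m k) K" by blast
  have D_pow: "cmod ((D ^\<^sub>m k) $$ (i, j)) = \<bar>(A ^\<^sub>m k) $$ (i, j)\<bar> / \<rho> ^ k" if "i < n" "j < n" for i j k
  proof -
    have Ak: "A ^\<^sub>m k \<in> carrier_mat n n" using A by simp
    have "D ^\<^sub>m k = complex_of_real (1 / \<rho>) ^ k \<cdot>\<^sub>m map_mat complex_of_real (A ^\<^sub>m k)"
      unfolding of_real_hom.mat_hom_pow[OF A] D_def Ac_def[symmetric] by (rule smult_pow_mat[OF Ac])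
    then have "(D ^\<^sub>m k) $$ (i, j) = complex_of_real (1 / \<rho>) ^ k * complex_of_real ((A ^\<^sub>m k) $$ (i, j))"
      using that carrier_matD[OF Ak] by (simp del: pow_mat.simps)
    then show ?thesis using \<rho> by (simp add: norm_mult norm_power norm_divide power_divide)
  qed
  have bound: "\<bar>(A ^\<^sub>m k) $$ (i, j)\<bar> \<le> K * \<rho> ^ k" if "i < n" "j < n" for i j k
  proof -
    have "cmod ((D ^\<^sub>m k) $$ (i, j)) \<le> K"
      using K[of k] that D unfolding norm_bound_def by simp
    then show ?thesis using D_pow[OF that] \<rho> by (simp add: divide_le_eq)
  qed
  have "0 \<le> K" using bound[OF n n, of 0] by simp
  then show thesis using \<rho> bound by (intro that)
qed

text \<open>
  Choose \<open>m\<close> such that \<open>A\<^sup>m\<close> contracts the \<open>l\<^sup>1\<close> norm by \<open>\<sigma>\<^sup>m\<close>. In the sum of \<open>\<sigma>\<^sup>-\<^sup>k |A\<^sup>k g|\<close> over \<open>k < m\<close>, replacing \<open>g\<close>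
  by \<open>A g\<close> shifts the terms by one, which multiplies them by \<open>\<sigma>\<close>, and the new last term is dominated by
  the lost first term.
\<close>

lemma schur_lyapunov_norm:
  assumes A: "A \<in> carrier_mat n n" and "schur A"
  obtains V \<sigma> where "0 < \<sigma>" "\<sigma> < 1" "lyapunov_norm n A \<sigma> V"
proof (cases "n = 0")
  case True
  have "lyapunov_norm n A (1/2) (\<lambda>_. 0)" unfolding lyapunov_norm_def True by auto
  then show thesis by (intro that[of "1/2"]) auto
next
  case False
  then have n: "0 < n" by simp
  obtain \<rho> K where \<rho>: "0 < \<rho>" "\<rho> < 1" and K: "0 \<le> K"
    "\<And>k i j. i < n \<Longrightarrow> j < n \<Longrightarrow> \<bar>(A ^\<^sub>m k) $$ (i, j)\<bar> \<le> K * \<rho> ^ k"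
    using schur_power_bound[OF A \<open>schur A\<close> n] by metis
  define \<sigma> where "\<sigma> = (1 + \<rho>) / 2"
  have \<sigma>: "0 < \<sigma>" "\<sigma> < 1" "\<rho> < \<sigma>" using \<rho> by (auto simp: \<sigma>_def)
  define a where "a k g = (\<Sum>i<n. \<bar>\<Sum>j<n. (A ^\<^sub>m k) $$ (i, j) * g j\<bar>)" for k and g :: "nat \<Rightarrow> real"
  define l1 where "l1 g = (\<Sum>j<n. \<bar>g j\<bar>)" for g :: "nat \<Rightarrow> real"
  have l1_nonneg: "0 \<le> l1 g" for g by (simp add: l1_def sum_nonneg)
  have a_nonneg: "0 \<le> a k g" for k g by (simp add: a_def sum_nonneg)
  have a_0: "a 0 g = l1 g" for g
  proof -
    have "(\<Sum>j<n. (A ^\<^sub>m 0) $$ (i, j) * g j) = g i" if "i < n" for i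
    proof -
      have "(\<Sum>j<n. (A ^\<^sub>m 0) $$ (i, j) * g j) = (\<Sum>j<n. if i = j then g j else 0)"
        using that A by (intro sum.cong) auto
      then show ?thesis using that by simp
    qed
    then show ?thesis by (simp add: a_def l1_def del: pow_mat.simps)
  qed
  have a_add: "a k (\<lambda>j. g j + h j) \<le> a k g + a k h" for k g h
    unfolding a_def distrib_left sum.distrib
    by (rule order_trans[OF sum_mono[OF abs_triangle_ineq]]) (simp add: sum.distrib)
  have a_scale: "a k (\<lambda>j. s * g j) = \<bar>s\<bar> * a k g" for k s g
    unfolding a_def by (simp add: mult.left_commute[of _ s] abs_mult flip: sum_distrib_left)
  have a_le: "a k g \<le> (real n * K * \<rho> ^ k) * l1 g" for k g
  proof -
    have "a k g \<le> (\<Sum>i<n. \<Sum>j<n. K * \<rho> ^ k * \<bar>g j\<bar>)"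
      unfolding a_def using K
      by (intro sum_mono order_trans[OF sum_abs]) (auto simp: abs_mult intro!: mult_right_mono)
    then show ?thesis by (simp add: l1_def mult.assoc flip: sum_distrib_left)
  qed
  have a_Suc: "a k (\<lambda>i. \<Sum>j<n. A $$ (i, j) * g j) = a (Suc k) g" for k g
  proof -
    have "(\<Sum>j<n. (A ^\<^sub>m k) $$ (i, j) * (\<Sum>l<n. A $$ (j, l) * g l)) =
        (\<Sum>l<n. (A ^\<^sub>m Suc k) $$ (i, l) * g l)" if "i < n" for i
    proof -
      have "(A ^\<^sub>m Suc k) $$ (i, l) = (\<Sum>j<n. (A ^\<^sub>m k) $$ (i, j) * A $$ (j, l))" if "l < n" for l
        using A \<open>i < n\<close> that by (simp add: scalar_prod_def atLeast0LessThan)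
      then have "(\<Sum>l<n. (A ^\<^sub>m Suc k) $$ (i, l) * g l) = (\<Sum>l<n. \<Sum>j<n. (A ^\<^sub>m k) $$ (i, j) * A $$ (j, l) * g l)"
        by (simp add: sum_distrib_right del: pow_mat.simps)
      also have "\<dots> = (\<Sum>j<n. \<Sum>l<n. (A ^\<^sub>m k) $$ (i, j) * A $$ (j, l) * g l)" by (rule sum.swap)
      finally show ?thesis by (simp add: sum_distrib_left mult.assoc del: pow_mat.simps)
    qed
    then show ?thesis unfolding a_def by (simp del: pow_mat.simps)
  qed
  have "(\<lambda>m. (\<rho> / \<sigma>) ^ m * (real n * K)) \<longlonglongrightarrow> 0 * (real n * K)"
    using \<rho> \<sigma> by (intro tendsto_mult LIMSEQ_realpow_zero tendsto_const) auto
  then have "eventually (\<lambda>m. (\<rho> / \<sigma>) ^ m * (real n * K) < 1) sequentially"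
    by (intro order_tendstoD) auto
  then obtain m0 where m0: "\<And>m. m0 \<le> m \<Longrightarrow> (\<rho> / \<sigma>) ^ m * (real n * K) < 1"
    by (auto simp: eventually_sequentially)
  \<comment> \<open>At least one term is needed for the sum to dominate the \<open>l\<^sup>1\<close> norm.\<close>
  define m where "m = Suc m0"
  have a_m: "a m g \<le> \<sigma> ^ m * l1 g" for g
  proof -
    have "real n * K * \<rho> ^ m \<le> \<sigma> ^ m"
      using m0[of m] \<sigma> by (simp add: m_def power_divide divide_less_eq mult_ac)
    then show ?thesis using a_le[of m g] mult_right_mono[OF _ l1_nonneg, of _ _ g] by (meson order_trans)
  qed
  define V where "V g = (\<Sum>k<m. (1 / \<sigma>) ^ k * a k g)" for g
  have "lyapunov_norm n A \<sigma> V"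
    unfolding lyapunov_norm_def
  proof (intro conjI allI impI)
    fix g h :: "nat \<Rightarrow> real"
    show "V (\<lambda>j. g j + h j) \<le> V g + V h"
      unfolding V_def sum.distrib[symmetric] distrib_left[symmetric]
      using \<sigma> by (intro sum_mono mult_left_mono a_add) auto
  next
    fix s and g :: "nat \<Rightarrow> real"
    show "V (\<lambda>j. s * g j) = \<bar>s\<bar> * V g"
      unfolding V_def a_scale sum_distrib_left by (simp add: mult_ac)
  next
    fix g :: "nat \<Rightarrow> real" and j assume j: "j < n"
    have "\<bar>g j\<bar> \<le> l1 g" unfolding l1_def using j by (intro member_le_sum[of j]) auto
    also have "\<dots> = (1 / \<sigma>) ^ 0 * a 0 g" by (simp add: a_0)
    also have "\<dots> \<le> V g"
      unfolding V_def using \<sigma> by (intro member_le_sum[of 0]) (auto simp: m_def a_nonneg)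
    finally show "\<bar>g j\<bar> \<le> V g" .
  next
    have "V g \<le> (\<Sum>k<m. (1 / \<sigma>) ^ k * (real n * K * \<rho> ^ k)) * (\<Sum>j<n. \<bar>g j\<bar>)" for g
      unfolding V_def sum_distrib_right mult.assoc[of _ _ "\<Sum>j<n. \<bar>g j\<bar>"] l1_def[symmetric]
      using \<sigma> a_le by (intro sum_mono mult_left_mono) (auto simp: mult.assoc)
    moreover have "0 \<le> (\<Sum>k<m. (1 / \<sigma>) ^ k * (real n * K * \<rho> ^ k))"
      using \<sigma> \<rho> K(1) by (intro sum_nonneg) auto
    ultimately show "\<exists>C\<ge>0. \<forall>g. V g \<le> C * (\<Sum>j<n. \<bar>g j\<bar>)" by blast
  next
    fix g :: "nat \<Rightarrow> real"
    have "V (\<lambda>i. \<Sum>j<n. A $$ (i, j) * g j) = (\<Sum>k<m0. (1 / \<sigma>) ^ k * a (Suc k) g) + (1 / \<sigma>) ^ m0 * a m g"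
      unfolding V_def a_Suc by (simp add: m_def)
    also have "(1 / \<sigma>) ^ m0 * a m g \<le> (1 / \<sigma>) ^ m0 * (\<sigma> ^ m * l1 g)"
      using \<sigma> a_m by (intro mult_left_mono) auto
    also have "\<dots> = \<sigma> * l1 g"
      using \<sigma> by (simp add: m_def power_divide)
    also have "(\<Sum>k<m0. (1 / \<sigma>) ^ k * a (Suc k) g) + \<sigma> * l1 g = \<sigma> * V g"
    proof -
      have "V g = l1 g + (\<Sum>k<m0. (1 / \<sigma>) ^ Suc k * a (Suc k) g)"
        unfolding V_def m_def sum.lessThan_Suc_shift by (simp add: a_0)
      then show ?thesis using \<sigma> by (simp add: distrib_left sum_distrib_left)
    qed
    finally show "V (\<lambda>i. \<Sum>j<n. A $$ (i, j) * g j) \<le> \<sigma> * V g" by simp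
  qed
  with \<sigma> show thesis by (intro that)
qed

section \<open>Dini continuity and geometric series\<close>

lemma modulus_of_continuity_mono:
  "s \<le> t \<Longrightarrow> modulus_of_continuity S p s \<le> modulus_of_continuity S p t"
  unfolding modulus_of_continuity_def by (intro SUP_subset_mono) auto

lemma modulus_of_continuity_le_1:
  assumes "\<And>s. s \<in> S \<Longrightarrow> p s \<in> {0..1}"
  shows "modulus_of_continuity S p t \<le> 1"
  unfolding modulus_of_continuity_def
proof (rule SUP_least, clarify)
  fix s s' assume "s \<in> S" "s' \<in> S"
  with assms[of s] assms[of s'] have "\<bar>p s - p s'\<bar> \<le> 1" by auto
  then show "ennreal \<bar>p s - p s'\<bar> \<le> 1" by simp
qed

definition real_modulus :: "real set \<Rightarrow> (real \<Rightarrow> real) \<Rightarrow> real \<Rightarrow> real" where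
  "real_modulus S p t = enn2real (modulus_of_continuity S p t)"

lemma ennreal_real_modulus:
  assumes "\<And>s. s \<in> S \<Longrightarrow> p s \<in> {0..1}"
  shows "ennreal (real_modulus S p t) = modulus_of_continuity S p t"
proof -
  have "modulus_of_continuity S p t < \<infinity>"
    using modulus_of_continuity_le_1[OF assms] by (rule le_less_trans) auto
  then show ?thesis unfolding real_modulus_def by (simp add: ennreal_enn2real)
qed

lemma real_modulus_nonneg: "0 \<le> real_modulus S p t"
  by (simp add: real_modulus_def)

lemma real_modulus_mono:
  assumes p: "\<And>s. s \<in> S \<Longrightarrow> p s \<in> {0..1}" and "s \<le> t"
  shows "real_modulus S p s \<le> real_modulus S p t"
proof -
  have eq: "ennreal (real_modulus S p u) = modulus_of_continuity S p u" for u
    using p by (rule ennreal_real_modulus)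
  show ?thesis
    using modulus_of_continuity_mono[OF \<open>s \<le> t\<close>, of S p]
    unfolding eq[symmetric] by (simp add: real_modulus_nonneg)
qed

lemma real_modulus_bound:
  assumes p: "\<And>s. s \<in> S \<Longrightarrow> p s \<in> {0..1}" and s: "s \<in> S" "s' \<in> S" "\<bar>s - s'\<bar> \<le> t"
  shows "\<bar>p s - p s'\<bar> \<le> real_modulus S p t"
proof -
  have "ennreal \<bar>p s - p s'\<bar> \<le> modulus_of_continuity S p t"
    unfolding modulus_of_continuity_def using s by (intro SUP_upper2[of "(s, s')"]) auto
  also have "\<dots> = ennreal (real_modulus S p t)"
    using p by (rule ennreal_real_modulus[symmetric])
  finally show ?thesis by (simp add: real_modulus_nonneg)
qed

text \<open>
  On the interval from \<open>R \<rho>\<^sup>k\<^sup>+\<^sup>1\<close> to \<open>R \<rho>\<^sup>k\<close> the integrand is at least \<open>\<omega> (R \<rho>\<^sup>k\<^sup>+\<^sup>1) / (R \<rho>\<^sup>k)\<close> by monotonicity, and the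
  interval has length \<open>(1 - \<rho>) R \<rho>\<^sup>k\<close>. So the integral bounds the sum of the \<open>(1 - \<rho>) \<omega> (R \<rho>\<^sup>k\<^sup>+\<^sup>1)\<close> over all
  intervals inside the unit interval.
\<close>

lemma Dini_summable:
  assumes p: "\<And>s. s \<in> S \<Longrightarrow> p s \<in> {0..1}" and Dini: "Dini_continuous_on S p"
    and R: "0 < R" and \<rho>: "0 < \<rho>" "\<rho> < 1"
  shows "summable (\<lambda>n. real_modulus S p (R * \<rho> ^ n))"
proof -
  have "(\<lambda>n. R * \<rho> ^ n) \<longlonglongrightarrow> R * 0"
    using \<rho> by (intro tendsto_mult LIMSEQ_realpow_zero tendsto_const) auto
  then have "eventually (\<lambda>n. R * \<rho> ^ n < 1) sequentially"
    by (intro order_tendstoD) auto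
  then obtain n0 where n0: "R * \<rho> ^ n0 < 1" by (auto simp: eventually_sequentially)
  define u where "u k = R * \<rho> ^ (k + n0)" for k
  have u_pos: "0 < u k" for k using R \<rho> by (simp add: u_def)
  have u_Suc: "u (Suc k) = \<rho> * u k" for k by (simp add: u_def)
  have u_mono: "u l \<le> u k" if "k \<le> l" for k l
    unfolding u_def using that R \<rho> by (intro mult_left_mono power_decreasing) auto
  have u_1: "u k < 1" for k
    using u_mono[of 0 k] n0 by (simp add: u_def)
  define I where "I = (\<integral>\<^sup>+ t \<in> {0<..1}. (modulus_of_continuity S p t / ennreal t) \<partial>lborel)"
  have I: "I < \<infinity>" using Dini unfolding Dini_continuous_on_def I_def .
  define m where "m k = real_modulus S p (u (Suc k))" for k
  have m0: "0 \<le> m k" for k by (simp add: m_def real_modulus_nonneg)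
  define J where "J k = {u (Suc k)<..u k}" for k
  have disj: "k = l" if "t \<in> J k" "t \<in> J l" for k l t
  proof (rule ccontr)
    assume "k \<noteq> l"
    then consider "Suc k \<le> l" | "Suc l \<le> k" by linarith
    then show False
      using that u_mono[of "Suc k" l] u_mono[of "Suc l" k] by cases (auto simp: J_def)
  qed
  have pointwise: "(\<Sum>k<K. ennreal (m k / u k) * indicator (J k) t)
      \<le> modulus_of_continuity S p t / ennreal t * indicator {0<..1} t" for K t
  proof (cases "\<exists>k<K. t \<in> J k")
    case True
    then obtain k where k: "k < K" "t \<in> J k" by blast
    have ind: "t \<in> J l \<longleftrightarrow> l = k" for l using disj[OF k(2), of l] k(2) by blast
    have t: "u (Suc k) < t" "t \<le> u k" using k(2) by (simp_all add: J_def)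
    then have t01: "0 < t" "t \<le> 1" using u_pos[of "Suc k"] u_1[of k] by linarith+
    have mono: "m k \<le> real_modulus S p t"
      unfolding m_def using p t(1) by (intro real_modulus_mono) auto
    have "(\<Sum>l<K. ennreal (m l / u l) * indicator (J l) t) = (\<Sum>l<K. if l = k then ennreal (m l / u l) else 0)"
      by (intro sum.cong refl) (simp add: indicator_def ind)
    also have "\<dots> = ennreal (m k / u k)" using k by simp
    also have "\<dots> \<le> ennreal (real_modulus S p t / t)"
      using t t01 mono by (intro ennreal_leI frac_le) (auto simp: real_modulus_nonneg)
    also have "\<dots> = ennreal (real_modulus S p t) / ennreal t"
      using t01 by (simp add: divide_ennreal real_modulus_nonneg)
    also have "ennreal (real_modulus S p t) = modulus_of_continuity S p t"
      using p by (rule ennreal_real_modulus)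
    finally show ?thesis using t01 by simp
  next
    case False
    then have "(\<Sum>k<K. ennreal (m k / u k) * indicator (J k) t) = 0" by (intro sum.neutral) auto
    then show ?thesis by simp
  qed
  have "(\<Sum>k<K. m k) \<le> enn2real I / (1 - \<rho>)" for K
  proof -
    have "(\<Sum>k<K. ennreal ((1 - \<rho>) * m k)) = (\<Sum>k<K. \<integral>\<^sup>+t. ennreal (m k / u k) * indicator (J k) t \<partial>lborel)"
    proof (rule sum.cong[OF refl])
      fix k
      have "u (Suc k) \<le> u k" by (rule u_mono) simp
      then have "(\<integral>\<^sup>+t. ennreal (m k / u k) * indicator (J k) t \<partial>lborel) = ennreal (m k / u k) * ennreal (u k - u (Suc k))"
        by (simp add: nn_integral_cmult_indicator J_def)
      also have "\<dots> = ennreal (m k / u k * (u k - u (Suc k)))"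
        using m0 u_pos[of k] by (intro ennreal_mult'[symmetric]) simp
      also have "m k / u k * (u k - u (Suc k)) = (1 - \<rho>) * m k"
        using u_pos[of k] by (simp add: u_Suc field_simps)
      finally show "ennreal ((1 - \<rho>) * m k) = (\<integral>\<^sup>+t. ennreal (m k / u k) * indicator (J k) t \<partial>lborel)" ..
    qed
    also have "\<dots> = (\<integral>\<^sup>+t. (\<Sum>k<K. ennreal (m k / u k) * indicator (J k) t) \<partial>lborel)"
      by (rule nn_integral_sum[symmetric]) (simp add: J_def)
    also have "\<dots> \<le> I" unfolding I_def by (intro nn_integral_mono pointwise)
    finally have "(\<Sum>k<K. ennreal ((1 - \<rho>) * m k)) \<le> I" .
    then have "ennreal ((1 - \<rho>) * (\<Sum>k<K. m k)) \<le> ennreal (enn2real I)"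
      using m0 \<rho> I by (simp add: sum_distrib_left ennreal_enn2real sum_nonneg)
    then show ?thesis using \<rho> by (simp add: field_simps enn2real_nonneg)
  qed
  then have "summable m" using m0 by (intro summableI_nonneg_bounded)
  moreover have "m = (\<lambda>n. real_modulus S p (R * \<rho> ^ (n + Suc n0)))"
    by (simp add: m_def u_def fun_eq_iff)
  ultimately show ?thesis using summable_iff_shift[of "\<lambda>n. real_modulus S p (R * \<rho> ^ n)" "Suc n0"] by simp
qed

section \<open>The topology of the state space\<close>

lemma topspace_vec_topology: "topspace (vec_topology n) = carrier_vec n"
  by (auto simp: vec_topology_def topspace_pullback_topology)

lemma continuous_map_vec_coordinate:
  assumes "j < n"
  shows "continuous_map (vec_topology n) euclideanreal (\<lambda>v. v $ j)"
proof -
  have "continuous_map (vec_topology n) euclideanreal ((\<lambda>h. h j) \<circ> (\<lambda>v. \<lambda>i\<in>{..<n}. v $ i))"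
    unfolding vec_topology_def using assms
    by (intro continuous_map_pullback continuous_map_product_projection) auto
  then show ?thesis by (rule continuous_map_eq) (use assms in auto)
qed

lemma continuous_map_into_vec_topology:
  assumes "\<And>y. y \<in> topspace Y \<Longrightarrow> h y \<in> carrier_vec n"
    and "\<And>j. j < n \<Longrightarrow> continuous_map Y euclideanreal (\<lambda>y. h y $ j)"
  shows "continuous_map Y (vec_topology n) h"
  unfolding vec_topology_def
proof (rule continuous_map_pullback')
  show "continuous_map Y (product_topology (\<lambda>_. euclideanreal) {..<n}) ((\<lambda>v. \<lambda>i\<in>{..<n}. v $ i) \<circ> h)"
    unfolding continuous_map_componentwise using assms(2) by auto
qed (use assms(1) in auto)

lemma compactin_vec_box:
  "compactin (vec_topology n) {v \<in> carrier_vec n. \<forall>j<n. \<bar>v $ j\<bar> \<le> R}"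
proof -
  have cont: "continuous_map (product_topology (\<lambda>_. euclideanreal) {..<n}) (vec_topology n) (vec n)"
  proof (rule continuous_map_into_vec_topology)
    fix j assume j: "j < n"
    then have "continuous_map (product_topology (\<lambda>_. euclideanreal) {..<n}) euclideanreal (\<lambda>h. h j)"
      using continuous_map_product_projection[of j "{..<n}" "\<lambda>_. euclideanreal"] by simp
    then show "continuous_map (product_topology (\<lambda>_. euclideanreal) {..<n}) euclideanreal (\<lambda>h. vec n h $ j)"
      using j by (simp only: index_vec)
  qed simp
  have "compactin (product_topology (\<lambda>_. euclideanreal) {..<n}) (PiE {..<n} (\<lambda>_. {-R..R}))"
    unfolding compactin_PiE by (intro disjI2 ballI) (simp only: compactin_euclidean_iff compact_Icc)
  then have "compactin (vec_topology n) (vec n ` PiE {..<n} (\<lambda>_. {-R..R}))"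
    by (rule image_compactin[OF _ cont])
  moreover have "vec n ` PiE {..<n} (\<lambda>_. {-R..R}) = {v \<in> carrier_vec n. \<forall>j<n. \<bar>v $ j\<bar> \<le> R}"
  proof (intro equalityI subsetI)
    fix v assume "v \<in> vec n ` PiE {..<n} (\<lambda>_. {-R..R})"
    then obtain h where h: "v = vec n h" "h \<in> PiE {..<n} (\<lambda>_. {-R..R})" by blast
    have "\<bar>h j\<bar> \<le> R" if "j < n" for j
      using PiE_mem[OF h(2), of j] that by (simp add: abs_le_iff minus_le_iff)
    then show "v \<in> {v \<in> carrier_vec n. \<forall>j<n. \<bar>v $ j\<bar> \<le> R}" using h(1) by simp
  next
    fix v assume v: "v \<in> {v \<in> carrier_vec n. \<forall>j<n. \<bar>v $ j\<bar> \<le> R}"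
    have "v = vec n (\<lambda>j\<in>{..<n}. v $ j)" using v by (intro eq_vecI) auto
    moreover have "(\<lambda>j\<in>{..<n}. v $ j) \<in> PiE {..<n} (\<lambda>_. {-R..R})"
      using v by (intro restrict_PiE_iff[THEN iffD2]) (simp add: abs_le_iff minus_le_iff)
    ultimately show "v \<in> vec n ` PiE {..<n} (\<lambda>_. {-R..R})" by (rule image_eqI)
  qed
  ultimately show ?thesis by simp
qed

lemma topspace_state_topology:
  "topspace (state_topology N ag F C) =
     PiE {1..N} (\<lambda>i. carrier_vec (ag_dim (ag i))) \<times> carrier_vec (fi_dim F) \<times> carrier_vec (co_dim C)"
  by (simp add: state_topology_def topspace_vec_topology)

lemma continuous_map_agent_state:
  "i \<in> {1..N} \<Longrightarrow> continuous_map (state_topology N ag F C) (vec_topology (ag_dim (ag i))) (\<lambda>\<xi>. fst \<xi> i)"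
  unfolding state_topology_def
  using continuous_map_compose[OF continuous_map_fst
      continuous_map_product_projection[of i "{1..N}" "\<lambda>i. vec_topology (ag_dim (ag i))"]]
  by (simp add: o_def)

lemma continuous_map_filter_state:
  "continuous_map (state_topology N ag F C) (vec_topology (fi_dim F)) (\<lambda>\<xi>. fst (snd \<xi>))"
  unfolding state_topology_def
  using continuous_map_compose[OF continuous_map_snd continuous_map_fst] by (simp add: o_def)

lemma continuous_map_controller_state:
  "continuous_map (state_topology N ag F C) (vec_topology (co_dim C)) (\<lambda>\<xi>. snd (snd \<xi>))"
  unfolding state_topology_def
  using continuous_map_compose[OF continuous_map_snd continuous_map_snd] by (simp add: o_def)

lemma continuous_map_into_state_topology:
  assumes "\<And>y. y \<in> topspace Y \<Longrightarrow> h y \<in> topspace (state_topology N ag F C)"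
    and "\<And>i j. i \<in> {1..N} \<Longrightarrow> j < ag_dim (ag i) \<Longrightarrow> continuous_map Y euclideanreal (\<lambda>y. fst (h y) i $ j)"
    and "\<And>j. j < fi_dim F \<Longrightarrow> continuous_map Y euclideanreal (\<lambda>y. fst (snd (h y)) $ j)"
    and "\<And>j. j < co_dim C \<Longrightarrow> continuous_map Y euclideanreal (\<lambda>y. snd (snd (h y)) $ j)"
  shows "continuous_map Y (state_topology N ag F C) h"
proof -
  have in_space: "fst (h y) \<in> PiE {1..N} (\<lambda>i. carrier_vec (ag_dim (ag i)))"
    "fst (snd (h y)) \<in> carrier_vec (fi_dim F)" "snd (snd (h y)) \<in> carrier_vec (co_dim C)"
    if "y \<in> topspace Y" for y
    using assms(1)[OF that] by (auto simp: topspace_state_topology mem_Times_iff)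
  have 1: "continuous_map Y (product_topology (\<lambda>i. vec_topology (ag_dim (ag i))) {1..N}) (\<lambda>y. fst (h y))"
    unfolding continuous_map_componentwise
  proof (intro conjI ballI)
    show "(\<lambda>y. fst (h y)) ` topspace Y \<subseteq> extensional {1..N}"
      using in_space(1) by (auto simp: PiE_iff)
    show "continuous_map Y (vec_topology (ag_dim (ag i))) (\<lambda>y. fst (h y) i)" if "i \<in> {1..N}" for i
      using in_space(1) that assms(2)
      by (intro continuous_map_into_vec_topology) (auto simp: PiE_iff)
  qed
  have 2: "continuous_map Y (vec_topology (fi_dim F)) (\<lambda>y. fst (snd (h y)))"
    using in_space assms(3) by (intro continuous_map_into_vec_topology) auto
  have 3: "continuous_map Y (vec_topology (co_dim C)) (\<lambda>y. snd (snd (h y)))"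
    using in_space assms(4) by (intro continuous_map_into_vec_topology) auto
  show ?thesis
    using 1 2 3 unfolding state_topology_def continuous_map_pairwise o_def by simp
qed

abbreviation vec_l1 :: "nat \<Rightarrow> real vec \<Rightarrow> real vec \<Rightarrow> real" where
  "vec_l1 n v w \<equiv> \<Sum>j<n. \<bar>v $ j - w $ j\<bar>"

definition state_l1 ::
    "nat \<Rightarrow> (nat \<Rightarrow> affine_agent) \<Rightarrow> linear_filter \<Rightarrow> linear_controller \<Rightarrow> state \<Rightarrow> state \<Rightarrow> real" where
  "state_l1 N ag F C \<xi> \<xi>' =
     (\<Sum>i=1..N. vec_l1 (ag_dim (ag i)) (fst \<xi> i) (fst \<xi>' i)) +
     vec_l1 (fi_dim F) (fst (snd \<xi>)) (fst (snd \<xi>')) +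
     vec_l1 (co_dim C) (snd (snd \<xi>)) (snd (snd \<xi>'))"

context
  fixes N :: nat and ag :: "nat \<Rightarrow> affine_agent" and F :: linear_filter and C :: linear_controller
begin

abbreviation (input) state_space :: "state topology" where
  "state_space \<equiv> state_topology N ag F C"

abbreviation (input) l1 :: "state \<Rightarrow> state \<Rightarrow> real" where
  "l1 \<equiv> state_l1 N ag F C"

lemma state_l1_coordinates:
  "i \<in> {1..N} \<Longrightarrow> j < ag_dim (ag i) \<Longrightarrow> \<bar>fst \<xi> i $ j - fst \<xi>' i $ j\<bar> \<le> l1 \<xi> \<xi>'"
  "j < fi_dim F \<Longrightarrow> \<bar>fst (snd \<xi>) $ j - fst (snd \<xi>') $ j\<bar> \<le> l1 \<xi> \<xi>'"
  "j < co_dim C \<Longrightarrow> \<bar>snd (snd \<xi>) $ j - snd (snd \<xi>') $ j\<bar> \<le> l1 \<xi> \<xi>'"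
proof -
  have le: "\<bar>v $ j - w $ j\<bar> \<le> vec_l1 n v w" if "j < n" for v w :: "real vec" and j n
    by (rule member_le_sum) (use that in auto)
  let ?a = "\<lambda>i. vec_l1 (ag_dim (ag i)) (fst \<xi> i) (fst \<xi>' i)"
  have nn: "0 \<le> vec_l1 n v w" for v w :: "real vec" and n by (simp add: sum_nonneg)
  have nn_a: "0 \<le> sum ?a {1..N}" by (intro sum_nonneg nn)
  show "\<bar>fst \<xi> i $ j - fst \<xi>' i $ j\<bar> \<le> l1 \<xi> \<xi>'" if "i \<in> {1..N}" "j < ag_dim (ag i)"
  proof -
    have "?a i \<le> sum ?a {1..N}" by (rule member_le_sum) (use that(1) nn in auto)
    then show ?thesis
      using le[OF that(2), of "fst \<xi> i" "fst \<xi>' i"] nn[of "fst (snd \<xi>)" "fst (snd \<xi>')" "fi_dim F"]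
        nn[of "snd (snd \<xi>)" "snd (snd \<xi>')" "co_dim C"]
      unfolding state_l1_def by linarith
  qed
  show "\<bar>fst (snd \<xi>) $ j - fst (snd \<xi>') $ j\<bar> \<le> l1 \<xi> \<xi>'" if "j < fi_dim F"
    using le[OF that, of "fst (snd \<xi>)" "fst (snd \<xi>')"] nn_a nn[of "snd (snd \<xi>)" "snd (snd \<xi>')" "co_dim C"]
    unfolding state_l1_def by linarith
  show "\<bar>snd (snd \<xi>) $ j - snd (snd \<xi>') $ j\<bar> \<le> l1 \<xi> \<xi>'" if "j < co_dim C"
    using le[OF that, of "snd (snd \<xi>)" "snd (snd \<xi>')"] nn_a nn[of "fst (snd \<xi>)" "fst (snd \<xi>')" "fi_dim F"]
    unfolding state_l1_def by linarith
qed

lemma continuous_map_state_l1: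
  "continuous_map state_space euclideanreal (l1 \<xi>)"
proof -
  have "continuous_map state_space euclideanreal (\<lambda>\<xi>'. fst \<xi>' i $ j)"
    if "i \<in> {1..N}" "j < ag_dim (ag i)" for i j
    using continuous_map_compose[OF continuous_map_agent_state[where ag = ag, OF that(1)] continuous_map_vec_coordinate[OF that(2)]]
    by (simp add: o_def)
  moreover have "continuous_map state_space euclideanreal (\<lambda>\<xi>'. fst (snd \<xi>') $ j)"
    if "j < fi_dim F" for j
    using continuous_map_compose[OF continuous_map_filter_state continuous_map_vec_coordinate[OF that]]
    by (simp add: o_def)
  moreover have "continuous_map state_space euclideanreal (\<lambda>\<xi>'. snd (snd \<xi>') $ j)"
    if "j < co_dim C" for j
    using continuous_map_compose[OF continuous_map_controller_state continuous_map_vec_coordinate[OF that]]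
    by (simp add: o_def)
  ultimately show ?thesis
    unfolding state_l1_def[abs_def]
    by (intro continuous_map_add continuous_map_sum continuous_map_real_abs continuous_map_diff) auto
qed

text \<open>
  Continuity of the coordinates with respect to \<open>d\<close> and of the \<open>l\<^sup>1\<close> distance with respect to the state
  topology show that each topology is finer than the other. Closed balls are closed subsets of a
  product of compact boxes.
\<close>

lemma state_metric_topology:
  assumes "Metric_space (topspace state_space) d" and K: "0 < K"
    and le: "\<And>\<xi> \<xi>'. d \<xi> \<xi>' \<le> K * l1 \<xi> \<xi>'" "\<And>\<xi> \<xi>'. l1 \<xi> \<xi>' \<le> K * d \<xi> \<xi>'"
  shows "Metric_space.mtopology (topspace state_space) d = state_space"
    "\<xi> \<in> topspace state_space \<Longrightarrow>
      compactin state_space (Metric_space.mcball (topspace state_space) d \<xi> R)"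
proof -
  define X where "X = state_space"
  interpret Metric_space "topspace X" d unfolding X_def by fact
  have coord_small: "\<bar>f \<xi> - f \<xi>'\<bar> < e"
    if "\<And>\<xi> \<xi>'. \<bar>f \<xi> - f \<xi>'\<bar> \<le> l1 \<xi> \<xi>'" "d \<xi> \<xi>' < e / K" for f :: "state \<Rightarrow> real" and \<xi> \<xi>' e
    using that(1)[of \<xi> \<xi>'] le(2)[of \<xi> \<xi>'] that(2) K by (simp add: field_simps)
  have cont: "continuous_map mtopology euclideanreal f"
    if "\<And>\<xi> \<xi>'. \<bar>f \<xi> - f \<xi>'\<bar> \<le> l1 \<xi> \<xi>'" for f
    unfolding continuous_map_to_real_iff
  proof (intro ballI allI impI)
    fix \<xi> and e :: real assume "0 < e"
    then show "\<exists>t>0. \<forall>\<xi>'\<in>topspace X. d \<xi> \<xi>' < t \<longrightarrow> \<bar>f \<xi> - f \<xi>'\<bar> < e"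
      using K coord_small[of f, OF that] by (intro exI[of _ "e / K"]) auto
  qed
  have "continuous_map mtopology state_space (\<lambda>\<xi>. \<xi>)"
  proof (rule continuous_map_into_state_topology)
    show "continuous_map mtopology euclideanreal (\<lambda>\<xi>. fst \<xi> i $ j)"
      if "i \<in> {1..N}" "j < ag_dim (ag i)" for i j
      using state_l1_coordinates(1)[OF that] by (rule cont)
    show "continuous_map mtopology euclideanreal (\<lambda>\<xi>. fst (snd \<xi>) $ j)" if "j < fi_dim F" for j
      using state_l1_coordinates(2)[OF that] by (rule cont)
    show "continuous_map mtopology euclideanreal (\<lambda>\<xi>. snd (snd \<xi>) $ j)" if "j < co_dim C" for j
      using state_l1_coordinates(3)[OF that] by (rule cont)
  qed (simp flip: X_def)
  then have id: "continuous_map mtopology X (\<lambda>\<xi>. \<xi>)" by (fold X_def)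
  have eq: "mtopology = X"
  proof (rule topology_eq[THEN iffD2], intro allI iffI)
    fix U assume U: "openin X U"
    then have "openin mtopology {\<xi> \<in> topspace mtopology. \<xi> \<in> U}"
      by (rule openin_continuous_map_preimage[OF id])
    moreover have "{\<xi> \<in> topspace mtopology. \<xi> \<in> U} = U" using openin_subset[OF U] by auto
    ultimately show "openin mtopology U" by simp
  next
    fix U assume U: "openin mtopology U"
    show "openin X U"
    proof (subst openin_subopen, intro ballI)
      fix \<xi> assume \<xi>: "\<xi> \<in> U"
      then obtain e where e: "e > 0" "mball \<xi> e \<subseteq> U" and \<xi>X: "\<xi> \<in> topspace X"
        using U unfolding openin_mtopology by blast
      define W where "W = {\<xi>' \<in> topspace X. l1 \<xi> \<xi>' \<in> {..<e / K}}"
      have "openin X W"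
        unfolding W_def X_def
        by (rule openin_continuous_map_preimage[OF continuous_map_state_l1]) simp
      moreover have "\<xi> \<in> W" using \<xi>X e K by (simp add: W_def state_l1_def)
      moreover have "W \<subseteq> U"
      proof
        fix \<xi>' assume w: "\<xi>' \<in> W"
        then have "K * l1 \<xi> \<xi>' < e" using K by (simp add: W_def field_simps)
        with le(1)[of \<xi> \<xi>'] have "d \<xi> \<xi>' < e" by linarith
        with w \<xi>X e(2) show "\<xi>' \<in> U" by (auto simp: W_def in_mball)
      qed
      ultimately show "\<exists>T. openin X T \<and> \<xi> \<in> T \<and> T \<subseteq> U" by blast
    qed
  qed
  then show "Metric_space.mtopology (topspace state_space) d = state_space"
    by (simp add: X_def)
  assume "\<xi> \<in> topspace state_space"
  then have \<xi>: "\<xi> \<in> topspace X" by (simp add: X_def)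
  define zero :: state where "zero = (\<lambda>i. 0\<^sub>v (ag_dim (ag i)), 0\<^sub>v (fi_dim F), 0\<^sub>v (co_dim C))"
  define Q where "Q = K * \<bar>R\<bar> + l1 \<xi> zero"
  define S where "S = PiE {1..N} (\<lambda>i. {w \<in> carrier_vec (ag_dim (ag i)). \<forall>j<ag_dim (ag i). \<bar>w $ j\<bar> \<le> Q})
    \<times> {w \<in> carrier_vec (fi_dim F). \<forall>j<fi_dim F. \<bar>w $ j\<bar> \<le> Q}
    \<times> {w \<in> carrier_vec (co_dim C). \<forall>j<co_dim C. \<bar>w $ j\<bar> \<le> Q}"
  have "compactin X S"
    unfolding X_def S_def state_topology_def compactin_Times compactin_PiE
    using compactin_vec_box by blast
  moreover have "mcball \<xi> R \<subseteq> S"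
  proof
    fix \<xi>' assume "\<xi>' \<in> mcball \<xi> R"
    then have \<xi>': "\<xi>' \<in> topspace X" "d \<xi> \<xi>' \<le> R" by (auto simp: in_mcball)
    have "l1 \<xi> \<xi>' \<le> K * \<bar>R\<bar>"
      using le(2)[of \<xi> \<xi>'] \<xi>'(2) K mult_left_mono[of "d \<xi> \<xi>'" "\<bar>R\<bar>" K] by linarith
    then have bound: "\<bar>f \<xi>'\<bar> \<le> Q"
      if "\<And>\<xi> \<xi>'. \<bar>f \<xi> - f \<xi>'\<bar> \<le> l1 \<xi> \<xi>'" "f zero = 0" for f
      using that(1)[of \<xi> \<xi>'] that(1)[of \<xi> zero] that(2) unfolding Q_def by linarith
    have "\<bar>fst \<xi>' i $ j\<bar> \<le> Q" if "i \<in> {1..N}" "j < ag_dim (ag i)" for i j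
      using state_l1_coordinates(1)[OF that] that(2)
      by (intro bound[of "\<lambda>\<xi>. fst \<xi> i $ j"]) (auto simp: zero_def)
    moreover have "\<bar>fst (snd \<xi>') $ j\<bar> \<le> Q" if "j < fi_dim F" for j
      using state_l1_coordinates(2)[OF that] that
      by (intro bound[of "\<lambda>\<xi>. fst (snd \<xi>) $ j"]) (auto simp: zero_def)
    moreover have "\<bar>snd (snd \<xi>') $ j\<bar> \<le> Q" if "j < co_dim C" for j
      using state_l1_coordinates(3)[OF that] that
      by (intro bound[of "\<lambda>\<xi>. snd (snd \<xi>) $ j"]) (auto simp: zero_def)
    ultimately show "\<xi>' \<in> S"
      using \<xi>'(1) unfolding X_def topspace_state_topology S_def by (auto simp: PiE_iff mem_Times_iff)
  qed
  moreover have "closedin X (mcball \<xi> R)" using closedin_mcball[of \<xi> R] unfolding eq .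
  ultimately have "compactin X (mcball \<xi> R)" by (rule closed_compactin)
  then show "compactin state_space (Metric_space.mcball (topspace state_space) d \<xi> R)"
    by (simp add: X_def)
qed

end

section \<open>Distances of vectors in an adapted norm\<close>

definition vec_dist :: "((nat \<Rightarrow> real) \<Rightarrow> real) \<Rightarrow> real vec \<Rightarrow> real vec \<Rightarrow> real" where
  "vec_dist V v w = V (\<lambda>j. v $ j - w $ j)"

context
  fixes n A \<sigma> V
  assumes V: "lyapunov_norm n A \<sigma> V"
begin

lemma vec_dist_nonneg: "0 \<le> vec_dist V v w"
  unfolding vec_dist_def by (rule lyapunov_norm_nonneg[OF V])

lemma vec_dist_commute: "vec_dist V v w = vec_dist V w v"
  using lyapunov_norm_minus[OF V, of "\<lambda>j. v $ j - w $ j"] by (simp add: vec_dist_def)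

lemma vec_dist_triangle: "vec_dist V u w \<le> vec_dist V u v + vec_dist V v w"
  using lyapunov_normD(1)[OF V, of "\<lambda>j. u $ j - v $ j" "\<lambda>j. v $ j - w $ j"] by (simp add: vec_dist_def)

lemma vec_dist_coordinate: "j < n \<Longrightarrow> \<bar>v $ j - w $ j\<bar> \<le> vec_dist V v w"
  unfolding vec_dist_def by (rule lyapunov_normD(3)[OF V, of j "\<lambda>j. v $ j - w $ j"])

lemma vec_dist_zero_iff:
  assumes "v \<in> carrier_vec n" "w \<in> carrier_vec n"
  shows "vec_dist V v w = 0 \<longleftrightarrow> v = w"
proof
  assume 0: "vec_dist V v w = 0"
  show "v = w" using vec_dist_coordinate[of _ v w] 0 assms by (intro eq_vecI) auto
qed (simp add: vec_dist_def lyapunov_norm_zero[OF V])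

lemma vec_dist_upper: "\<exists>C\<ge>0. \<forall>v w. vec_dist V v w \<le> C * vec_l1 n v w"
  using lyapunov_normD(5)[OF V] unfolding vec_dist_def by blast

lemma vec_dist_l1: "vec_l1 n v w \<le> real n * vec_dist V v w"
  using sum_bounded_above[of "{..<n}" "\<lambda>j. \<bar>v $ j - w $ j\<bar>" "vec_dist V v w"] vec_dist_coordinate by auto

lemma vec_dist_affine:
  assumes A: "A \<in> carrier_mat n n" and v: "v \<in> carrier_vec n" "w \<in> carrier_vec n" and B: "B \<in> carrier_vec n"
  shows "vec_dist V (A *\<^sub>v v + s \<cdot>\<^sub>v B) (A *\<^sub>v w + s' \<cdot>\<^sub>v B) \<le> \<sigma> * vec_dist V v w + \<bar>s - s'\<bar> * V (\<lambda>j. B $ j)"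
proof -
  have "vec_dist V (A *\<^sub>v v + s \<cdot>\<^sub>v B) (A *\<^sub>v w + s' \<cdot>\<^sub>v B)
      = V (\<lambda>i. (\<Sum>j<n. A $$ (i, j) * (v $ j - w $ j)) + (s - s') * B $ i)"
    unfolding vec_dist_def
  proof (rule lyapunov_norm_cong[OF V])
    fix i assume i: "i < n"
    have "(A *\<^sub>v v) $ i - (A *\<^sub>v w) $ i = (\<Sum>j<n. A $$ (i, j) * (v $ j - w $ j))"
      using i A v by (simp add: scalar_prod_def atLeast0LessThan right_diff_distrib sum_subtractf)
    then show "(A *\<^sub>v v + s \<cdot>\<^sub>v B) $ i - (A *\<^sub>v w + s' \<cdot>\<^sub>v B) $ i =
        (\<Sum>j<n. A $$ (i, j) * (v $ j - w $ j)) + (s - s') * B $ i"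
      using i A v B by (simp add: algebra_simps del: index_mult_mat_vec)
  qed
  also have "\<dots> \<le> V (\<lambda>i. \<Sum>j<n. A $$ (i, j) * (v $ j - w $ j)) + V (\<lambda>i. (s - s') * B $ i)"
    by (rule lyapunov_normD(1)[OF V])
  also have "\<dots> \<le> \<sigma> * vec_dist V v w + \<bar>s - s'\<bar> * V (\<lambda>j. B $ j)"
    unfolding vec_dist_def lyapunov_normD(2)[OF V]
    by (rule add_right_mono[OF lyapunov_normD(4)[OF V]])
  finally show ?thesis .
qed

lemma vec_dist_affine_shift:
  assumes "A \<in> carrier_mat n n" "v \<in> carrier_vec n" "w \<in> carrier_vec n" "B \<in> carrier_vec n"
  shows "vec_dist V (A *\<^sub>v v + B) (A *\<^sub>v w + B) \<le> \<sigma> * vec_dist V v w"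
  using vec_dist_affine[OF assms, of 1 1] by simp

lemma scalar_prod_vec_dist:
  assumes "v \<in> carrier_vec n" "w \<in> carrier_vec n"
  shows "\<bar>c \<bullet> v - c \<bullet> w\<bar> \<le> (\<Sum>j<n. \<bar>c $ j\<bar>) * vec_dist V v w"
proof -
  have eq: "c \<bullet> v - c \<bullet> w = (\<Sum>j<n. c $ j * (v $ j - w $ j))"
    using assms by (simp add: scalar_prod_def atLeast0LessThan right_diff_distrib sum_subtractf)
  have "\<bar>c \<bullet> v - c \<bullet> w\<bar> \<le> (\<Sum>j<n. \<bar>c $ j\<bar> * vec_dist V v w)"
    unfolding eq
    by (rule order_trans[OF sum_abs], rule sum_mono)
      (simp add: abs_mult mult_left_mono vec_dist_coordinate)
  then show ?thesis by (simp add: sum_distrib_right)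
qed

end

section \<open>The feedback loop as a contractive system\<close>

lemma pmf_index_pmf:
  assumes "\<And>j. j \<in> {1..m} \<Longrightarrow> 0 \<le> q j" "(\<Sum>j=1..m. q j) = 1"
  shows "pmf (index_pmf m q) j = (if j \<in> {1..m} then q j else 0)"
  unfolding index_pmf_def
proof (rule pmf_embed_pmf)
  show "0 \<le> (if j \<in> {1..m} then q j else 0)" for j using assms(1) by auto
  have "(\<integral>\<^sup>+j. ennreal (if j \<in> {1..m} then q j else 0) \<partial>count_space UNIV) = (\<Sum>j=1..m. ennreal (q j))"
    by (subst nn_integral_count_space'[of "{1..m}"]) auto
  also have "\<dots> = ennreal (\<Sum>j=1..m. q j)" using assms(1) by (intro sum_ennreal) auto
  finally show "(\<integral>\<^sup>+j. ennreal (if j \<in> {1..m} then q j else 0) \<partial>count_space UNIV) = 1"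
    using assms(2) by simp
qed

text \<open>
  The adapted norms of the blocks are parameters, and they share the rate \<open>\<sigma>\<close>, so that the weights of the
  metric of the loop can be computed from them.
\<close>

locale closed_loop =
  fixes N :: nat and ag :: "nat \<Rightarrow> affine_agent" and Adm :: "real set" and \<delta> \<delta>' r :: real
    and F :: linear_filter and C :: linear_controller
    and Va :: "nat \<Rightarrow> (nat \<Rightarrow> real) \<Rightarrow> real" and Vf Vc :: "(nat \<Rightarrow> real) \<Rightarrow> real" and \<sigma> :: real
  assumes dims: "\<And>i. i \<in> {1..N} \<Longrightarrow> agent_dims (ag i)"
    and p_range: "\<And>i j s. i \<in> {1..N} \<Longrightarrow> j \<in> {1..ag_w (ag i)} \<Longrightarrow> s \<in> Adm \<Longrightarrow>
                    ag_p (ag i) j s \<in> {0..1}"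
    and p'_range: "\<And>i l s. i \<in> {1..N} \<Longrightarrow> l \<in> {1..ag_h (ag i)} \<Longrightarrow> s \<in> Adm \<Longrightarrow>
                    ag_p' (ag i) l s \<in> {0..1}"
    and p_Dini: "\<And>i j. i \<in> {1..N} \<Longrightarrow> j \<in> {1..ag_w (ag i)} \<Longrightarrow>
                    Dini_continuous_on Adm (ag_p (ag i) j)"
    and p'_Dini: "\<And>i l. i \<in> {1..N} \<Longrightarrow> l \<in> {1..ag_h (ag i)} \<Longrightarrow>
                    Dini_continuous_on Adm (ag_p' (ag i) l)"
    and p_sum: "\<And>i s. i \<in> {1..N} \<Longrightarrow> s \<in> Adm \<Longrightarrow> (\<Sum>j=1..ag_w (ag i). ag_p (ag i) j s) = 1"
    and p'_sum: "\<And>i s. i \<in> {1..N} \<Longrightarrow> s \<in> Adm \<Longrightarrow> (\<Sum>l=1..ag_h (ag i). ag_p' (ag i) l s) = 1"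
    and delta_pos: "\<delta> > 0" "\<delta>' > 0"
    and p_bound: "\<And>i j s. i \<in> {1..N} \<Longrightarrow> j \<in> {1..ag_w (ag i)} \<Longrightarrow> s \<in> Adm \<Longrightarrow>
                    ag_p (ag i) j s \<ge> \<delta>"
    and p'_bound: "\<And>i l s. i \<in> {1..N} \<Longrightarrow> l \<in> {1..ag_h (ag i)} \<Longrightarrow> s \<in> Adm \<Longrightarrow>
                    ag_p' (ag i) l s \<ge> \<delta>'"
    and filter_dims: "filter_dims F" and controller_dims: "controller_dims C"
    and admissible: "\<And>\<xi>. \<xi> \<in> topspace (state_topology N ag F C) \<Longrightarrow> broadcast r F C \<xi> \<in> Adm"
    and sigma: "0 < \<sigma>" "\<sigma> < 1"
    and Va: "\<And>i. i \<in> {1..N} \<Longrightarrow> lyapunov_norm (ag_dim (ag i)) (ag_A (ag i)) \<sigma> (Va i)"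
    and Vf: "lyapunov_norm (fi_dim F) (fi_A F) \<sigma> Vf"
    and Vc: "lyapunov_norm (co_dim C) (co_A C) \<sigma> Vc"
begin

abbreviation states :: "state set" where
  "states \<equiv> topspace (state_topology N ag F C)"

definition choices :: "(nat \<Rightarrow> nat \<times> nat) set" where
  "choices = PiE_dflt {1..N} (0, 0) (\<lambda>i. {1..ag_w (ag i)} \<times> {1..ag_h (ag i)})"

definition agent_dist :: "state \<Rightarrow> state \<Rightarrow> real" where
  "agent_dist \<xi> \<xi>' = (\<Sum>i=1..N. vec_dist (Va i) (fst \<xi> i) (fst \<xi>' i))"

definition filter_dist :: "state \<Rightarrow> state \<Rightarrow> real" where
  "filter_dist \<xi> \<xi>' = vec_dist Vf (fst (snd \<xi>)) (fst (snd \<xi>'))"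

definition controller_dist :: "state \<Rightarrow> state \<Rightarrow> real" where
  "controller_dist \<xi> \<xi>' = vec_dist Vc (snd (snd \<xi>)) (snd (snd \<xi>'))"

text \<open>
  A rate between the rate \<open>\<sigma>\<close> of the blocks and 1 leaves room for the couplings in the cascade: agents drive the
  filter, and the filter drives the controller. The weights are chosen against the direction of
  influence, so that the gap \<open>\<tau> - \<sigma>\<close> of an upstream block absorbs what it feeds into the next one.
\<close>

definition \<tau> :: real where "\<tau> = (1 + \<sigma>) / 2"

definition filter_gain :: real where
  "filter_gain = (\<Sum>i=1..N. \<Sum>j<ag_dim (ag i). \<bar>ag_c (ag i) $ j\<bar>) * Vf (\<lambda>j. fi_B F $ j)"

definition controller_gain :: real where
  "controller_gain = (\<Sum>j<fi_dim F. \<bar>fi_C F $ j\<bar>) * Vc (\<lambda>j. co_B C $ j)"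

definition filter_weight :: real where
  "filter_weight = 1 + controller_gain / (\<tau> - \<sigma>)"

definition agent_weight :: real where
  "agent_weight = 1 + filter_weight * filter_gain / (\<tau> - \<sigma>)"

definition loop_dist :: "state \<Rightarrow> state \<Rightarrow> real" where
  "loop_dist \<xi> \<xi>' =
     agent_weight * agent_dist \<xi> \<xi>' + filter_weight * filter_dist \<xi> \<xi>' + controller_dist \<xi> \<xi>'"

lemma tau: "\<sigma> < \<tau>" "0 < \<tau>" "\<tau> < 1"
  using sigma by (auto simp: \<tau>_def)

lemma gains_nonneg: "0 \<le> filter_gain" "0 \<le> controller_gain"
  unfolding filter_gain_def controller_gain_def
  by (auto intro!: mult_nonneg_nonneg sum_nonneg lyapunov_norm_nonneg[OF Vf] lyapunov_norm_nonneg[OF Vc])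

lemma weights_ge_1: "1 \<le> filter_weight" "1 \<le> agent_weight"
proof -
  show f: "1 \<le> filter_weight" using gains_nonneg tau by (simp add: filter_weight_def)
  show "1 \<le> agent_weight" using f gains_nonneg tau by (simp add: agent_weight_def)
qed

lemma weights_absorb_gains:
  "controller_gain \<le> filter_weight * (\<tau> - \<sigma>)" "filter_weight * filter_gain \<le> agent_weight * (\<tau> - \<sigma>)"
proof -
  have "(1 + x / (\<tau> - \<sigma>)) * (\<tau> - \<sigma>) = \<tau> - \<sigma> + x" for x
    using tau by (simp add: field_simps)
  then show "controller_gain \<le> filter_weight * (\<tau> - \<sigma>)"
    "filter_weight * filter_gain \<le> agent_weight * (\<tau> - \<sigma>)"
    unfolding filter_weight_def agent_weight_def using tau by simp_all
qed

lemma states_iff: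
  "(x, x\<^sub>f, x\<^sub>c) \<in> states \<longleftrightarrow> x \<in> PiE {1..N} (\<lambda>i. carrier_vec (ag_dim (ag i))) \<and>
     x\<^sub>f \<in> carrier_vec (fi_dim F) \<and> x\<^sub>c \<in> carrier_vec (co_dim C)"
  by (simp add: topspace_state_topology)

lemma part_dists_nonneg: "0 \<le> agent_dist \<xi> \<xi>'" "0 \<le> filter_dist \<xi> \<xi>'" "0 \<le> controller_dist \<xi> \<xi>'"
  unfolding agent_dist_def filter_dist_def controller_dist_def
  by (auto intro!: sum_nonneg vec_dist_nonneg[OF Va] vec_dist_nonneg[OF Vf] vec_dist_nonneg[OF Vc])

lemma parts_le_loop_dist:
  "agent_dist \<xi> \<xi>' \<le> loop_dist \<xi> \<xi>'" "filter_dist \<xi> \<xi>' \<le> loop_dist \<xi> \<xi>'"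
  "controller_dist \<xi> \<xi>' \<le> loop_dist \<xi> \<xi>'"
proof -
  have "1 * agent_dist \<xi> \<xi>' \<le> agent_weight * agent_dist \<xi> \<xi>'"
    "1 * filter_dist \<xi> \<xi>' \<le> filter_weight * filter_dist \<xi> \<xi>'"
    by (rule mult_right_mono[OF weights_ge_1(2) part_dists_nonneg(1)],
        rule mult_right_mono[OF weights_ge_1(1) part_dists_nonneg(2)])
  then show "agent_dist \<xi> \<xi>' \<le> loop_dist \<xi> \<xi>'" "filter_dist \<xi> \<xi>' \<le> loop_dist \<xi> \<xi>'"
    "controller_dist \<xi> \<xi>' \<le> loop_dist \<xi> \<xi>'"
    using part_dists_nonneg[of \<xi> \<xi>'] unfolding loop_dist_def by linarith+
qed

lemma metric_loop_dist: "Metric_space states loop_dist"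
proof
  show "0 \<le> loop_dist \<xi> \<xi>'" for \<xi> \<xi>'
    using parts_le_loop_dist(2)[of \<xi> \<xi>'] part_dists_nonneg(2)[of \<xi> \<xi>'] by linarith
  have "agent_dist \<xi> \<xi>' = agent_dist \<xi>' \<xi>" for \<xi> \<xi>'
    unfolding agent_dist_def by (intro sum.cong refl vec_dist_commute[OF Va])
  then show "loop_dist \<xi> \<xi>' = loop_dist \<xi>' \<xi>" for \<xi> \<xi>'
    unfolding loop_dist_def filter_dist_def controller_dist_def
    by (simp add: vec_dist_commute[OF Vf, of "fst (snd \<xi>)"] vec_dist_commute[OF Vc, of "snd (snd \<xi>)"])
  show "loop_dist \<xi> \<xi>' = 0 \<longleftrightarrow> \<xi> = \<xi>'" if "\<xi> \<in> states" "\<xi>' \<in> states" for \<xi> \<xi>'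
  proof
    assume "loop_dist \<xi> \<xi>' = 0"
    then have 0: "agent_dist \<xi> \<xi>' = 0" "filter_dist \<xi> \<xi>' = 0" "controller_dist \<xi> \<xi>' = 0"
      using parts_le_loop_dist[of \<xi> \<xi>'] part_dists_nonneg[of \<xi> \<xi>'] by linarith+
    obtain x x\<^sub>f x\<^sub>c y y\<^sub>f y\<^sub>c where eq: "\<xi> = (x, x\<^sub>f, x\<^sub>c)" "\<xi>' = (y, y\<^sub>f, y\<^sub>c)" by (metis surj_pair)
    note mem = that[unfolded eq states_iff]
    have "vec_dist (Va i) (x i) (y i) = 0" if "i \<in> {1..N}" for i
      using 0(1) that vec_dist_nonneg[OF Va] unfolding agent_dist_def eq
      by (subst (asm) sum_nonneg_eq_0_iff) auto
    then have agents: "x i = y i" if "i \<in> {1..N}" for i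
      using vec_dist_zero_iff[OF Va[OF that], of "x i" "y i"] mem that by (auto simp: PiE_iff)
    have "x = y" by (rule PiE_ext[OF mem(1)[THEN conjunct1] mem(2)[THEN conjunct1] agents])
    moreover have "x\<^sub>f = y\<^sub>f" using 0(2) vec_dist_zero_iff[OF Vf] mem by (simp add: filter_dist_def eq)
    moreover have "x\<^sub>c = y\<^sub>c" using 0(3) vec_dist_zero_iff[OF Vc] mem by (simp add: controller_dist_def eq)
    ultimately show "\<xi> = \<xi>'" by (simp add: eq)
  next
    assume "\<xi> = \<xi>'"
    then show "loop_dist \<xi> \<xi>' = 0"
      using lyapunov_norm_zero[OF Va] lyapunov_norm_zero[OF Vf] lyapunov_norm_zero[OF Vc]
      by (simp add: loop_dist_def agent_dist_def filter_dist_def controller_dist_def vec_dist_def)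
  qed
  show "loop_dist \<xi> \<zeta> \<le> loop_dist \<xi> \<xi>' + loop_dist \<xi>' \<zeta>" for \<xi> \<xi>' \<zeta>
  proof -
    have "agent_dist \<xi> \<zeta> \<le> agent_dist \<xi> \<xi>' + agent_dist \<xi>' \<zeta>"
      unfolding agent_dist_def sum.distrib[symmetric] by (intro sum_mono vec_dist_triangle[OF Va])
    then have "agent_weight * agent_dist \<xi> \<zeta> \<le> agent_weight * (agent_dist \<xi> \<xi>' + agent_dist \<xi>' \<zeta>)"
      using weights_ge_1 by (intro mult_left_mono) auto
    moreover have "filter_weight * filter_dist \<xi> \<zeta> \<le> filter_weight * (filter_dist \<xi> \<xi>' + filter_dist \<xi>' \<zeta>)"
      using weights_ge_1 unfolding filter_dist_def by (intro mult_left_mono vec_dist_triangle[OF Vf]) auto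
    moreover have "controller_dist \<xi> \<zeta> \<le> controller_dist \<xi> \<xi>' + controller_dist \<xi>' \<zeta>"
      unfolding controller_dist_def by (rule vec_dist_triangle[OF Vc])
    ultimately show ?thesis unfolding loop_dist_def distrib_left by linarith
  qed
qed

lemma loop_dist_equivalent:
  obtains K where "0 < K" "\<And>\<xi> \<xi>'. loop_dist \<xi> \<xi>' \<le> K * state_l1 N ag F C \<xi> \<xi>'"
    "\<And>\<xi> \<xi>'. state_l1 N ag F C \<xi> \<xi>' \<le> K * loop_dist \<xi> \<xi>'"
proof -
  have "\<forall>i\<in>{1..N}. \<exists>K\<ge>0. \<forall>v w. vec_dist (Va i) v w \<le> K * vec_l1 (ag_dim (ag i)) v w"
    using vec_dist_upper[OF Va] by blast
  then obtain Ka where Ka: "\<And>i. i \<in> {1..N} \<Longrightarrow> 0 \<le> Ka i"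
    "\<And>i v w. i \<in> {1..N} \<Longrightarrow> vec_dist (Va i) v w \<le> Ka i * vec_l1 (ag_dim (ag i)) v w"
    by metis
  obtain Kf where Kf: "0 \<le> Kf" "\<And>v w. vec_dist Vf v w \<le> Kf * vec_l1 (fi_dim F) v w"
    using vec_dist_upper[OF Vf] by blast
  obtain Kc where Kc: "0 \<le> Kc" "\<And>v w. vec_dist Vc v w \<le> Kc * vec_l1 (co_dim C) v w"
    using vec_dist_upper[OF Vc] by blast
  define Q where "Q = (\<Sum>i=1..N. Ka i) + Kf + Kc"
  have Ka_sum: "0 \<le> (\<Sum>i=1..N. Ka i)" by (intro sum_nonneg Ka(1))
  have QK: "Ka i \<le> Q" if "i \<in> {1..N}" for i
    using member_le_sum[of i "{1..N}" Ka] Ka(1) that Kf(1) Kc(1) unfolding Q_def by force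
  have Q: "0 \<le> Q" "Kf \<le> Q" "Kc \<le> Q" using Ka_sum Kf(1) Kc(1) by (auto simp: Q_def)
  define W where "W = agent_weight + filter_weight + 1"
  have W: "0 \<le> W" "agent_weight \<le> W" "filter_weight \<le> W" "1 \<le> W" using weights_ge_1 by (auto simp: W_def)
  define n where "n = (\<Sum>i=1..N. ag_dim (ag i)) + fi_dim F + co_dim C"
  have n_agent: "ag_dim (ag i) \<le> n" if "i \<in> {1..N}" for i
    using member_le_sum[of i "{1..N}" "\<lambda>i. ag_dim (ag i)"] that by (auto simp: n_def)
  define K where "K = W * Q + 3 * real n + 1"
  have K: "0 < K" "W * Q \<le> K" "3 * real n \<le> K" using W Q by (auto simp: K_def intro: add_nonneg_pos)
  have upper: "loop_dist \<xi> \<xi>' \<le> K * state_l1 N ag F C \<xi> \<xi>'" for \<xi> \<xi>'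
  proof -
    let ?a = "\<lambda>i. vec_l1 (ag_dim (ag i)) (fst \<xi> i) (fst \<xi>' i)"
    let ?f = "vec_l1 (fi_dim F) (fst (snd \<xi>)) (fst (snd \<xi>'))"
    let ?c = "vec_l1 (co_dim C) (snd (snd \<xi>)) (snd (snd \<xi>'))"
    have nn: "0 \<le> ?a i" "0 \<le> sum ?a {1..N}" "0 \<le> ?f" "0 \<le> ?c" for i by (auto intro!: sum_nonneg)
    have "agent_dist \<xi> \<xi>' \<le> (\<Sum>i=1..N. Q * ?a i)"
      unfolding agent_dist_def
      using order_trans[OF Ka(2) mult_right_mono[OF QK nn(1)]] by (intro sum_mono) blast
    then have "agent_dist \<xi> \<xi>' \<le> Q * sum ?a {1..N}" unfolding sum_distrib_left .
    then have 1: "agent_weight * agent_dist \<xi> \<xi>' \<le> W * (Q * sum ?a {1..N})"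
      using W part_dists_nonneg by (intro mult_mono) auto
    have "filter_dist \<xi> \<xi>' \<le> Q * ?f"
      unfolding filter_dist_def by (rule order_trans[OF Kf(2) mult_right_mono[OF Q(2) nn(3)]])
    then have 2: "filter_weight * filter_dist \<xi> \<xi>' \<le> W * (Q * ?f)"
      using W part_dists_nonneg by (intro mult_mono) auto
    have "controller_dist \<xi> \<xi>' \<le> Q * ?c"
      unfolding controller_dist_def by (rule order_trans[OF Kc(2) mult_right_mono[OF Q(3) nn(4)]])
    then have 3: "1 * controller_dist \<xi> \<xi>' \<le> W * (Q * ?c)"
      using W part_dists_nonneg by (intro mult_mono) auto
    have "loop_dist \<xi> \<xi>' \<le> W * Q * state_l1 N ag F C \<xi> \<xi>'"
      using 1 2 3 unfolding loop_dist_def state_l1_def by (simp add: algebra_simps)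
    also have "\<dots> \<le> K * state_l1 N ag F C \<xi> \<xi>'"
      using K nn unfolding state_l1_def by (intro mult_right_mono) auto
    finally show ?thesis .
  qed
  have lower: "state_l1 N ag F C \<xi> \<xi>' \<le> K * loop_dist \<xi> \<xi>'" for \<xi> \<xi>'
  proof -
    have "(\<Sum>i=1..N. vec_l1 (ag_dim (ag i)) (fst \<xi> i) (fst \<xi>' i))
        \<le> (\<Sum>i=1..N. real n * vec_dist (Va i) (fst \<xi> i) (fst \<xi>' i))"
    proof (rule sum_mono)
      fix i assume i: "i \<in> {1..N}"
      have "real (ag_dim (ag i)) * vec_dist (Va i) (fst \<xi> i) (fst \<xi>' i) \<le> real n * vec_dist (Va i) (fst \<xi> i) (fst \<xi>' i)"
        using n_agent[OF i] vec_dist_nonneg[OF Va[OF i]] by (intro mult_right_mono) auto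
      with vec_dist_l1[OF Va[OF i], of "fst \<xi> i" "fst \<xi>' i"]
      show "vec_l1 (ag_dim (ag i)) (fst \<xi> i) (fst \<xi>' i) \<le> real n * vec_dist (Va i) (fst \<xi> i) (fst \<xi>' i)"
        by linarith
    qed
    then have 1: "(\<Sum>i=1..N. vec_l1 (ag_dim (ag i)) (fst \<xi> i) (fst \<xi>' i)) \<le> real n * agent_dist \<xi> \<xi>'"
      unfolding agent_dist_def sum_distrib_left .
    have 2: "vec_l1 (fi_dim F) (fst (snd \<xi>)) (fst (snd \<xi>')) \<le> real n * filter_dist \<xi> \<xi>'"
      unfolding filter_dist_def
      by (rule order_trans[OF vec_dist_l1[OF Vf] mult_right_mono[OF _ vec_dist_nonneg[OF Vf]]]) (simp add: n_def sum_nonneg)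
    have 3: "vec_l1 (co_dim C) (snd (snd \<xi>)) (snd (snd \<xi>')) \<le> real n * controller_dist \<xi> \<xi>'"
      unfolding controller_dist_def
      by (rule order_trans[OF vec_dist_l1[OF Vc] mult_right_mono[OF _ vec_dist_nonneg[OF Vc]]]) (simp add: n_def sum_nonneg)
    have "real n * agent_dist \<xi> \<xi>' \<le> real n * loop_dist \<xi> \<xi>'"
      "real n * filter_dist \<xi> \<xi>' \<le> real n * loop_dist \<xi> \<xi>'"
      "real n * controller_dist \<xi> \<xi>' \<le> real n * loop_dist \<xi> \<xi>'"
      by (rule mult_left_mono[OF parts_le_loop_dist(1)], simp,
          rule mult_left_mono[OF parts_le_loop_dist(2)], simp,
          rule mult_left_mono[OF parts_le_loop_dist(3)], simp)
    then have "state_l1 N ag F C \<xi> \<xi>' \<le> 3 * real n * loop_dist \<xi> \<xi>'"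
      using 1 2 3 unfolding state_l1_def by linarith
    also have "\<dots> \<le> K * loop_dist \<xi> \<xi>'"
      using K(3) parts_le_loop_dist(2)[of \<xi> \<xi>'] part_dists_nonneg(2)[of \<xi> \<xi>'] by (intro mult_right_mono) auto
    finally show ?thesis .
  qed
  show thesis using K(1) upper lower by (rule that)
qed

lemma choices_mem:
  "\<beta> \<in> choices \<Longrightarrow> i \<in> {1..N} \<Longrightarrow> fst (\<beta> i) \<in> {1..ag_w (ag i)} \<and> snd (\<beta> i) \<in> {1..ag_h (ag i)}"
  unfolding choices_def PiE_dflt_def by force

lemma next_state_closed:
  assumes \<beta>: "\<beta> \<in> choices" and \<xi>: "\<xi> \<in> states"
  shows "next_state N ag r F C \<beta> \<xi> \<in> states"
proof -
  obtain x x\<^sub>f x\<^sub>c where eq: "\<xi> = (x, x\<^sub>f, x\<^sub>c)" by (metis surj_pair)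
  note mem = \<xi>[unfolded eq states_iff]
  have "ag_A (ag i) *\<^sub>v x i + ag_b (ag i) (fst (\<beta> i)) \<in> carrier_vec (ag_dim (ag i))" if "i \<in> {1..N}" for i
    using dims[OF that] choices_mem[OF \<beta> that] mem that unfolding agent_dims_def
    by (auto simp: PiE_iff intro!: add_carrier_vec)
  then show ?thesis
    unfolding eq next_state_def prod.case states_iff
    using mem filter_dims controller_dims unfolding filter_dims_def controller_dims_def by auto
qed

lemma broadcast_lipschitz:
  obtains L where "0 < L"
    "\<And>\<xi> \<xi>'. \<xi> \<in> states \<Longrightarrow> \<xi>' \<in> states \<Longrightarrow>
       \<bar>broadcast r F C \<xi> - broadcast r F C \<xi>'\<bar> \<le> L * loop_dist \<xi> \<xi>'"
proof -
  define Lc where "Lc = (\<Sum>j<co_dim C. \<bar>co_C C $ j\<bar>)"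
  define Lf where "Lf = (\<Sum>j<fi_dim F. \<bar>fi_C F $ j\<bar>)"
  define L where "L = Lc + \<bar>co_D C\<bar> * Lf + 1"
  have nn: "0 \<le> Lc" "0 \<le> Lf" by (simp_all add: Lc_def Lf_def sum_nonneg)
  have "\<bar>broadcast r F C \<xi> - broadcast r F C \<xi>'\<bar> \<le> L * loop_dist \<xi> \<xi>'"
    if "\<xi> \<in> states" "\<xi>' \<in> states" for \<xi> \<xi>'
  proof -
    obtain x x\<^sub>f x\<^sub>c y y\<^sub>f y\<^sub>c where eq: "\<xi> = (x, x\<^sub>f, x\<^sub>c)" "\<xi>' = (y, y\<^sub>f, y\<^sub>c)" by (metis surj_pair)
    note mem = that[unfolded eq states_iff]
    define dc where "dc = co_C C \<bullet> x\<^sub>c - co_C C \<bullet> y\<^sub>c"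
    define df where "df = fi_C F \<bullet> x\<^sub>f - fi_C F \<bullet> y\<^sub>f"
    have "\<bar>dc\<bar> \<le> Lc * controller_dist \<xi> \<xi>'"
      using scalar_prod_vec_dist[OF Vc] mem by (simp add: Lc_def dc_def controller_dist_def eq)
    also have "\<dots> \<le> Lc * loop_dist \<xi> \<xi>'" using nn by (intro mult_left_mono parts_le_loop_dist)
    finally have 1: "\<bar>dc\<bar> \<le> Lc * loop_dist \<xi> \<xi>'" .
    have "\<bar>df\<bar> \<le> Lf * filter_dist \<xi> \<xi>'"
      using scalar_prod_vec_dist[OF Vf] mem by (simp add: Lf_def df_def filter_dist_def eq)
    also have "\<dots> \<le> Lf * loop_dist \<xi> \<xi>'" using nn by (intro mult_left_mono parts_le_loop_dist)
    finally have 2: "\<bar>co_D C\<bar> * \<bar>df\<bar> \<le> \<bar>co_D C\<bar> * (Lf * loop_dist \<xi> \<xi>')" by (rule mult_left_mono) simp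
    have "broadcast r F C \<xi> - broadcast r F C \<xi>' = dc - co_D C * df"
      by (simp add: broadcast_def control_error_def eq dc_def df_def algebra_simps)
    then have "\<bar>broadcast r F C \<xi> - broadcast r F C \<xi>'\<bar> \<le> \<bar>dc\<bar> + \<bar>co_D C\<bar> * \<bar>df\<bar>"
      using abs_triangle_ineq4[of dc "co_D C * df"] by (simp add: abs_mult)
    also have "\<dots> \<le> Lc * loop_dist \<xi> \<xi>' + \<bar>co_D C\<bar> * (Lf * loop_dist \<xi> \<xi>') + loop_dist \<xi> \<xi>'"
      using 1 2 parts_le_loop_dist(2)[of \<xi> \<xi>'] part_dists_nonneg(2)[of \<xi> \<xi>'] by linarith
    also have "\<dots> = L * loop_dist \<xi> \<xi>'" by (simp add: L_def distrib_right mult.assoc)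
    finally show ?thesis .
  qed
  moreover have "0 < L" using nn by (simp add: L_def add_nonneg_pos)
  ultimately show thesis by (intro that)
qed

text \<open>
  The offsets cancel when the same choices are made in both copies, and the difference of the states evolves
  as in the undisturbed cascade.
\<close>

lemma next_state_contraction:
  assumes \<beta>: "\<beta> \<in> choices" and \<xi>: "\<xi> \<in> states" "\<xi>' \<in> states"
  shows "loop_dist (next_state N ag r F C \<beta> \<xi>) (next_state N ag r F C \<beta> \<xi>') \<le> \<tau> * loop_dist \<xi> \<xi>'"
proof -
  obtain x x\<^sub>f x\<^sub>c y y\<^sub>f y\<^sub>c where eq: "\<xi> = (x, x\<^sub>f, x\<^sub>c)" "\<xi>' = (y, y\<^sub>f, y\<^sub>c)" by (metis surj_pair)
  note mem = \<xi>[unfolded eq states_iff]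
  have xy: "x i \<in> carrier_vec (ag_dim (ag i))" "y i \<in> carrier_vec (ag_dim (ag i))" if "i \<in> {1..N}" for i
    using mem that by (auto simp: PiE_iff)
  let ?\<xi> = "next_state N ag r F C \<beta> \<xi>" and ?\<xi>' = "next_state N ag r F C \<beta> \<xi>'"
  have agents: "agent_dist ?\<xi> ?\<xi>' \<le> \<sigma> * agent_dist \<xi> \<xi>'"
  proof -
    have "agent_dist ?\<xi> ?\<xi>' \<le> (\<Sum>i=1..N. \<sigma> * vec_dist (Va i) (x i) (y i))"
      unfolding agent_dist_def
    proof (rule sum_mono)
      fix i assume i: "i \<in> {1..N}"
      have "vec_dist (Va i) (ag_A (ag i) *\<^sub>v x i + ag_b (ag i) (fst (\<beta> i)))
          (ag_A (ag i) *\<^sub>v y i + ag_b (ag i) (fst (\<beta> i))) \<le> \<sigma> * vec_dist (Va i) (x i) (y i)"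
        using dims[OF i] choices_mem[OF \<beta> i] xy[OF i] unfolding agent_dims_def
        by (intro vec_dist_affine_shift[OF Va[OF i]]) auto
      then show "vec_dist (Va i) (fst ?\<xi> i) (fst ?\<xi>' i) \<le> \<sigma> * vec_dist (Va i) (x i) (y i)"
        using i by (simp add: next_state_def eq)
    qed
    then show ?thesis by (simp add: agent_dist_def eq sum_distrib_left)
  qed
  define u where "u = aggregate_output N ag \<beta> \<xi>"
  define u' where "u' = aggregate_output N ag \<beta> \<xi>'"
  define Lc where "Lc = (\<Sum>i=1..N. \<Sum>j<ag_dim (ag i). \<bar>ag_c (ag i) $ j\<bar>)"
  have output_bound: "\<bar>u - u'\<bar> \<le> Lc * agent_dist \<xi> \<xi>'"
  proof -
    have diff: "u - u' = (\<Sum>i=1..N. ag_c (ag i) \<bullet> x i - ag_c (ag i) \<bullet> y i)"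
      by (simp add: u_def u'_def aggregate_output_def eq flip: sum_subtractf)
    have "\<bar>u - u'\<bar> \<le> (\<Sum>i=1..N. Lc * vec_dist (Va i) (x i) (y i))"
      unfolding diff
    proof (rule order_trans[OF sum_abs], rule sum_mono)
      fix i assume i: "i \<in> {1..N}"
      have "\<bar>ag_c (ag i) \<bullet> x i - ag_c (ag i) \<bullet> y i\<bar> \<le> (\<Sum>j<ag_dim (ag i). \<bar>ag_c (ag i) $ j\<bar>) * vec_dist (Va i) (x i) (y i)"
        by (rule scalar_prod_vec_dist[OF Va[OF i] xy[OF i]])
      also have "\<dots> \<le> Lc * vec_dist (Va i) (x i) (y i)"
        unfolding Lc_def using i
        by (intro mult_right_mono vec_dist_nonneg[OF Va[OF i]]
            member_le_sum[of i "{1..N}" "\<lambda>i. \<Sum>j<ag_dim (ag i). \<bar>ag_c (ag i) $ j\<bar>"])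
          (auto intro: sum_nonneg)
      finally show "\<bar>ag_c (ag i) \<bullet> x i - ag_c (ag i) \<bullet> y i\<bar> \<le> Lc * vec_dist (Va i) (x i) (y i)" .
    qed
    then show ?thesis by (simp add: agent_dist_def eq sum_distrib_left)
  qed
  have filter: "filter_dist ?\<xi> ?\<xi>' \<le> \<sigma> * filter_dist \<xi> \<xi>' + filter_gain * agent_dist \<xi> \<xi>'"
  proof -
    have "filter_dist ?\<xi> ?\<xi>' \<le> \<sigma> * filter_dist \<xi> \<xi>' + \<bar>u - u'\<bar> * Vf (\<lambda>j. fi_B F $ j)"
      using vec_dist_affine[OF Vf, of x\<^sub>f y\<^sub>f "fi_B F" u u'] mem filter_dims
      unfolding filter_dims_def by (simp add: filter_dist_def next_state_def eq u_def u'_def)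
    also have "\<dots> \<le> \<sigma> * filter_dist \<xi> \<xi>' + Lc * agent_dist \<xi> \<xi>' * Vf (\<lambda>j. fi_B F $ j)"
      by (intro add_left_mono mult_right_mono output_bound lyapunov_norm_nonneg[OF Vf])
    finally show ?thesis by (simp add: filter_gain_def Lc_def mult_ac)
  qed
  have controller: "controller_dist ?\<xi> ?\<xi>' \<le> \<sigma> * controller_dist \<xi> \<xi>' + controller_gain * filter_dist \<xi> \<xi>'"
  proof -
    define e where "e = control_error r F \<xi>"
    define e' where "e' = control_error r F \<xi>'"
    have "\<bar>e - e'\<bar> = \<bar>fi_C F \<bullet> x\<^sub>f - fi_C F \<bullet> y\<^sub>f\<bar>"
      by (simp add: e_def e'_def control_error_def eq abs_minus_commute)
    also have "\<dots> \<le> (\<Sum>j<fi_dim F. \<bar>fi_C F $ j\<bar>) * filter_dist \<xi> \<xi>'"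
      unfolding filter_dist_def eq fst_conv snd_conv using mem by (intro scalar_prod_vec_dist[OF Vf]) auto
    finally have err: "\<bar>e - e'\<bar> \<le> (\<Sum>j<fi_dim F. \<bar>fi_C F $ j\<bar>) * filter_dist \<xi> \<xi>'" .
    have "controller_dist ?\<xi> ?\<xi>' \<le> \<sigma> * controller_dist \<xi> \<xi>' + \<bar>e - e'\<bar> * Vc (\<lambda>j. co_B C $ j)"
      using vec_dist_affine[OF Vc, of x\<^sub>c y\<^sub>c "co_B C" e e'] mem controller_dims
      unfolding controller_dims_def by (simp add: controller_dist_def next_state_def eq e_def e'_def)
    also have "\<dots> \<le> \<sigma> * controller_dist \<xi> \<xi>' +
        (\<Sum>j<fi_dim F. \<bar>fi_C F $ j\<bar>) * filter_dist \<xi> \<xi>' * Vc (\<lambda>j. co_B C $ j)"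
      by (intro add_left_mono mult_right_mono err lyapunov_norm_nonneg[OF Vc])
    finally show ?thesis by (simp add: controller_gain_def mult_ac)
  qed
  have "agent_weight * agent_dist ?\<xi> ?\<xi>' \<le> agent_weight * (\<sigma> * agent_dist \<xi> \<xi>')"
    "filter_weight * filter_dist ?\<xi> ?\<xi>' \<le> filter_weight * (\<sigma> * filter_dist \<xi> \<xi>' + filter_gain * agent_dist \<xi> \<xi>')"
    using agents filter weights_ge_1 by (auto intro: mult_left_mono)
  moreover have "filter_weight * filter_gain * agent_dist \<xi> \<xi>' \<le> agent_weight * (\<tau> - \<sigma>) * agent_dist \<xi> \<xi>'"
    "controller_gain * filter_dist \<xi> \<xi>' \<le> filter_weight * (\<tau> - \<sigma>) * filter_dist \<xi> \<xi>'"
    by (intro mult_right_mono weights_absorb_gains part_dists_nonneg)+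
  moreover have "\<sigma> * controller_dist \<xi> \<xi>' \<le> \<tau> * controller_dist \<xi> \<xi>'"
    using tau by (intro mult_right_mono part_dists_nonneg) auto
  ultimately show ?thesis
    using controller unfolding loop_dist_def by (simp add: algebra_simps)
qed

abbreviation offset_pmf :: "nat \<Rightarrow> real \<Rightarrow> nat pmf" where
  "offset_pmf i s \<equiv> index_pmf (ag_w (ag i)) (\<lambda>j. ag_p (ag i) j s)"

abbreviation output_pmf :: "nat \<Rightarrow> real \<Rightarrow> nat pmf" where
  "output_pmf i s \<equiv> index_pmf (ag_h (ag i)) (\<lambda>l. ag_p' (ag i) l s)"

abbreviation choice :: "state \<Rightarrow> (nat \<Rightarrow> nat \<times> nat) pmf" where
  "choice \<xi> \<equiv> choice_pmf N ag (broadcast r F C \<xi>)"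

definition agent_prob :: "(nat \<Rightarrow> nat \<times> nat) \<Rightarrow> real \<Rightarrow> nat \<Rightarrow> real" where
  "agent_prob \<beta> s i = ag_p (ag i) (fst (\<beta> i)) s * ag_p' (ag i) (snd (\<beta> i)) s"

lemma pmf_letter:
  assumes "i \<in> {1..N}" "s \<in> Adm"
  shows "pmf (offset_pmf i s) j = (if j \<in> {1..ag_w (ag i)} then ag_p (ag i) j s else 0)"
    "pmf (output_pmf i s) l = (if l \<in> {1..ag_h (ag i)} then ag_p' (ag i) l s else 0)"
proof -
  show "pmf (offset_pmf i s) j = (if j \<in> {1..ag_w (ag i)} then ag_p (ag i) j s else 0)"
  proof (rule pmf_index_pmf)
    show "0 \<le> ag_p (ag i) j s" if "j \<in> {1..ag_w (ag i)}" for j using p_range[OF assms(1) that assms(2)] by simp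
  qed (rule p_sum[OF assms])
  show "pmf (output_pmf i s) l = (if l \<in> {1..ag_h (ag i)} then ag_p' (ag i) l s else 0)"
  proof (rule pmf_index_pmf)
    show "0 \<le> ag_p' (ag i) l s" if "l \<in> {1..ag_h (ag i)}" for l using p'_range[OF assms(1) that assms(2)] by simp
  qed (rule p'_sum[OF assms])
qed

lemma pmf_choice:
  assumes \<beta>: "\<beta> \<in> choices" and s: "s \<in> Adm"
  shows "pmf (choice_pmf N ag s) \<beta> = (\<Prod>i=1..N. agent_prob \<beta> s i)"
proof -
  have "pmf (choice_pmf N ag s) \<beta> =
      (\<Prod>i=1..N. pmf (pair_pmf (offset_pmf i s) (output_pmf i s)) (\<beta> i))"
    unfolding choice_pmf_def using \<beta> by (intro pmf_Pi') (auto simp: choices_def PiE_dflt_def)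
  also have "\<dots> = (\<Prod>i=1..N. agent_prob \<beta> s i)"
  proof (rule prod.cong[OF refl])
    fix i assume i: "i \<in> {1..N}"
    have "pmf (pair_pmf (offset_pmf i s) (output_pmf i s)) (fst (\<beta> i), snd (\<beta> i)) = agent_prob \<beta> s i"
      unfolding pmf_pair pmf_letter[OF i s] agent_prob_def using choices_mem[OF \<beta> i] by simp
    then show "pmf (pair_pmf (offset_pmf i s) (output_pmf i s)) (\<beta> i) = agent_prob \<beta> s i" by simp
  qed
  finally show ?thesis .
qed

lemma set_choice: "s \<in> Adm \<Longrightarrow> set_pmf (choice_pmf N ag s) \<subseteq> choices"
  unfolding choice_pmf_def choices_def
proof -
  assume s: "s \<in> Adm"
  have "set_pmf (pair_pmf (offset_pmf i s) (output_pmf i s)) \<subseteq> {1..ag_w (ag i)} \<times> {1..ag_h (ag i)}"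
    if "i \<in> {1..N}" for i
  proof -
    have "set_pmf (offset_pmf i s) \<subseteq> {1..ag_w (ag i)}"
      "set_pmf (output_pmf i s) \<subseteq> {1..ag_h (ag i)}"
      using pmf_letter[OF that s] by (auto simp: set_pmf_eq split: if_splits)
    then show ?thesis unfolding set_pair_pmf by (rule Sigma_mono)
  qed
  then show "set_pmf (Pi_pmf {1..N} (0, 0) (\<lambda>i. pair_pmf (offset_pmf i s) (output_pmf i s)))
    \<subseteq> PiE_dflt {1..N} (0, 0) (\<lambda>i. {1..ag_w (ag i)} \<times> {1..ag_h (ag i)})"
    unfolding set_Pi_pmf[OF finite_atLeastAtMost] PiE_dflt_def o_def by blast
qed

text \<open>
  Each of the \<open>N\<close> agents contributes the factor \<open>\<delta> \<delta>'\<close> for its two choices.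
\<close>

lemma choice_ge:
  assumes \<beta>: "\<beta> \<in> choices" and s: "s \<in> Adm"
  shows "(\<delta> * \<delta>') ^ N \<le> pmf (choice_pmf N ag s) \<beta>"
proof -
  have "(\<Prod>i=1..N. \<delta> * \<delta>') \<le> (\<Prod>i=1..N. agent_prob \<beta> s i)"
    using p_bound p'_bound choices_mem[OF \<beta>] s delta_pos
    by (intro prod_mono) (auto simp: agent_prob_def intro!: mult_mono order_trans[OF less_imp_le[OF delta_pos(1)] p_bound])
  then show ?thesis by (simp add: pmf_choice[OF \<beta> s])
qed

definition choice_modulus :: "real \<Rightarrow> real" where
  "choice_modulus t = (\<Sum>i=1..N. (\<Sum>j=1..ag_w (ag i). real_modulus Adm (ag_p (ag i) j) t)
     + (\<Sum>l=1..ag_h (ag i). real_modulus Adm (ag_p' (ag i) l) t))"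

lemma choice_modulus_mono: "s \<le> t \<Longrightarrow> choice_modulus s \<le> choice_modulus t"
  unfolding choice_modulus_def
  by (intro sum_mono add_mono real_modulus_mono p_range p'_range) auto

lemma choice_modulus_summable:
  "0 < R \<Longrightarrow> summable (\<lambda>n. choice_modulus (R * \<tau> ^ n))"
  unfolding choice_modulus_def using tau
  by (intro summable_sum summable_add Dini_summable p_Dini p'_Dini p_range p'_range) auto

text \<open>
  A product of numbers in the unit interval changes by at most the sum of the changes of its factors.
\<close>

lemma choice_modulus_bound:
  assumes \<beta>: "\<beta> \<in> choices" and s: "s \<in> Adm" "s' \<in> Adm" "\<bar>s - s'\<bar> \<le> t"
  shows "\<bar>pmf (choice_pmf N ag s) \<beta> - pmf (choice_pmf N ag s') \<beta>\<bar> \<le> choice_modulus t"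
proof -
  have range: "agent_prob \<beta> s i \<in> {0..1}" if "i \<in> {1..N}" "s \<in> Adm" for i s
    using p_range[of i "fst (\<beta> i)" s] p'_range[of i "snd (\<beta> i)" s] choices_mem[OF \<beta> that(1)] that
    by (auto simp: agent_prob_def intro: mult_le_one)
  have "\<bar>(\<Prod>i=1..N. agent_prob \<beta> s i) - (\<Prod>i=1..N. agent_prob \<beta> s' i)\<bar>
      \<le> (\<Sum>i=1..N. \<bar>agent_prob \<beta> s i - agent_prob \<beta> s' i\<bar>)"
    using norm_prod_diff[of "{1..N}" "agent_prob \<beta> s" "agent_prob \<beta> s'"] range s by force
  also have "\<dots> \<le> choice_modulus t"
    unfolding choice_modulus_def
  proof (rule sum_mono)
    fix i assume i: "i \<in> {1..N}"
    define j l where "j = fst (\<beta> i)" and "l = snd (\<beta> i)"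
    have jl: "j \<in> {1..ag_w (ag i)}" "l \<in> {1..ag_h (ag i)}"
      using choices_mem[OF \<beta> i] by (auto simp: j_def l_def)
    have r: "\<bar>ag_p' (ag i) l s\<bar> \<le> 1" "\<bar>ag_p (ag i) j s'\<bar> \<le> 1"
      using p'_range[OF i jl(2) s(1)] p_range[OF i jl(1) s(2)] by auto
    have "agent_prob \<beta> s i - agent_prob \<beta> s' i =
        (ag_p (ag i) j s - ag_p (ag i) j s') * ag_p' (ag i) l s + ag_p (ag i) j s' * (ag_p' (ag i) l s - ag_p' (ag i) l s')"
      by (simp add: agent_prob_def j_def l_def algebra_simps)
    then have "\<bar>agent_prob \<beta> s i - agent_prob \<beta> s' i\<bar>
        \<le> \<bar>ag_p (ag i) j s - ag_p (ag i) j s'\<bar> * \<bar>ag_p' (ag i) l s\<bar> + \<bar>ag_p (ag i) j s'\<bar> * \<bar>ag_p' (ag i) l s - ag_p' (ag i) l s'\<bar>"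
      unfolding abs_mult[symmetric] by (simp only: abs_triangle_ineq)
    also have "\<dots> \<le> \<bar>ag_p (ag i) j s - ag_p (ag i) j s'\<bar> + \<bar>ag_p' (ag i) l s - ag_p' (ag i) l s'\<bar>"
      using r by (intro add_mono) (auto intro: mult_left_le mult_left_le_one_le)
    also have "\<dots> \<le> real_modulus Adm (ag_p (ag i) j) t + real_modulus Adm (ag_p' (ag i) l) t"
      using i jl s by (intro add_mono real_modulus_bound p_range p'_range) auto
    also have "\<dots> \<le> (\<Sum>j=1..ag_w (ag i). real_modulus Adm (ag_p (ag i) j) t)
        + (\<Sum>l=1..ag_h (ag i). real_modulus Adm (ag_p' (ag i) l) t)"
      using jl member_le_sum[of j "{1..ag_w (ag i)}" "\<lambda>j. real_modulus Adm (ag_p (ag i) j) t"]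
        member_le_sum[of l "{1..ag_h (ag i)}" "\<lambda>l. real_modulus Adm (ag_p' (ag i) l) t"]
      by (simp add: real_modulus_nonneg)
    finally show "\<bar>agent_prob \<beta> s i - agent_prob \<beta> s' i\<bar> \<le> (\<Sum>j=1..ag_w (ag i). real_modulus Adm (ag_p (ag i) j) t)
        + (\<Sum>l=1..ag_h (ag i). real_modulus Adm (ag_p' (ag i) l) t)" .
  qed
  finally show ?thesis by (simp add: pmf_choice[OF \<beta>] s)
qed

theorem converges_to_unique_invariant_loop:
  "converges_to_unique_invariant (state_topology N ag F C) (loop_kernel N ag r F C)"
proof -
  obtain K where K: "0 < K" "\<And>\<xi> \<xi>'. loop_dist \<xi> \<xi>' \<le> K * state_l1 N ag F C \<xi> \<xi>'"
    "\<And>\<xi> \<xi>'. state_l1 N ag F C \<xi> \<xi>' \<le> K * loop_dist \<xi> \<xi>'"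
    using loop_dist_equivalent by blast
  note topology = state_metric_topology[OF metric_loop_dist K]
  obtain L where L: "0 < L" "\<And>\<xi> \<xi>'. \<xi> \<in> states \<Longrightarrow> \<xi>' \<in> states \<Longrightarrow>
       \<bar>broadcast r F C \<xi> - broadcast r F C \<xi>'\<bar> \<le> L * loop_dist \<xi> \<xi>'"
    using broadcast_lipschitz by blast
  interpret place_dependent_ifs states loop_dist choices "next_state N ag r F C" choice \<tau>
    "(\<delta> * \<delta>') ^ N" "\<lambda>t. choice_modulus (L * t)"
  proof (intro place_dependent_ifs.intro metric_loop_dist place_dependent_ifs_axioms.intro)
    have "((\<lambda>i\<in>{1..N}. 0\<^sub>v (ag_dim (ag i))), 0\<^sub>v (fi_dim F), 0\<^sub>v (co_dim C)) \<in> states"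
      unfolding states_iff by auto
    then show "states \<noteq> {}" by blast
    show "finite choices" unfolding choices_def by (intro finite_PiE_dflt) auto
    show "next_state N ag r F C \<beta> \<xi> \<in> states" if "\<beta> \<in> choices" "\<xi> \<in> states" for \<beta> \<xi>
      using that by (rule next_state_closed)
    show "loop_dist (next_state N ag r F C \<beta> \<xi>) (next_state N ag r F C \<beta> \<xi>') \<le> \<tau> * loop_dist \<xi> \<xi>'"
      if "\<beta> \<in> choices" "\<xi> \<in> states" "\<xi>' \<in> states" for \<beta> \<xi> \<xi>'
      using that by (rule next_state_contraction)
    show "0 < \<tau>" "\<tau> < 1" using tau by auto
    show "set_pmf (choice \<xi>) \<subseteq> choices" if "\<xi> \<in> states" for \<xi>
      using admissible[OF that] by (rule set_choice)
    show "0 < (\<delta> * \<delta>') ^ N" using delta_pos by simp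
    show "(\<delta> * \<delta>') ^ N \<le> pmf (choice \<xi>) \<beta>" if "\<beta> \<in> choices" "\<xi> \<in> states" for \<beta> \<xi>
      using that(1) admissible[OF that(2)] by (rule choice_ge)
    show "\<bar>pmf (choice \<xi>) \<beta> - pmf (choice \<xi>') \<beta>\<bar> \<le> choice_modulus (L * loop_dist \<xi> \<xi>')"
      if "\<beta> \<in> choices" "\<xi> \<in> states" "\<xi>' \<in> states" for \<beta> \<xi> \<xi>'
      using that by (intro choice_modulus_bound admissible L)
    show "choice_modulus (L * s) \<le> choice_modulus (L * t)" if "0 \<le> s" "s \<le> t" for s t
      using that L(1) by (intro choice_modulus_mono mult_left_mono) auto
    show "summable (\<lambda>n. choice_modulus (L * (R * \<tau> ^ n)))" if "0 < R" for R
      using choice_modulus_summable[of "L * R"] that L(1) by (simp add: mult.assoc)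
    show "compactin (Metric_space.mtopology states loop_dist) (Metric_space.mcball states loop_dist \<xi> R)"
      if "\<xi> \<in> states" for \<xi> R
      unfolding topology(1) using that by (rule topology(2))
  qed
  have "kernel = loop_kernel N ag r F C"
    unfolding fun_eq_iff kernel_def loop_kernel_def topology(1) by simp
  then show ?thesis using converges_to_unique_invariant_kernel unfolding topology(1) by simp
qed

end

section \<open>Convergence to a unique invariant measure\<close>

theorem theorem12:
  fixes N :: nat
    and ag :: "nat \<Rightarrow> affine_agent"
    and Adm :: "real set"
    and \<delta> \<delta>' r :: real
  assumes dims: "\<And>i. i \<in> {1..N} \<Longrightarrow> agent_dims (ag i)"
    and schur_agents: "\<And>i. i \<in> {1..N} \<Longrightarrow> schur (ag_A (ag i))"
    and p_range: "\<And>i j s. i \<in> {1..N} \<Longrightarrow> j \<in> {1..ag_w (ag i)} \<Longrightarrow> s \<in> Adm \<Longrightarrow>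
                    ag_p (ag i) j s \<in> {0..1}"
    and p'_range: "\<And>i l s. i \<in> {1..N} \<Longrightarrow> l \<in> {1..ag_h (ag i)} \<Longrightarrow> s \<in> Adm \<Longrightarrow>
                    ag_p' (ag i) l s \<in> {0..1}"
    and p_Dini: "\<And>i j. i \<in> {1..N} \<Longrightarrow> j \<in> {1..ag_w (ag i)} \<Longrightarrow>
                    Dini_continuous_on Adm (ag_p (ag i) j)"
    and p'_Dini: "\<And>i l. i \<in> {1..N} \<Longrightarrow> l \<in> {1..ag_h (ag i)} \<Longrightarrow>
                    Dini_continuous_on Adm (ag_p' (ag i) l)"
    and p_sum: "\<And>i s. i \<in> {1..N} \<Longrightarrow> s \<in> Adm \<Longrightarrow> (\<Sum>j=1..ag_w (ag i). ag_p (ag i) j s) = 1"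
    and p'_sum: "\<And>i s. i \<in> {1..N} \<Longrightarrow> s \<in> Adm \<Longrightarrow> (\<Sum>l=1..ag_h (ag i). ag_p' (ag i) l s) = 1"
    and delta_pos: "\<delta> > 0" "\<delta>' > 0"
    and p_bound: "\<And>i j s. i \<in> {1..N} \<Longrightarrow> j \<in> {1..ag_w (ag i)} \<Longrightarrow> s \<in> Adm \<Longrightarrow>
                    ag_p (ag i) j s \<ge> \<delta>"
    and p'_bound: "\<And>i l s. i \<in> {1..N} \<Longrightarrow> l \<in> {1..ag_h (ag i)} \<Longrightarrow> s \<in> Adm \<Longrightarrow>
                    ag_p' (ag i) l s \<ge> \<delta>'"
  shows "\<forall>F C. filter_dims F \<and> schur (fi_A F) \<and> controller_dims C \<and> schur (co_A C) \<and>
           (\<forall>\<xi> \<in> topspace (state_topology N ag F C). broadcast r F C \<xi> \<in> Adm) \<longrightarrow>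
           converges_to_unique_invariant (state_topology N ag F C) (loop_kernel N ag r F C)"
proof (intro allI impI, elim conjE)
  fix F C
  assume F: "filter_dims F" "schur (fi_A F)" and C: "controller_dims C" "schur (co_A C)"
    and adm: "\<forall>\<xi> \<in> topspace (state_topology N ag F C). broadcast r F C \<xi> \<in> Adm"
  have "\<exists>V \<sigma>. 0 < \<sigma> \<and> \<sigma> < 1 \<and> lyapunov_norm (ag_dim (ag i)) (ag_A (ag i)) \<sigma> V" if "i \<in> {1..N}" for i
  proof -
    have "ag_A (ag i) \<in> carrier_mat (ag_dim (ag i)) (ag_dim (ag i))"
      using dims[OF that] by (simp add: agent_dims_def)
    from schur_lyapunov_norm[OF this schur_agents[OF that]] show ?thesis by metis
  qed
  then obtain Va \<sigma>a where Va: "\<And>i. i \<in> {1..N} \<Longrightarrow> 0 < \<sigma>a i \<and> \<sigma>a i < 1 \<and>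
      lyapunov_norm (ag_dim (ag i)) (ag_A (ag i)) (\<sigma>a i) (Va i)"
    by metis
  obtain Vf \<sigma>f where Vf: "0 < \<sigma>f" "\<sigma>f < 1" "lyapunov_norm (fi_dim F) (fi_A F) \<sigma>f Vf"
    using schur_lyapunov_norm[of "fi_A F" "fi_dim F"] F unfolding filter_dims_def by metis
  obtain Vc \<sigma>c where Vc: "0 < \<sigma>c" "\<sigma>c < 1" "lyapunov_norm (co_dim C) (co_A C) \<sigma>c Vc"
    using schur_lyapunov_norm[of "co_A C" "co_dim C"] C unfolding controller_dims_def by metis
  \<comment> \<open>Rates may be increased, so the maximum serves all blocks at once.\<close>
  define \<sigma> where "\<sigma> = Max (insert \<sigma>f (insert \<sigma>c (\<sigma>a ` {1..N})))"
  have \<sigma>: "\<sigma>f \<le> \<sigma>" "\<sigma>c \<le> \<sigma>" "\<And>i. i \<in> {1..N} \<Longrightarrow> \<sigma>a i \<le> \<sigma>" "\<sigma> < 1"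
    unfolding \<sigma>_def using Va Vf(2) Vc(2) by (auto intro!: Max_ge simp del: Max_insert)
  interpret closed_loop N ag Adm \<delta> \<delta>' r F C Va Vf Vc \<sigma>
  proof (rule closed_loop.intro; (fact | assumption)?)
    show "broadcast r F C \<xi> \<in> Adm" if "\<xi> \<in> topspace (state_topology N ag F C)" for \<xi>
      using adm that by blast
    show "0 < \<sigma>" using Vf(1) \<sigma>(1) by linarith
    show "lyapunov_norm (ag_dim (ag i)) (ag_A (ag i)) \<sigma> (Va i)" if "i \<in> {1..N}" for i
      using lyapunov_norm_mono Va[OF that] \<sigma>(3)[OF that] by blast
    show "lyapunov_norm (fi_dim F) (fi_A F) \<sigma> Vf" by (rule lyapunov_norm_mono[OF Vf(3) \<sigma>(1)])
    show "lyapunov_norm (co_dim C) (co_A C) \<sigma> Vc" by (rule lyapunov_norm_mono[OF Vc(3) \<sigma>(2)])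
  qed
  show "converges_to_unique_invariant (state_topology N ag F C) (loop_kernel N ag r F C)"
    by (rule converges_to_unique_invariant_loop)
qed

end
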